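(* Let $k$ be an algebraically closed field of characteristic zero, let $n\geqslant 1$, and let a unipotent affine algebraic group $U$ over $k$ act regularly on the affine space $\mathbf{A}^n$ over $k$. If $$\max_{a\in \mathbf{A}^n}\dim U\cdot a=n-1,$$ then $k[\mathbf{A}^n]^U=k[c]$, where $c$ is a rational coordinate in $k[\mathbf{A}^n]$.
   Context: $U\cdot a$ denotes the $U$-orbit of $a$. A regular action is one for which the action map $U\times \mathbf{A}^n\to\mathbf{A}^n$ is a morphism of varieties. $k[\mathbf{A}^n]=k[x_1,\ldots,x_n]$ is the algebra of regular functions on $\mathbf{A}^n$, and $k[\mathbf{A}^n]^U$ is its subalgebra of $U$-invariant elements. Definition (rational coordinate): an irreducible element $c$ of the polynomial ring $k[x_1,\ldots,x_n]$ is called a rational coordinate if there are elements $f_1,\ldots,f_{n-1}\in k(x_1,\ldots,x_n)$ such that $k(c,f_1,\ldots,f_{n-1})=k(x_1,\ldots,x_n)$. *)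

theory Defs
  imports
    "HOL-Analysis.Abstract_Topology"
    "HOL-Algebra.Group_Action"
    "HOL-Computational_Algebra.Fraction_Field"
    "HOL-Computational_Algebra.Factorial_Ring"
    "HOL-Computational_Algebra.Polynomial"
    "HOL-Library.Cardinality"
    "HOL-Library.Poly_Mapping"
    "HOL-Library.Extended_Nat"
    "HOL.Hull"
begin

text \<open>
  Affine space of dimension \<open>n\<close> over \<open>'k\<close> is \<open>'n \<Rightarrow> 'k\<close> with \<open>n = CARD('n)\<close>, and
  \<open>('n, 'k) mpoly\<close> is the ring of polynomials in the coordinates indexed by \<open>'n\<close>.
\<close>

type_synonym ('v, 'k) mpoly = "('v \<Rightarrow>\<^sub>0 nat) \<Rightarrow>\<^sub>0 'k"

definition mconst :: "'k::zero \<Rightarrow> ('v, 'k) mpoly" where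
  "mconst c = Poly_Mapping.single 0 c"

definition mpeval :: "('v::finite, 'k::comm_ring_1) mpoly \<Rightarrow> ('v \<Rightarrow> 'k) \<Rightarrow> 'k" where
  "mpeval p x = (\<Sum>m\<in>Poly_Mapping.keys p.
     Poly_Mapping.lookup p m * (\<Prod>i\<in>UNIV. x i ^ Poly_Mapping.lookup m i))"

lemma mpeval_superset:
  assumes "finite A" "Poly_Mapping.keys p \<subseteq> A"
  shows "mpeval p x = (\<Sum>m\<in>A. Poly_Mapping.lookup p m * (\<Prod>i\<in>UNIV. x i ^ Poly_Mapping.lookup m i))"
  unfolding mpeval_def using assms
  by (intro sum.mono_neutral_left) (auto simp: in_keys_iff)

lemma mpeval_zero [simp]: "mpeval 0 x = 0"
  by (simp add: mpeval_def)

lemma mpeval_single: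
  "mpeval (Poly_Mapping.single m c) x = c * (\<Prod>i\<in>UNIV. x i ^ Poly_Mapping.lookup m i)"
  by (subst mpeval_superset[of "{m}"]) auto

lemma mpeval_mconst [simp]: "mpeval (mconst c) x = c"
  by (simp add: mconst_def mpeval_single)

lemma mpeval_add [simp]: "mpeval (p + q) x = mpeval p x + mpeval q x"
proof -
  let ?A = "Poly_Mapping.keys p \<union> Poly_Mapping.keys q"
  have A: "finite ?A" by simp
  have pq: "Poly_Mapping.keys (p + q) \<subseteq> ?A" by (rule Poly_Mapping.keys_add)
  show ?thesis
    unfolding mpeval_superset[OF A pq] mpeval_superset[OF A Un_upper1] mpeval_superset[OF A Un_upper2]
    by (simp only: lookup_add distrib_right sum.distrib)
qed

lemma mpeval_sum: "mpeval (sum f A) x = (\<Sum>a\<in>A. mpeval (f a) x)"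
  by (induction A rule: infinite_finite_induct) auto

lemma mpoly_sum_monomials:
  fixes p :: "('v, 'k::comm_monoid_add) mpoly"
  shows "(\<Sum>m\<in>Poly_Mapping.keys p. Poly_Mapping.single m (Poly_Mapping.lookup p m)) = p"
proof (rule poly_mapping_eqI)
  fix k
  have "Poly_Mapping.lookup (\<Sum>m\<in>Poly_Mapping.keys p. Poly_Mapping.single m (Poly_Mapping.lookup p m)) k =
      (\<Sum>m\<in>Poly_Mapping.keys p. if m = k then Poly_Mapping.lookup p m else 0)"
    by (simp add: lookup_sum lookup_single when_def)
  also have "\<dots> = Poly_Mapping.lookup p k"
    by (simp add: sum.delta in_keys_iff)
  finally show "Poly_Mapping.lookup (\<Sum>m\<in>Poly_Mapping.keys p.
      Poly_Mapping.single m (Poly_Mapping.lookup p m)) k = Poly_Mapping.lookup p k" .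
qed

lemma mpeval_mult [simp]: "mpeval (p * q) x = mpeval p x * mpeval q x"
proof -
  have s: "mpeval (Poly_Mapping.single m c * Poly_Mapping.single m' c') x =
      mpeval (Poly_Mapping.single m c) x * mpeval (Poly_Mapping.single m' c') x" for m m' c c'
    by (simp add: mult_single mpeval_single lookup_add power_add prod.distrib)
  have "p * q = (\<Sum>m\<in>Poly_Mapping.keys p. Poly_Mapping.single m (Poly_Mapping.lookup p m)) *
      (\<Sum>m\<in>Poly_Mapping.keys q. Poly_Mapping.single m (Poly_Mapping.lookup q m))"
    by (simp only: mpoly_sum_monomials)
  also have "mpeval \<dots> x =
      mpeval (\<Sum>m\<in>Poly_Mapping.keys p. Poly_Mapping.single m (Poly_Mapping.lookup p m)) x *
      mpeval (\<Sum>m\<in>Poly_Mapping.keys q. Poly_Mapping.single m (Poly_Mapping.lookup q m)) x"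
    by (simp only: sum_product mpeval_sum s)
  finally show ?thesis
    by (simp only: mpoly_sum_monomials)
qed

definition regular_fun_on :: "('v::finite \<Rightarrow> 'k::comm_ring_1) set \<Rightarrow> (('v \<Rightarrow> 'k) \<Rightarrow> 'k) \<Rightarrow> bool" where
  "regular_fun_on X f \<longleftrightarrow> (\<exists>p. \<forall>x\<in>X. f x = mpeval p x)"

definition regular_map_on ::
    "('v::finite \<Rightarrow> 'k::comm_ring_1) set \<Rightarrow> (('v \<Rightarrow> 'k) \<Rightarrow> ('w \<Rightarrow> 'k)) \<Rightarrow> bool" where
  "regular_map_on X f \<longleftrightarrow> (\<forall>i. regular_fun_on X (\<lambda>x. f x i))"

definition zariski :: "('v::finite \<Rightarrow> 'k::idom) topology" where
  "zariski = topology (\<lambda>S. \<exists>P. S = - {x. \<forall>p\<in>P. mpeval p x = 0})"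

lemma istopology_zariski:
  "istopology (\<lambda>S :: ('v::finite \<Rightarrow> 'k::idom) set. \<exists>P. S = - {x. \<forall>p\<in>P. mpeval p x = 0})"
  unfolding istopology_def
proof (intro conjI allI impI)
  fix S T :: "('v \<Rightarrow> 'k) set"
  assume "\<exists>P. S = - {x. \<forall>p\<in>P. mpeval p x = 0}" "\<exists>P. T = - {x. \<forall>p\<in>P. mpeval p x = 0}"
  then obtain P Q where S: "S = - {x. \<forall>p\<in>P. mpeval p x = 0}"
    and T: "T = - {x. \<forall>p\<in>Q. mpeval p x = 0}"
    by (elim exE)
  have "x \<in> S \<inter> T \<longleftrightarrow> x \<in> - {x. \<forall>r\<in>(\<Union>p\<in>P. \<Union>q\<in>Q. {p * q}). mpeval r x = 0}" for x
    unfolding S T by simp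
  then have "S \<inter> T = - {x. \<forall>r\<in>(\<Union>p\<in>P. \<Union>q\<in>Q. {p * q}). mpeval r x = 0}"
    by (rule Set.set_eqI)
  then show "\<exists>P. S \<inter> T = - {x. \<forall>p\<in>P. mpeval p x = 0}" by (rule exI)
next
  fix \<K> :: "('v \<Rightarrow> 'k) set set"
  assume "\<forall>K\<in>\<K>. \<exists>P. K = - {x. \<forall>p\<in>P. mpeval p x = 0}"
  then obtain P where P: "\<forall>K\<in>\<K>. K = - {x. \<forall>p\<in>P K. mpeval p x = 0}"
    by (rule bchoice[THEN exE])
  have "x \<in> K \<longleftrightarrow> (\<exists>p\<in>P K. mpeval p x \<noteq> 0)" if "K \<in> \<K>" for x K
  proof -
    have "x \<in> K \<longleftrightarrow> x \<in> - {x. \<forall>p\<in>P K. mpeval p x = 0}"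
      using P[rule_format, OF that] by (rule arg_cong)
    then show ?thesis by simp
  qed
  then have "x \<in> \<Union>\<K> \<longleftrightarrow> x \<in> - {x. \<forall>p\<in>(\<Union>K\<in>\<K>. P K). mpeval p x = 0}" for x
    by auto
  then have "\<Union>\<K> = - {x. \<forall>p\<in>(\<Union>K\<in>\<K>. P K). mpeval p x = 0}"
    by (rule Set.set_eqI)
  then show "\<exists>P. \<Union>\<K> = - {x. \<forall>p\<in>P. mpeval p x = 0}" by (rule exI)
qed

lemma openin_zariski:
  "openin zariski S \<longleftrightarrow> (\<exists>P. S = - {x. \<forall>p\<in>P. mpeval p x = 0})"
  unfolding zariski_def topology_inverse'[OF istopology_zariski] ..

lemma topspace_zariski [simp]:
  "topspace (zariski :: ('v::finite \<Rightarrow> 'k::idom) topology) = UNIV"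
proof -
  have "openin (zariski :: ('v \<Rightarrow> 'k) topology) UNIV"
    unfolding openin_zariski by (rule exI[of _ "{mconst 1}"]) simp
  then have "UNIV \<subseteq> topspace (zariski :: ('v \<Rightarrow> 'k) topology)"
    by (rule openin_subset)
  then show ?thesis
    by (simp only: UNIV_eq_I subset_UNIV subset_antisym)
qed

lemma closedin_zariski:
  "closedin zariski S \<longleftrightarrow> (\<exists>P. S = {x. \<forall>p\<in>P. mpeval p x = 0})"
proof -
  have "closedin zariski S \<longleftrightarrow> openin zariski (- S)"
    by (simp add: closedin_def Compl_eq_Diff_UNIV)
  also have "\<dots> \<longleftrightarrow> (\<exists>P. S = {x. \<forall>p\<in>P. mpeval p x = 0})"
    unfolding openin_zariski by (simp only: compl_eq_compl_iff)
  finally show ?thesis .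
qed

definition irreducible_closedin :: "'a topology \<Rightarrow> 'a set \<Rightarrow> bool" where
  "irreducible_closedin X S \<longleftrightarrow> closedin X S \<and> S \<noteq> {} \<and>
     (\<forall>A B. closedin X A \<longrightarrow> closedin X B \<longrightarrow> S = A \<union> B \<longrightarrow> S = A \<or> S = B)"

text \<open>The dimension of the empty space is \<open>0\<close> here; it is only used for nonempty spaces.\<close>

definition krull_dim :: "'a topology \<Rightarrow> enat" where
  "krull_dim X = Sup {enat d | d. \<exists>Z :: nat \<Rightarrow> 'a set.
     (\<forall>i\<le>d. irreducible_closedin X (Z i)) \<and> (\<forall>i<d. Z i \<subset> Z (Suc i))}"

definition orbit_dim ::
    "('g, 'b) monoid_scheme \<Rightarrow> ('g \<Rightarrow> ('n::finite \<Rightarrow> 'k::idom) \<Rightarrow> ('n \<Rightarrow> 'k)) \<Rightarrow> ('n \<Rightarrow> 'k) \<Rightarrow> enat" where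
  "orbit_dim G \<phi> a = krull_dim (subtopology zariski (orbit G \<phi> a))"

text \<open>
  A point of the product of affine spaces with coordinates in \<open>'m\<close> and \<open>'n\<close> is a function \<open>z\<close>
  on \<open>'m + 'n\<close>; its two components are \<open>z \<circ> Inl\<close> and \<open>z \<circ> Inr\<close>.
\<close>

definition affine_algebraic_group :: "('m::finite \<Rightarrow> 'k::field) monoid \<Rightarrow> bool" where
  "affine_algebraic_group G \<longleftrightarrow>
     group G \<and> closedin zariski (carrier G) \<and>
     regular_map_on {z. z \<circ> Inl \<in> carrier G \<and> z \<circ> Inr \<in> carrier G}
       (\<lambda>z. (z \<circ> Inl) \<otimes>\<^bsub>G\<^esub> (z \<circ> Inr)) \<and>
     regular_map_on (carrier G) (\<lambda>x. inv\<^bsub>G\<^esub> x)"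

text \<open>
  An element \<open>g\<close> is unipotent if right translation \<open>\<rho>\<^sub>g f = (\<lambda>x. f (x \<otimes> g))\<close> on the algebra of
  regular functions on \<open>G\<close>, which is always locally finite, is locally unipotent: every \<open>f\<close> is
  annihilated by a power of \<open>\<rho>\<^sub>g - id\<close>.
\<close>

definition unipotent_element :: "('m::finite \<Rightarrow> 'k::field) monoid \<Rightarrow> ('m \<Rightarrow> 'k) \<Rightarrow> bool" where
  "unipotent_element G g \<longleftrightarrow>
     (\<forall>f. regular_fun_on (carrier G) f \<longrightarrow>
       (\<exists>N. \<forall>x\<in>carrier G. ((\<lambda>h x. h (x \<otimes>\<^bsub>G\<^esub> g) - h x) ^^ N) f x = 0))"

definition unipotent_algebraic_group :: "('m::finite \<Rightarrow> 'k::field) monoid \<Rightarrow> bool" where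
  "unipotent_algebraic_group G \<longleftrightarrow>
     affine_algebraic_group G \<and> (\<forall>g\<in>carrier G. unipotent_element G g)"

definition regular_action ::
    "('m::finite \<Rightarrow> 'k::field) monoid \<Rightarrow> (('m \<Rightarrow> 'k) \<Rightarrow> ('n::finite \<Rightarrow> 'k) \<Rightarrow> ('n \<Rightarrow> 'k)) \<Rightarrow> bool" where
  "regular_action G \<phi> \<longleftrightarrow>
     group_action G UNIV \<phi> \<and>
     regular_map_on {z. z \<circ> Inl \<in> carrier G} (\<lambda>z. \<phi> (z \<circ> Inl) (z \<circ> Inr))"

definition invariant_polys ::
    "('g, 'b) monoid_scheme \<Rightarrow> ('g \<Rightarrow> ('n::finite \<Rightarrow> 'k::field) \<Rightarrow> ('n \<Rightarrow> 'k)) \<Rightarrow> ('n, 'k) mpoly set" where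
  "invariant_polys G \<phi> = {p. \<forall>g\<in>carrier G. \<forall>a. mpeval p (\<phi> g a) = mpeval p a}"

text \<open>The subalgebra \<open>k[c]\<close>: coefficients of \<open>q\<close> are embedded as constants before evaluating at \<open>c\<close>.\<close>

definition generated_algebra :: "('n, 'k::field) mpoly \<Rightarrow> ('n, 'k) mpoly set" where
  "generated_algebra c = range (\<lambda>q :: 'k poly. poly (map_poly mconst q) c)"

definition is_subfield :: "'a::field set \<Rightarrow> bool" where
  "is_subfield F \<longleftrightarrow> 1 \<in> F \<and>
     (\<forall>x\<in>F. \<forall>y\<in>F. x - y \<in> F \<and> x * y \<in> F) \<and> (\<forall>x\<in>F. inverse x \<in> F)"

text \<open>
  The type \<open>('n, 'k) mpoly fract\<close> is the field of rational functions. The order on \<open>'n\<close> is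
  only there because the library's integral domain instance for \<open>poly_mapping\<close> asks for it.
\<close>

definition mfract :: "('n::linorder, 'k::field) mpoly \<Rightarrow> ('n, 'k) mpoly fract" where
  "mfract p = Fraction_Field.Fract p 1"

definition generated_field ::
    "('n::linorder, 'k::field) mpoly fract set \<Rightarrow> ('n, 'k) mpoly fract set" where
  "generated_field S = (\<lambda>F. is_subfield F \<and> range (\<lambda>a. mfract (mconst a)) \<subseteq> F) hull S"

definition rational_coordinate :: "('n::{finite, linorder}, 'k::field) mpoly \<Rightarrow> bool" where
  "rational_coordinate c \<longleftrightarrow> irreducible c \<and>
     (\<exists>f :: nat \<Rightarrow> ('n, 'k) mpoly fract.
        generated_field (insert (mfract c) (f ` {1..CARD('n) - 1})) = UNIV)"

end

theory Submission
  imports Defs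
begin

text \<open>
  \<open>U\<close> acts on the polynomial ring by locally unipotent automorphisms. Hence every stable subspace
  contains, outside any given proper subspace of it, a vector invariant modulo that subspace (Kolchin), and \<open>g\<^sup>s a\<close> is polynomial in \<open>s\<close>.
  The vanishing ideal of an orbit of dimension \<open>n - 1\<close> is a prime of height one, so it is generated by an
  irreducible \<open>h\<close>, which is itself invariant. Every invariant minus its value on the orbit is \<open>h\<close> times an invariant
  of smaller degree, so the invariants are \<open>k[h]\<close>. Starting from \<open>k(h)\<close>, adjoin polynomials \<open>v\<close> for which
  all \<open>g v - v\<close> lie in the field obtained so far. If such a \<open>v\<close> were algebraic over it, averaging would make \<open>v\<close>
  invariant up to an element of that field, hence an element of it; so \<open>v\<close> is transcendental, and the whole field
  of rational functions is reached after at most \<open>n - 1\<close> steps.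
\<close>

text \<open>Two obstacles shape the proof. Dimension enters only as the topological Krull dimension
  of an orbit, and \<open>U\<close> is given by its points, not by one-parameter subgroups. The
  first is met by counting: the polynomials with partial degrees at most \<open>D\<close> in n
  variables have (D + 1)^n coefficients, and comparing such numbers for large \<open>D\<close> makes
  n + 1 polynomials dependent, bounds chains of primes, and forces a dense orbit to have dimension
  at least n. The second is met by the powers \<open>g [^] s\<close> for natural s: in
  characteristic zero a nonzero polynomial in s has finitely many natural zeros, so these discrete
  curves act as affine lines joining the points of an orbit and make its ideal prime. Kolchin's
  theorem is obtained from traces: operators in the augmentation ideal have powers of trace zero, so
  none of them fixes a nonzero vector. Intermediate fields are represented by the polynomials that
  they contain, so that the group acts on polynomials throughout.\<close>

abbreviation lookup where "lookup \<equiv> Poly_Mapping.lookup"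
abbreviation single where "single \<equiv> Poly_Mapping.single"
abbreviation keys where "keys \<equiv> Poly_Mapping.keys"

section \<open>Polynomials in several variables and their homomorphisms\<close>

definition mvar :: "'v \<Rightarrow> ('v, 'k::comm_ring_1) mpoly" where
  "mvar i = single (single i 1) 1"

text \<open>The homomorphism of the universal property, once \<open>\<kappa>\<close> is a ring map.
  Evaluation, passage to one variable, specialisation of parameters and restriction to curves are
  instances.\<close>

definition mpsubst :: "('k \<Rightarrow> 'b::comm_ring_1) \<Rightarrow> ('v \<Rightarrow> 'b) \<Rightarrow> ('v::finite, 'k::comm_ring_1) mpoly \<Rightarrow> 'b" where
  "mpsubst \<kappa> \<xi> p = (\<Sum>m\<in>keys p. \<kappa> (lookup p m) * (\<Prod>i\<in>UNIV. \<xi> i ^ lookup m i))"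

lemma mconst_0 [simp]: "mconst 0 = 0" by (simp add: mconst_def)
lemma mconst_1 [simp]: "mconst 1 = 1" by (simp add: mconst_def)
lemma mconst_add: "mconst (a + b) = mconst a + mconst b" by (simp add: mconst_def single_add)
lemma mconst_mult: "mconst (a * b) = mconst a * mconst b" by (simp add: mconst_def mult_single)
lemma mconst_minus: "mconst (- a) = - mconst a" by (simp add: mconst_def single_uminus)
lemma mconst_eq_iff [simp]: "mconst a = mconst b \<longleftrightarrow> a = b" 
  by (metis mconst_def lookup_single_eq)

lemma mvar_power: "mvar i ^ j = single (single i j) 1"
proof (induction j)
  case (Suc j)
  have "single i (Suc 0) + single i j = single i (Suc j)" by (simp flip: single_add)
  with Suc show ?case by (simp add: mvar_def mult_single)
qed simp

lemma prod_single: "(\<Prod>i\<in>A. single (f i :: 'v \<Rightarrow>\<^sub>0 nat) (1::'k::comm_ring_1)) = single (sum f A) 1"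
  by (induction A rule: infinite_finite_induct) (auto simp: mult_single)

lemma single_eq_prod:
  "(single m c :: ('v::finite, 'k::comm_ring_1) mpoly) = mconst c * (\<Prod>i\<in>UNIV. mvar i ^ lookup m i)"
proof -
  have 2: "(\<Sum>i\<in>UNIV. single i (lookup m i)) = m"
    by (rule poly_mapping_eqI) (simp add: lookup_sum lookup_single when_def)
  show ?thesis unfolding mvar_power prod_single 2 by (simp add: mconst_def mult_single)
qed

lemma mpoly_induct [case_names const var add mult]:
  fixes p :: "('v::finite, 'k::comm_ring_1) mpoly"
  assumes c: "\<And>c. P (mconst c)" and v: "\<And>i. P (mvar i)"
    and a: "\<And>p q. P p \<Longrightarrow> P q \<Longrightarrow> P (p + q)" and m: "\<And>p q. P p \<Longrightarrow> P q \<Longrightarrow> P (p * q)"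
  shows "P p"
proof -
  have pw: "P (p ^ j)" if "P p" for p j
    by (induction j) (use that m c[of 1] in auto)
  have pr: "P (prod f A)" if "finite A" "\<And>i. P (f i)" for f and A :: "'v set"
    using that by (induction A rule: finite_induct) (use m c[of 1] in auto)
  have s: "P (single k x)" for k x
    unfolding single_eq_prod by (intro m c pr pw v) simp
  have sm: "P (sum f A)" if "finite A" "\<And>i. P (f i)" for f and A :: "('v \<Rightarrow>\<^sub>0 nat) set"
    using that by (induction A rule: finite_induct) (use a c[of 0] in auto)
  show ?thesis
    by (subst mpoly_sum_monomials[symmetric]) (intro sm s, simp)
qed

definition ring_map :: "('a::comm_ring_1 \<Rightarrow> 'b::comm_ring_1) \<Rightarrow> bool" where
  "ring_map f \<longleftrightarrow> f 1 = 1 \<and> (\<forall>x y. f (x + y) = f x + f y) \<and> (\<forall>x y. f (x * y) = f x * f y)"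

lemma ring_mapD:
  assumes "ring_map f"
  shows "f 1 = 1" "f (x + y) = f x + f y" "f (x * y) = f x * f y" "f 0 = 0" "f (- x) = - f x"
    "f (x - y) = f x - f y" "f (x ^ k) = f x ^ k" "f (sum h A) = (\<Sum>a\<in>A. f (h a))"
    "f (prod h A) = (\<Prod>a\<in>A. f (h a))"
proof -
  show 1: "f 1 = 1" "f (x + y) = f x + f y" "f (x * y) = f x * f y" for x y
    using assms by (auto simp: ring_map_def)
  show 0: "f 0 = 0" using 1(2)[of 0 0] by simp
  show m: "f (- x) = - f x" for x using 1(2)[of x "- x"] 0 by (simp add: eq_neg_iff_add_eq_0 add.commute)
  show "f (x - y) = f x - f y" using 1(2)[of x "- y"] m by simp
  show "f (x ^ k) = f x ^ k" by (induction k) (auto simp: 1)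
  show "f (sum h A) = (\<Sum>a\<in>A. f (h a))" by (induction A rule: infinite_finite_induct) (auto simp: 1 0)
  show "f (prod h A) = (\<Prod>a\<in>A. f (h a))" by (induction A rule: infinite_finite_induct) (auto simp: 1)
qed

lemma ring_map_comp: "ring_map f \<Longrightarrow> ring_map g \<Longrightarrow> ring_map (\<lambda>x. f (g x))"
  by (auto simp: ring_map_def)

lemma ring_map_mconst: "ring_map mconst"
  by (auto simp: ring_map_def mconst_add mconst_mult)

lemma ring_map_id: "ring_map (\<lambda>x. x)" by (auto simp: ring_map_def)

lemma ring_map_const_poly: "ring_map (\<lambda>c. [:c:])"
  by (auto simp: ring_map_def)

lemma ring_map_poly: "ring_map (\<lambda>q. poly q x)"
  by (auto simp: ring_map_def)

lemma ring_map_mpeval: "ring_map (\<lambda>p. mpeval p x)"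
  by (auto simp: ring_map_def mpeval_mconst simp flip: mconst_1)

context
  fixes \<kappa> :: "'k::comm_ring_1 \<Rightarrow> 'b::comm_ring_1" and \<xi> :: "'v::finite \<Rightarrow> 'b"
  assumes \<kappa>: "ring_map \<kappa>"
begin

lemma mpsubst_superset:
  assumes "finite A" "keys p \<subseteq> A"
  shows "mpsubst \<kappa> \<xi> p = (\<Sum>m\<in>A. \<kappa> (lookup p m) * (\<Prod>i\<in>UNIV. \<xi> i ^ lookup m i))"
  unfolding mpsubst_def using assms
  by (intro sum.mono_neutral_left) (auto simp: in_keys_iff ring_mapD[OF \<kappa>])

lemma mpsubst_single: "mpsubst \<kappa> \<xi> (single m c) = \<kappa> c * (\<Prod>i\<in>UNIV. \<xi> i ^ lookup m i)"
  by (subst mpsubst_superset[of "{m}"]) auto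

lemma mpsubst_mconst: "mpsubst \<kappa> \<xi> (mconst c) = \<kappa> c"
  by (simp add: mconst_def mpsubst_single)

lemma mpsubst_mvar: "mpsubst \<kappa> \<xi> (mvar i) = \<xi> i"
proof -
  have "(\<Prod>j\<in>UNIV. \<xi> j ^ lookup (single i (Suc 0)) j) = (\<Prod>j\<in>UNIV. if j = i then \<xi> j else 1)"
    by (rule prod.cong) (auto simp: lookup_single when_def)
  then show ?thesis by (simp add: mvar_def mpsubst_single ring_mapD[OF \<kappa>])
qed

lemma mpsubst_add: "mpsubst \<kappa> \<xi> (p + q) = mpsubst \<kappa> \<xi> p + mpsubst \<kappa> \<xi> q"
proof -
  let ?A = "keys p \<union> keys q"
  have A: "finite ?A" by simp
  have pq: "keys (p + q) \<subseteq> ?A" by (rule Poly_Mapping.keys_add)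
  show ?thesis
    unfolding mpsubst_superset[OF A pq] mpsubst_superset[OF A Un_upper1] mpsubst_superset[OF A Un_upper2]
    by (simp only: lookup_add distrib_right sum.distrib ring_mapD[OF \<kappa>])
qed

lemma mpsubst_sum: "mpsubst \<kappa> \<xi> (sum f A) = (\<Sum>a\<in>A. mpsubst \<kappa> \<xi> (f a))"
proof -
  have "mpsubst \<kappa> \<xi> 0 = 0" by (simp add: mpsubst_def)
  then show ?thesis by (induction A rule: infinite_finite_induct) (auto simp: mpsubst_add)
qed

lemma mpsubst_mult: "mpsubst \<kappa> \<xi> (p * q) = mpsubst \<kappa> \<xi> p * mpsubst \<kappa> \<xi> q"
proof -
  have s: "mpsubst \<kappa> \<xi> (single m c * single m' c') = mpsubst \<kappa> \<xi> (single m c) * mpsubst \<kappa> \<xi> (single m' c')" for m m' c c'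
    by (simp add: mult_single mpsubst_single lookup_add power_add prod.distrib ring_mapD[OF \<kappa>])
  have "p * q = (\<Sum>m\<in>keys p. single m (lookup p m)) * (\<Sum>m\<in>keys q. single m (lookup q m))"
    by (simp only: mpoly_sum_monomials)
  also have "mpsubst \<kappa> \<xi> \<dots> = mpsubst \<kappa> \<xi> (\<Sum>m\<in>keys p. single m (lookup p m)) *
      mpsubst \<kappa> \<xi> (\<Sum>m\<in>keys q. single m (lookup q m))"
    by (simp only: sum_product mpsubst_sum s)
  finally show ?thesis by (simp only: mpoly_sum_monomials)
qed

lemma ring_map_mpsubst: "ring_map (mpsubst \<kappa> \<xi>)"
  using mpsubst_mconst[of 1] by (auto simp: ring_map_def mpsubst_add mpsubst_mult ring_mapD[OF \<kappa>])

end

lemma mpeval_eq_mpsubst: "mpeval p x = mpsubst (\<lambda>c. c) x p"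
  by (simp add: mpeval_def mpsubst_def)

lemma mpeval_mvar [simp]: "mpeval (mvar i) x = x i"
  by (simp add: mpeval_eq_mpsubst mpsubst_mvar ring_map_id)

text \<open>Constants and variables generate the ring. Identities between iterated substitutions are
  checked on them, with no computation on monomials.\<close>

lemma ring_map_mpoly_eq:
  fixes F G :: "('v::finite, 'k::comm_ring_1) mpoly \<Rightarrow> 'b::comm_ring_1"
  assumes "ring_map F" "ring_map G" "\<And>c. F (mconst c) = G (mconst c)" "\<And>i. F (mvar i) = G (mvar i)"
  shows "F p = G p"
  by (induction p rule: mpoly_induct) (auto simp: assms ring_mapD[OF assms(1)] ring_mapD[OF assms(2)])

lemma mpeval_diff [simp]: "mpeval (p - q) x = mpeval p x - mpeval q x"
  by (rule ring_mapD[OF ring_map_mpeval])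
lemma mpeval_one [simp]: "mpeval 1 x = 1"
  by (rule ring_mapD[OF ring_map_mpeval])
lemma mpeval_power [simp]: "mpeval (p ^ j) x = mpeval p x ^ j"
  by (rule ring_mapD[OF ring_map_mpeval])

section \<open>Polynomials in one variable over the others\<close>

text \<open>The coefficients stay in the same polynomial ring, where they happen to be free of
  \<open>mvar y\<close>. Eliminating a variable thus changes no type, and induction runs over sets
  of variables.\<close>

definition upoly :: "'v \<Rightarrow> ('v::finite, 'k::comm_ring_1) mpoly \<Rightarrow> ('v, 'k) mpoly poly" where
  "upoly y = mpsubst (\<lambda>c. [:mconst c:]) (\<lambda>i. if i = y then [:0, 1:] else [:mvar i:])"

lemma ring_map_upoly: "ring_map (upoly y)"
  unfolding upoly_def by (intro ring_map_mpsubst ring_map_comp[OF ring_map_const_poly] ring_map_mconst)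

lemmas upoly_hom = ring_mapD[OF ring_map_upoly]

lemma upoly_mconst [simp]: "upoly y (mconst c) = [:mconst c:]"
  unfolding upoly_def by (subst mpsubst_mconst) (intro ring_map_comp[OF ring_map_const_poly] ring_map_mconst refl)+

lemma upoly_mvar: "upoly y (mvar i) = (if i = y then [:0, 1:] else [:mvar i:])"
  unfolding upoly_def by (subst mpsubst_mvar) (intro ring_map_comp[OF ring_map_const_poly] ring_map_mconst refl)+

lemma poly_upoly [simp]: "poly (upoly y p) (mvar y) = p"
  by (rule ring_map_mpoly_eq[OF ring_map_comp[OF ring_map_poly ring_map_upoly] ring_map_id])
     (auto simp: upoly_mvar)

lemma upoly_eq_iff: "upoly y p = upoly y q \<longleftrightarrow> p = q"
  by (metis poly_upoly)

lemma upoly_eq_0 [simp]: "upoly y p = 0 \<longleftrightarrow> p = 0"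
  using upoly_eq_iff[of y p 0] by (simp add: upoly_hom)

lemma upoly_single:
  fixes c :: "'k::comm_ring_1" and m :: "'v::finite \<Rightarrow>\<^sub>0 nat"
  shows "upoly y (single m c) = monom (single (Poly_Mapping.update y 0 m) c) (lookup m y)"
proof -
  have cp: "[:r:] ^ j = [:r ^ j:]" for r :: "('v, 'k) mpoly" and j
    by (induction j) auto
  have pp: "(\<Prod>i\<in>A. [:h i:]) = [:\<Prod>i\<in>A. h i:]" for h :: "'v \<Rightarrow> ('v, 'k) mpoly" and A
    by (induction A rule: infinite_finite_induct) (auto simp: pCons_one)
  have "upoly y (single m c) = [:mconst c:] * (\<Prod>i\<in>UNIV. upoly y (mvar i) ^ lookup m i)"
    by (subst single_eq_prod) (simp add: upoly_hom)
  also have "(\<Prod>i\<in>UNIV. upoly y (mvar i :: ('v, 'k) mpoly) ^ lookup m i) =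
      [:0,1:] ^ lookup m y * (\<Prod>i\<in>UNIV - {y}. [:(mvar i :: ('v, 'k) mpoly) ^ lookup m i:])"
    by (subst prod.remove[of _ y]) (auto simp: upoly_mvar cp)
  also have "(\<Prod>i\<in>UNIV - {y}. [:(mvar i :: ('v, 'k) mpoly) ^ lookup m i:]) = [:\<Prod>i\<in>UNIV - {y}. mvar i ^ lookup m i:]"
    by (rule pp)
  also have "(\<Prod>i\<in>UNIV - {y}. (mvar i :: ('v, 'k) mpoly) ^ lookup m i) = (\<Prod>i\<in>UNIV. (mvar i :: ('v, 'k) mpoly) ^ lookup (Poly_Mapping.update y 0 m) i)"
    by (subst prod.remove[of UNIV y]) (auto simp: lookup_update intro!: prod.cong)
  also have "[:0, 1:] ^ lookup m y = monom 1 (lookup m y)"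
    by (simp add: monom_altdef)
  also have "[:mconst c:] * (monom 1 (lookup m y) * [:\<Prod>i\<in>UNIV. mvar i ^ lookup (Poly_Mapping.update y 0 m) i:])
     = monom (mconst c * (\<Prod>i\<in>UNIV. mvar i ^ lookup (Poly_Mapping.update y 0 m) i)) (lookup m y)"
    by (simp add: smult_monom mult.commute)
  also have "mconst c * (\<Prod>i\<in>UNIV. mvar i ^ lookup (Poly_Mapping.update y 0 m) i) = single (Poly_Mapping.update y 0 m) c"
    by (rule single_eq_prod[symmetric])
  finally show ?thesis .
qed

lemma lookup_coeff_upoly:
  "lookup (coeff (upoly y p) j) m = (if lookup m y = 0 then lookup p (m + single y j) else 0)"
proof -
  have eq: "Poly_Mapping.update y 0 m' = m \<and> lookup m' y = j \<longleftrightarrow> lookup m y = 0 \<and> m' = m + single y j" for m'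
    by (auto simp: poly_mapping_eq_iff fun_eq_iff lookup_update lookup_add lookup_single when_def)
  have "upoly y p = (\<Sum>m'\<in>keys p. upoly y (single m' (lookup p m')))"
    by (subst mpoly_sum_monomials[symmetric]) (simp add: upoly_hom)
  then have "lookup (coeff (upoly y p) j) m =
     (\<Sum>m'\<in>keys p. if lookup m y = 0 \<and> m' = m + single y j then lookup p m' else 0)"
    by (simp add: coeff_sum lookup_sum upoly_single lookup_single when_def coeff_monom eq[symmetric] 
        if_distrib[of "\<lambda>x. lookup x _"] conj_commute cong: if_cong)
       (intro sum.cong refl, auto)
  also have "\<dots> = (if lookup m y = 0 then lookup p (m + single y j) else 0)"
    by (auto simp: in_keys_iff sum.delta)
  finally show ?thesis .
qed

definition dg :: "'v \<Rightarrow> ('v::finite, 'k::comm_ring_1) mpoly \<Rightarrow> nat" where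
  "dg y p = degree (upoly y p)"

lemma dg_le_iff: "dg y p \<le> D \<longleftrightarrow> (\<forall>m\<in>keys p. lookup m y \<le> D)"
proof
  assume L: "dg y p \<le> D"
  show "\<forall>m\<in>keys p. lookup m y \<le> D"
  proof
    fix m assume m: "m \<in> keys p"
    have "m = Poly_Mapping.update y 0 m + single y (lookup m y)"
      by (auto simp: poly_mapping_eq_iff fun_eq_iff lookup_update lookup_add lookup_single when_def)
    then have "lookup (coeff (upoly y p) (lookup m y)) (Poly_Mapping.update y 0 m) = lookup p m"
      by (simp add: lookup_coeff_upoly lookup_update)
    with m have "coeff (upoly y p) (lookup m y) \<noteq> 0" by (auto simp: in_keys_iff)
    then show "lookup m y \<le> D" using L le_degree unfolding dg_def by fastforce
  qed
next
  assume R: "\<forall>m\<in>keys p. lookup m y \<le> D"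
  have "coeff (upoly y p) j = 0" if "j > D" for j
  proof (rule poly_mapping_eqI)
    fix m
    have "lookup p (m + single y j) = 0"
    proof (rule ccontr)
      assume "lookup p (m + single y j) \<noteq> 0"
      then have "lookup (m + single y j) y \<le> D" using R by (auto simp: in_keys_iff)
      then show False using that by (simp add: lookup_add)
    qed
    then show "lookup (coeff (upoly y p) j) m = lookup 0 m" by (simp add: lookup_coeff_upoly)
  qed
  then show "dg y p \<le> D" unfolding dg_def by (simp add: degree_le)
qed

lemma dg_0D: "dg y p = 0 \<Longrightarrow> m \<in> keys p \<Longrightarrow> lookup m y = 0"
  using dg_le_iff[of y p 0] by simp

lemma dg_add_le: "dg y (p + q) \<le> max (dg y p) (dg y q)"
  by (simp add: dg_def upoly_hom degree_add_le_max)
lemma dg_mult_le: "dg y (p * q) \<le> dg y p + dg y q"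
  by (simp add: dg_def upoly_hom degree_mult_le)
lemma dg_mconst [simp]: "dg y (mconst c) = 0" by (simp add: dg_def)
lemma dg_zero [simp]: "dg y 0 = 0" by (simp add: dg_def upoly_hom)
lemma dg_one [simp]: "dg y 1 = 0" by (simp add: dg_def upoly_hom)
lemma dg_minus [simp]: "dg y (- p) = dg y p" by (simp add: dg_def upoly_hom)
lemma dg_diff_le: "dg y (p - q) \<le> max (dg y p) (dg y q)"
  using dg_add_le[of y p "- q"] by simp
lemma dg_mult:
  fixes p q :: "('v::{finite,linorder}, 'k::field) mpoly"
  shows "p \<noteq> 0 \<Longrightarrow> q \<noteq> 0 \<Longrightarrow> dg y (p * q) = dg y p + dg y q"
  by (simp add: dg_def upoly_hom degree_mult_eq)

lemma dg_power_le: "dg y (p ^ k) \<le> k * dg y p"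
  using degree_power_le[of "upoly y p" k] by (simp add: dg_def upoly_hom mult.commute)

lemma dg_sum_le: "(\<And>a. a \<in> A \<Longrightarrow> dg y (f a) \<le> D) \<Longrightarrow> dg y (sum f A) \<le> D"
proof (induction A rule: infinite_finite_induct)
  case (insert x F)
  then show ?case using dg_add_le[of y "f x" "sum f F"] by fastforce
qed auto

lemma dg_prod_le: "finite A \<Longrightarrow> dg y (prod f A) \<le> (\<Sum>a\<in>A. dg y (f a))"
proof (induction A rule: finite_induct)
  case (insert x F)
  then show ?case using dg_mult_le[of y "f x" "prod f F"] by fastforce
qed auto

lemma mpoly_const_if_dg_0:
  assumes "\<And>y. dg y p = 0"
  shows "p = mconst (lookup p 0)"
proof (rule poly_mapping_eqI)
  fix m
  show "lookup p m = lookup (mconst (lookup p 0)) m"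
  proof (cases "m = 0")
    case False
    then obtain y where "lookup m y \<noteq> 0" by (auto simp: poly_mapping_eq_iff fun_eq_iff)
    with dg_0D[OF assms[of y], of m] have "m \<notin> keys p" by auto
    then have "lookup p m = 0" by (simp add: in_keys_iff)
    then show ?thesis using False by (simp add: mconst_def lookup_single)
  qed (simp add: mconst_def)
qed

text \<open>A size additive on products, like the total degree; as a sum of one-variable degrees it
  inherits additivity from univariate polynomials. Descents on factorisations use it.\<close>

definition msize :: "('v::finite, 'k::comm_ring_1) mpoly \<Rightarrow> nat" where
  "msize p = (\<Sum>y\<in>UNIV. dg y p)"

lemma msize_mult:
  fixes p q :: "('v::{finite,linorder}, 'k::field) mpoly"
  shows "p \<noteq> 0 \<Longrightarrow> q \<noteq> 0 \<Longrightarrow> msize (p * q) = msize p + msize q"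
  by (simp add: msize_def dg_mult sum.distrib)

lemma msize_eq_0D: "msize p = 0 \<Longrightarrow> p = mconst (lookup p 0)"
  by (rule mpoly_const_if_dg_0) (simp add: msize_def)

lemma msize_mconst [simp]: "msize (mconst c) = 0" by (simp add: msize_def)

lemma msize_0_unit:
  fixes p :: "('v::{finite,linorder}, 'k::field) mpoly"
  assumes "msize p = 0" "p \<noteq> 0"
  shows "p dvd 1"
proof -
  obtain c where c: "p = mconst c" using msize_eq_0D[OF assms(1)] by blast
  with assms have "c \<noteq> 0" by auto
  then have "p * mconst (inverse c) = 1" by (simp add: c flip: mconst_mult)
  then show ?thesis by (metis dvdI)
qed

lemma unit_iff_msize:
  fixes p :: "('v::{finite,linorder}, 'k::field) mpoly"
  shows "p dvd 1 \<longleftrightarrow> p \<noteq> 0 \<and> msize p = 0"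
proof
  assume "p dvd 1"
  then obtain q where q: "1 = p * q" by blast
  then have "p \<noteq> 0" "q \<noteq> 0" by auto
  then have "msize p + msize q = msize (1 :: ('v, 'k) mpoly)" using q msize_mult by metis
  also have "\<dots> = 0" using msize_mconst[of 1] by (simp del: msize_mconst)
  finally show "p \<noteq> 0 \<and> msize p = 0" using \<open>p \<noteq> 0\<close> by simp
qed (auto intro: msize_0_unit)

text \<open>The subring k[S], cut out by degrees inside the full ring; since degrees add up, it
  contains the factors of its nonzero elements.\<close>

definition polys_in :: "'v set \<Rightarrow> ('v::finite, 'k::comm_ring_1) mpoly set" where
  "polys_in S = {p. \<forall>y. y \<notin> S \<longrightarrow> dg y p = 0}"

lemma polys_in_UNIV: "p \<in> polys_in UNIV" by (simp add: polys_in_def)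

lemma polys_in_add: "p \<in> polys_in S \<Longrightarrow> q \<in> polys_in S \<Longrightarrow> p + q \<in> polys_in S"
proof -
  assume a: "p \<in> polys_in S" "q \<in> polys_in S"
  have "dg y (p + q) = 0" if "y \<notin> S" for y
    using dg_add_le[of y p q] that a by (simp add: polys_in_def)
  then show ?thesis by (simp add: polys_in_def)
qed
lemma polys_in_mult: "p \<in> polys_in S \<Longrightarrow> q \<in> polys_in S \<Longrightarrow> p * q \<in> polys_in S"
proof -
  assume a: "p \<in> polys_in S" "q \<in> polys_in S"
  have "dg y (p * q) = 0" if "y \<notin> S" for y
    using dg_mult_le[of y p q] that a by (simp add: polys_in_def)
  then show ?thesis by (simp add: polys_in_def)
qed
lemma polys_in_minus: "p \<in> polys_in S \<Longrightarrow> - p \<in> polys_in S"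
  unfolding polys_in_def by (auto)
lemma polys_in_diff: "p \<in> polys_in S \<Longrightarrow> q \<in> polys_in S \<Longrightarrow> p - q \<in> polys_in S"
  using polys_in_add[of p S "- q"] polys_in_minus by fastforce
lemma polys_in_mconst: "mconst c \<in> polys_in S" by (simp add: polys_in_def)
lemma polys_in_mvar: "i \<in> S \<Longrightarrow> mvar i \<in> polys_in S" 
  by (auto simp: polys_in_def dg_def upoly_mvar)

lemma polys_in_factor:
  fixes p q :: "('v::{finite,linorder}, 'k::field) mpoly"
  assumes "p * q \<in> polys_in S" "p \<noteq> 0" "q \<noteq> 0"
  shows "p \<in> polys_in S"
  using assms unfolding polys_in_def by (auto simp: dg_mult)

lemma coeff_upoly_in:
  assumes "p \<in> polys_in (insert y S)"
  shows "coeff (upoly y p) j \<in> polys_in (S - {y})"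
  unfolding polys_in_def
proof (intro CollectI allI impI)
  fix z assume z: "z \<notin> S - {y}"
  have "dg z (coeff (upoly y p) j) \<le> 0" unfolding dg_le_iff
  proof
    fix m assume "m \<in> keys (coeff (upoly y p) j)"
    then have m: "lookup m y = 0" "lookup p (m + single y j) \<noteq> 0"
      by (auto simp: in_keys_iff lookup_coeff_upoly split: if_splits)
    show "lookup m z \<le> 0"
    proof (cases "z = y")
      case False
      with z assms have "dg z p = 0" by (auto simp: polys_in_def)
      with m have "lookup (m + single y j) z = 0" by (intro dg_0D) (auto simp: in_keys_iff)
      then show ?thesis by (simp add: lookup_add)
    qed (simp add: m)
  qed
  then show "dg z (coeff (upoly y p) j) = 0" by simp
qed

lemma mpeval_cong_polys_in:
  assumes "p \<in> polys_in S" "\<And>i. i \<in> S \<Longrightarrow> x i = x' i"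
  shows "mpeval p x = mpeval p x'"
  unfolding mpeval_def
proof (intro sum.cong refl arg_cong2[where f = "(*)"] prod.cong)
  fix m i assume "m \<in> keys p"
  show "x i ^ lookup m i = x' i ^ lookup m i"
  proof (cases "i \<in> S")
    case False
    then have "dg i p = 0" using assms by (auto simp: polys_in_def)
    then show ?thesis using dg_0D[of i p m] \<open>m \<in> keys p\<close> by simp
  qed (simp add: assms)
qed

text \<open>Induction on the variables: at a point where some coefficient in \<open>y\<close> is
  nonzero, \<open>p\<close> becomes a nonzero polynomial in the coordinate \<open>y\<close>, and an
  infinite domain contains a non-root of it.\<close>

lemma mpeval_nonzero_aux:
  fixes p :: "('v::finite, 'k::{idom,ring_char_0}) mpoly"
  assumes "finite S" "p \<in> polys_in S" "p \<noteq> 0"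
  shows "\<exists>x. mpeval p x \<noteq> 0"
  using assms
proof (induction S arbitrary: p rule: finite_induct)
  case empty
  then have "p = mconst (lookup p 0)" by (intro mpoly_const_if_dg_0) (auto simp: polys_in_def)
  then show ?case using empty by (metis mpeval_mconst mconst_0)
next
  case (insert y S)
  then obtain j where j: "coeff (upoly y p) j \<noteq> 0" by (metis leading_coeff_0_iff upoly_eq_0)
  have cS: "coeff (upoly y p) j \<in> polys_in S" for j
    using coeff_upoly_in[OF insert.prems(1), of j] insert.hyps by auto
  obtain x where x: "mpeval (coeff (upoly y p) j) x \<noteq> 0" using insert.IH[OF cS j] by blast
  define r where "r = map_poly (\<lambda>c. mpeval c x) (upoly y p)"
  have "coeff r j \<noteq> 0" using x by (simp add: r_def coeff_map_poly)
  then have "r \<noteq> 0" by auto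
  then obtain t where t: "poly r t \<noteq> 0" using poly_roots_finite[of r] infinite_UNIV_char_0
    by (metis (mono_tags, lifting) UNIV_I mem_Collect_eq subsetI finite_subset)
  \<comment> \<open>Only the coordinate \<open>y\<close> moves, and the coefficients do not involve
    it.\<close>
  define x' where "x' = x(y := t)"
  have e: "mpeval (coeff (upoly y p) i) x' = mpeval (coeff (upoly y p) i) x" for i
    by (rule mpeval_cong_polys_in[OF cS]) (use insert.hyps in \<open>auto simp: x'_def\<close>)
  have "mpeval p x' = mpeval (poly (upoly y p) (mvar y)) x'" by simp
  also have "\<dots> = (\<Sum>i\<le>degree (upoly y p). mpeval (coeff (upoly y p) i) x * t ^ i)"
    unfolding poly_altdef by (simp add: mpeval_sum e) (simp add: x'_def)
  also have "\<dots> = poly r t"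
    unfolding poly_altdef
  proof (rule sum.mono_neutral_cong_right)
    show "{..degree r} \<subseteq> {..degree (upoly y p)}" using map_poly_degree_leq[of _ "upoly y p"] by (auto simp: r_def intro: order_trans)
    have c: "coeff r i = mpeval (coeff (upoly y p) i) x" for i by (simp add: r_def coeff_map_poly)
    show "\<forall>i\<in>{..degree (upoly y p)} - {..degree r}. mpeval (coeff (upoly y p) i) x * t ^ i = 0"
      by (auto simp: coeff_eq_0 c[symmetric])
  qed (auto simp: r_def coeff_map_poly)
  finally show ?case using t by (intro exI[of _ x']) simp
qed

lemma mpeval_ext:
  fixes p q :: "('v::finite, 'k::{idom,ring_char_0}) mpoly"
  assumes "\<And>x. mpeval p x = mpeval q x"
  shows "p = q"
proof (rule ccontr)
  assume "p \<noteq> q"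
  then have "\<exists>x. mpeval (p - q) x \<noteq> 0"
    by (intro mpeval_nonzero_aux[of UNIV]) (auto simp: polys_in_UNIV)
  then show False using assms by simp
qed

section \<open>Algebraic dependence by counting\<close>

text \<open>Gaussian elimination, one equation at a time: \<open>x\<close> is solved for an unknown
  \<open>b\<close> with nonzero coefficient, and \<open>N\<close> is the rest of the system after
  substitution. Every counting argument below ends here.\<close>

lemma homogeneous_system:
  fixes M :: "'x \<Rightarrow> 'a \<Rightarrow> 'k::field"
  assumes "finite X" "finite A" "card X < card A"
  shows "\<exists>u. (\<exists>a\<in>A. u a \<noteq> 0) \<and> (\<forall>x\<in>X. (\<Sum>a\<in>A. u a * M x a) = 0)"
  using assms
proof (induction X arbitrary: A M rule: finite_induct)
  case empty
  then have "A \<noteq> {}" by auto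
  then show ?case by (intro exI[of _ "\<lambda>_. 1"]) auto
next
  case (insert x X)
  show ?case
  proof (cases "\<forall>a\<in>A. M x a = 0")
    case True
    obtain u where "\<exists>a\<in>A. u a \<noteq> 0" "\<forall>x\<in>X. (\<Sum>a\<in>A. u a * M x a) = 0"
      using insert.IH[of A M] insert.prems insert.hyps by auto
    with True show ?thesis by (intro exI[of _ u]) auto
  next
    case False
    then obtain b where b: "b \<in> A" "M x b \<noteq> 0" by auto
    define N where "N z a = M z a - M x a * M z b / M x b" for z a
    have "card X < card (A - {b})" using insert b by (simp add: card_Diff_singleton)
    then obtain u where u: "\<exists>a\<in>A - {b}. u a \<noteq> 0" "\<forall>z\<in>X. (\<Sum>a\<in>A - {b}. u a * N z a) = 0"
      using insert.IH[of "A - {b}" N] insert.prems by auto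
    define s where "s = (\<Sum>a\<in>A - {b}. u a * M x a)"
    define u' where "u' = u(b := - s / M x b)"
    have split: "(\<Sum>a\<in>A. u' a * M z a) = - s / M x b * M z b + (\<Sum>a\<in>A - {b}. u a * M z a)" for z
    proof -
      have "(\<Sum>a\<in>A. u' a * M z a) = u' b * M z b + (\<Sum>a\<in>A - {b}. u' a * M z a)"
        using insert.prems b by (intro sum.remove) auto
      also have "(\<Sum>a\<in>A - {b}. u' a * M z a) = (\<Sum>a\<in>A - {b}. u a * M z a)"
        by (intro sum.cong) (auto simp: u'_def)
      finally show ?thesis by (simp add: u'_def)
    qed
    have "(\<Sum>a\<in>A. u' a * M z a) = 0" if "z \<in> X" for z
    proof -
      have "0 = (\<Sum>a\<in>A - {b}. u a * N z a)" using u that by simp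
      also have "\<dots> = (\<Sum>a\<in>A - {b}. u a * M z a - u a * M x a * (M z b / M x b))"
        by (intro sum.cong) (auto simp: N_def algebra_simps)
      also have "\<dots> = (\<Sum>a\<in>A - {b}. u a * M z a) - s * (M z b / M x b)"
        by (simp add: sum_subtractf s_def sum_distrib_right sum_divide_distrib)
      finally show ?thesis unfolding split by simp
    qed
    moreover have "(\<Sum>a\<in>A. u' a * M x a) = 0" unfolding split using b by (simp add: s_def)
    moreover have "\<exists>a\<in>A. u' a \<noteq> 0" using u by (auto simp: u'_def)
    ultimately show ?thesis by auto
  qed
qed

text \<open>Partial degrees are bounded instead of the total degree because the number of monomials
  is then exactly (D + 1)^n.\<close>

definition box :: "nat \<Rightarrow> ('v::finite, 'k::comm_ring_1) mpoly set" where
  "box D = {p. \<forall>y. dg y p \<le> D}"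

definition exponents :: "nat \<Rightarrow> ('v::finite \<Rightarrow>\<^sub>0 nat) set" where
  "exponents D = {m. \<forall>y. lookup m y \<le> D}"

lemma box_keys: "p \<in> box D \<longleftrightarrow> keys p \<subseteq> exponents D"
  by (auto simp: box_def exponents_def dg_le_iff)

lemma bij_betw_exponents: "bij_betw lookup (exponents D :: ('v::finite \<Rightarrow>\<^sub>0 nat) set) (UNIV \<rightarrow>\<^sub>E {..D})"
proof (rule bij_betwI')
  show "lookup m = lookup m' \<longleftrightarrow> m = m'" for m m' :: "'v \<Rightarrow>\<^sub>0 nat" by (rule lookup_inject)
  show "lookup m \<in> UNIV \<rightarrow>\<^sub>E {..D}" if "m \<in> exponents D" for m :: "'v \<Rightarrow>\<^sub>0 nat"
    using that unfolding exponents_def PiE_UNIV_domain by blast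
  show "\<exists>m\<in>exponents D. f = lookup m" if f: "f \<in> UNIV \<rightarrow>\<^sub>E {..D}" for f :: "'v \<Rightarrow> nat"
  proof -
    have "finite {v. f v \<noteq> 0}" by (rule finite)
    then have "lookup (Abs_poly_mapping f) = f" by (simp add: Abs_poly_mapping_inverse)
    moreover have "f v \<le> D" for v using PiE_mem[OF f, of v] by simp
    ultimately show ?thesis by (intro bexI[of _ "Abs_poly_mapping f"]) (simp_all add: exponents_def)
  qed
qed

lemma finite_exponents [simp]: "finite (exponents D)"
proof -
  have "finite (UNIV \<rightarrow>\<^sub>E {..D} :: ('a \<Rightarrow> nat) set)" by (intro finite_PiE finite finite_atMost)
  then show ?thesis by (rule bij_betw_finite[OF bij_betw_exponents, THEN iffD2])
qed

lemma card_exponents: "card (exponents D :: ('v::finite \<Rightarrow>\<^sub>0 nat) set) = (D + 1) ^ CARD('v)"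
proof -
  have "card (exponents D :: ('v \<Rightarrow>\<^sub>0 nat) set) = card (UNIV \<rightarrow>\<^sub>E {..D} :: ('v \<Rightarrow> nat) set)"
    by (rule bij_betw_same_card[OF bij_betw_exponents])
  also have "\<dots> = (\<Prod>v\<in>(UNIV :: 'v set). card {..D})" by (rule card_PiE[OF finite])
  finally show ?thesis by simp
qed

lemma box_mono: "D \<le> D' \<Longrightarrow> box D \<subseteq> box D'" unfolding box_def using order_trans by blast

lemma box_sum: "(\<And>a. a \<in> A \<Longrightarrow> f a \<in> box D) \<Longrightarrow> sum f A \<in> box D"
  by (auto simp: box_def intro: dg_sum_le)

lemma box_mult: "p \<in> box D \<Longrightarrow> q \<in> box E \<Longrightarrow> p * q \<in> box (D + E)"
  by (auto simp: box_def intro: order_trans[OF dg_mult_le] add_mono)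

lemma box_power: "p \<in> box D \<Longrightarrow> p ^ k \<in> box (k * D)"
  by (auto simp: box_def intro: order_trans[OF dg_power_le])

lemma box_mconst: "mconst c \<in> box D" by (simp add: box_def)

lemma ex_box:
  fixes F :: "('v::finite, 'k::comm_ring_1) mpoly set"
  assumes "finite F" shows "\<exists>d. F \<subseteq> box d"
proof (intro exI subsetI)
  fix p assume p: "p \<in> F"
  have "dg y p \<le> (\<Sum>p\<in>F. msize p)" for y
  proof -
    have "dg y p \<le> msize p" unfolding msize_def by (rule member_le_sum) auto
    also have "\<dots> \<le> (\<Sum>p\<in>F. msize p)" by (rule member_le_sum) (use p assms in auto)
    finally show ?thesis .
  qed
  then show "p \<in> box (\<Sum>p\<in>F. msize p)" by (simp add: box_def)
qed

text \<open>Exponents of power products of a list of polynomials. Lists let the independence proofs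
  split off the first factor and recurse.\<close>

definition expos :: "nat \<Rightarrow> nat \<Rightarrow> nat list set" where
  "expos r D = {\<alpha>. set \<alpha> \<subseteq> {..D} \<and> length \<alpha> = r}"

fun monomial :: "'a::comm_monoid_mult list \<Rightarrow> nat list \<Rightarrow> 'a" where
  "monomial (f # fs) (a # \<alpha>) = f ^ a * monomial fs \<alpha>"
| "monomial _ _ = 1"

lemma finite_expos [simp]: "finite (expos r D)"
  unfolding expos_def by (rule finite_lists_length_eq) simp

lemma card_expos: "card (expos r D) = (D + 1) ^ r"
  unfolding expos_def by (subst card_lists_length_eq) auto

lemma expos_0: "expos 0 D = {[]}" by (auto simp: expos_def)

lemma sum_expos_Suc: "(\<Sum>\<alpha>\<in>expos (Suc r) D. F \<alpha>) = (\<Sum>a\<le>D. \<Sum>\<beta>\<in>expos r D. F (a # \<beta>))"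
proof -
  have "expos (Suc r) D = (\<lambda>(a, \<beta>). a # \<beta>) ` ({..D} \<times> expos r D)"
    by (force simp: expos_def length_Suc_conv image_iff)
  moreover have "inj_on (\<lambda>(a, \<beta>). a # \<beta>) ({..D} \<times> expos r D)" by (auto simp: inj_on_def)
  ultimately show ?thesis by (simp add: sum.reindex sum.cartesian_product split_def o_def)
qed

lemma monomial_box:
  "set fs \<subseteq> box d \<Longrightarrow> \<alpha> \<in> expos (length fs) D \<Longrightarrow> monomial fs \<alpha> \<in> box (length fs * (D * d))"
proof (induction fs arbitrary: \<alpha>)
  case Nil
  then show ?case using box_mconst[of 1] by (simp add: expos_0)
next
  case (Cons f fs)
  then obtain a \<beta> where \<alpha>: "\<alpha> = a # \<beta>" "a \<le> D" "\<beta> \<in> expos (length fs) D"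
    by (auto simp: expos_def length_Suc_conv)
  have "f ^ a \<in> box (D * d)" using Cons.prems \<alpha> box_mono[of "a * d" "D * d"] box_power[of f d a] by auto
  then show ?case using Cons \<alpha> by (auto intro!: box_mult)
qed

lemma poly_growth:
  fixes c n :: nat
  shows "\<exists>D. (c * D + 1) ^ n < (D + 1) ^ Suc n"
proof -
  \<comment> \<open>This \<open>D\<close> absorbs the constant: ((c + 1) (D + 1))^n is D (D + 1)^n,
    one factor short of the right-hand side.\<close>
  define D where "D = (c + 1) ^ n"
  have "(c * D + 1) ^ n \<le> ((c + 1) * (D + 1)) ^ n" by (intro power_mono) auto
  also have "\<dots> = D * (D + 1) ^ n" by (simp only: D_def power_mult_distrib)
  also have "\<dots> < (D + 1) ^ Suc n" by simp
  finally show ?thesis by blast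
qed

lemma lookup_mconst_mult: "lookup (mconst c * p) m = c * lookup p m"
proof -
  have "mconst c * p = (\<Sum>m\<in>keys p. single m (c * lookup p m))"
    by (subst (1) mpoly_sum_monomials[symmetric]) (simp add: sum_distrib_left mconst_def mult_single)
  then show ?thesis by (auto simp: lookup_sum lookup_single when_def in_keys_iff)
qed

text \<open>With exponents up to \<open>D\<close> there are (D + 1)^(n + 1) power products. If the
  given polynomials lie in \<open>box d\<close>, all these products lie in a box of side linear in
  \<open>D\<close>, with only O(D^n) coefficients to cancel.\<close>

lemma algebraic_dependence:
  fixes fs :: "('v::finite, 'k::field) mpoly list"
  assumes "length fs = Suc CARD('v)"
  shows "\<exists>D u. (\<exists>\<alpha>\<in>expos (length fs) D. u \<alpha> \<noteq> 0) \<and>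
     (\<Sum>\<alpha>\<in>expos (length fs) D. mconst (u \<alpha>) * monomial fs \<alpha>) = 0"
proof -
  let ?n = "CARD('v)"
  obtain d where d: "set fs \<subseteq> box d" using ex_box[of "set fs"] by auto
  obtain D where D: "(Suc ?n * d * D + 1) ^ ?n < (D + 1) ^ Suc ?n" using poly_growth by blast
  define E where "E = Suc ?n * d * D"
  have "card (exponents E :: ('v \<Rightarrow>\<^sub>0 nat) set) < card (expos (length fs) D)"
    unfolding card_exponents card_expos assms E_def using D by simp
  from homogeneous_system[OF _ _ this, of "\<lambda>m \<alpha>. lookup (monomial fs \<alpha>) m"]
  obtain u where u: "\<exists>\<alpha>\<in>expos (length fs) D. u \<alpha> \<noteq> 0"
    "\<forall>m\<in>exponents E. (\<Sum>\<alpha>\<in>expos (length fs) D. u \<alpha> * lookup (monomial fs \<alpha>) m) = 0"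
    by auto
  have "(\<Sum>\<alpha>\<in>expos (length fs) D. mconst (u \<alpha>) * monomial fs \<alpha>) = 0"
  proof (rule poly_mapping_eqI)
    fix m
    have "(\<Sum>\<alpha>\<in>expos (length fs) D. u \<alpha> * lookup (monomial fs \<alpha>) m) = 0"
    proof (cases "m \<in> exponents E")
      case False
      have "lookup (monomial fs \<alpha>) m = 0" if "\<alpha> \<in> expos (length fs) D" for \<alpha>
      proof -
        have "monomial fs \<alpha> \<in> box E"
          using monomial_box[OF d that] unfolding assms E_def by (simp only: mult_ac)
        then show ?thesis using False by (auto simp: box_keys in_keys_iff)
      qed
      then show ?thesis by simp
    qed (use u in simp)
    then show "lookup (\<Sum>\<alpha>\<in>expos (length fs) D. mconst (u \<alpha>) * monomial fs \<alpha>) m = lookup 0 m"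
      by (simp add: lookup_sum lookup_mconst_mult)
  qed
  with u show ?thesis by blast
qed

lemma monomial_sum_Cons:
  fixes f :: "('v::finite, 'k::field) mpoly"
  shows "(\<Sum>\<alpha>\<in>expos (length (f # fs)) D. mconst (u \<alpha>) * monomial (f # fs) \<alpha>) =
   (\<Sum>a\<le>D. (\<Sum>\<beta>\<in>expos (length fs) D. mconst (u (a # \<beta>)) * monomial fs \<beta>) * f ^ a)"
  by (simp add: sum_expos_Suc sum_distrib_left sum_distrib_right mult_ac)

section \<open>Prime ideals and the length of their chains\<close>

definition ideal_of :: "'a::comm_ring_1 set \<Rightarrow> bool" where
  "ideal_of P \<longleftrightarrow> 0 \<in> P \<and> (\<forall>p\<in>P. \<forall>q\<in>P. p + q \<in> P) \<and> (\<forall>p\<in>P. \<forall>b. b * p \<in> P)"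

definition primeideal_of :: "'a::comm_ring_1 set \<Rightarrow> bool" where
  "primeideal_of P \<longleftrightarrow> ideal_of P \<and> 1 \<notin> P \<and> (\<forall>p q. p * q \<in> P \<longrightarrow> p \<in> P \<or> q \<in> P)"

lemma ideal_ofD:
  assumes "ideal_of P"
  shows "0 \<in> P" "p \<in> P \<Longrightarrow> q \<in> P \<Longrightarrow> p + q \<in> P" "p \<in> P \<Longrightarrow> b * p \<in> P" "p \<in> P \<Longrightarrow> p * b \<in> P"
    "p \<in> P \<Longrightarrow> - p \<in> P" "p \<in> P \<Longrightarrow> q \<in> P \<Longrightarrow> p - q \<in> P" "(\<And>a. a \<in> A \<Longrightarrow> f a \<in> P) \<Longrightarrow> sum f A \<in> P"
proof -
  show 1: "0 \<in> P" "p \<in> P \<Longrightarrow> q \<in> P \<Longrightarrow> p + q \<in> P" "p \<in> P \<Longrightarrow> b * p \<in> P" for p q b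
    using assms by (auto simp: ideal_of_def)
  show "p \<in> P \<Longrightarrow> p * b \<in> P" using 1(3) by (metis mult.commute)
  show 2: "p \<in> P \<Longrightarrow> - p \<in> P" for p using 1(3)[of p "-1"] by simp
  show "p \<in> P \<Longrightarrow> q \<in> P \<Longrightarrow> p - q \<in> P" using 1(2)[of p "- q"] 2 by simp
  show "(\<And>a. a \<in> A \<Longrightarrow> f a \<in> P) \<Longrightarrow> sum f A \<in> P"
    by (induction A rule: infinite_finite_induct) (auto intro: 1)
qed

lemma primeideal_ofD:
  assumes "primeideal_of P"
  shows "ideal_of P" "1 \<notin> P" "p * q \<in> P \<Longrightarrow> p \<in> P \<or> q \<in> P"
  using assms by (auto simp: primeideal_of_def)

lemma primeideal_power: "primeideal_of P \<Longrightarrow> p ^ k \<in> P \<Longrightarrow> p \<in> P"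
  by (induction k) (auto dest: primeideal_ofD)

text \<open>An ascending chain of primes starting at \<open>P\<close>, recorded by one witness for
  each strict inclusion; these witnesses turn out to be algebraically independent modulo
  \<open>P\<close>.\<close>

fun prime_chain :: "'a::comm_ring_1 set \<Rightarrow> 'a list \<Rightarrow> bool" where
  "prime_chain P [] \<longleftrightarrow> primeideal_of P"
| "prime_chain P (f # fs) \<longleftrightarrow> primeideal_of P \<and> f \<notin> P \<and> (\<exists>Q. P \<subseteq> Q \<and> f \<in> Q \<and> prime_chain Q fs)"

lemma prime_chain_prime: "prime_chain P fs \<Longrightarrow> primeideal_of P"
  by (cases fs) auto

text \<open>
  A relation among the \<open>f\<^sub>i\<close> has, in the lexicographic order, a lowest monomial; dividing by it inside
  successive members of the chain shows that its coefficient lies in the last prime.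
\<close>

lemma prime_chain_indep:
  fixes fs :: "('v::finite, 'k::field) mpoly list"
  assumes "prime_chain P fs" "(\<Sum>\<alpha>\<in>expos (length fs) D. mconst (u \<alpha>) * monomial fs \<alpha>) \<in> P"
    "\<alpha> \<in> expos (length fs) D"
  shows "u \<alpha> = 0"
  using assms
proof (induction fs arbitrary: P u \<alpha>)
  case Nil
  then have m: "mconst (u []) \<in> P" "\<alpha> = []" "primeideal_of P" by (auto simp: expos_0)
  show ?case
  proof (rule ccontr)
    assume "u \<alpha> \<noteq> 0"
    then have "mconst (inverse (u [])) * mconst (u []) = (1 :: ('v, 'k) mpoly)" using m by (simp flip: mconst_mult)
    with m have "1 \<in> P" by (metis ideal_ofD(3) primeideal_ofD(1))
    then show False using m primeideal_ofD by blast
  qed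
next
  case (Cons f fs)
  then obtain Q where Q: "P \<subseteq> Q" "f \<in> Q" "prime_chain Q fs" and P: "primeideal_of P" "f \<notin> P" by auto
  note iQ = ideal_ofD[OF primeideal_ofD(1)[OF prime_chain_prime[OF Q(3)]]]
  note iP = ideal_ofD[OF primeideal_ofD(1)[OF P(1)]]
  define S where "S a = (\<Sum>\<beta>\<in>expos (length fs) D. mconst (u (a # \<beta>)) * monomial fs \<beta>)" for a
  have SP: "(\<Sum>a\<le>D. S a * f ^ a) \<in> P"
    using Cons.prems(2) unfolding monomial_sum_Cons S_def .
  obtain a \<beta> where \<alpha>: "\<alpha> = a # \<beta>" "a \<le> D" "\<beta> \<in> expos (length fs) D"
    using Cons.prems(3) by (auto simp: expos_def length_Suc_conv)
  have "\<forall>\<beta>\<in>expos (length fs) D. u (a # \<beta>) = 0" if "a \<le> D" for a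
    using that
  proof (induction a rule: less_induct)
    case (less a)
    have S0: "S b = 0" if "b < a" for b using less.IH[OF that] that less.prems by (simp add: S_def)
    have "(\<Sum>b\<le>D. S b * f ^ b) = (\<Sum>b\<in>{a..D}. S b * f ^ b)"
      by (rule sum.mono_neutral_right) (auto simp: S0)
    also have "\<dots> = S a * f ^ a + (\<Sum>b\<in>{Suc a..D}. S b * f ^ b)"
      using less.prems by (simp add: sum.atLeast_Suc_atMost)
    also have "(\<Sum>b\<in>{Suc a..D}. S b * f ^ b) = f ^ a * (f * (\<Sum>b\<in>{Suc a..D}. S b * f ^ (b - Suc a)))"
      unfolding sum_distrib_left
    proof (intro sum.cong refl)
      fix b assume "b \<in> {Suc a..D}"
      then have "f ^ b = f ^ (Suc a + (b - Suc a))" by simp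
      then have "f ^ b = f ^ a * f * f ^ (b - Suc a)" by (simp only: power_add power_Suc2)
      then show "S b * f ^ b = f ^ a * (f * (S b * f ^ (b - Suc a)))" by (simp add: mult_ac)
    qed
    finally have "(\<Sum>b\<le>D. S b * f ^ b) = f ^ a * (S a + f * (\<Sum>b\<in>{Suc a..D}. S b * f ^ (b - Suc a)))" 
      by (simp add: algebra_simps)
    with SP have "f ^ a * (S a + f * (\<Sum>b\<in>{Suc a..D}. S b * f ^ (b - Suc a))) \<in> P" by simp
    \<comment> \<open>\<open>f\<close> is outside the prime \<open>P\<close>, so its power cancels
      there; in \<open>Q\<close>, which contains \<open>f\<close>, only \<open>S a\<close> then
      remains.\<close>
    then have "S a + f * (\<Sum>b\<in>{Suc a..D}. S b * f ^ (b - Suc a)) \<in> P"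
      using P primeideal_power primeideal_ofD(3) by blast
    then have "S a + f * (\<Sum>b\<in>{Suc a..D}. S b * f ^ (b - Suc a)) - f * (\<Sum>b\<in>{Suc a..D}. S b * f ^ (b - Suc a)) \<in> Q"
      using Q by (intro iQ(6) iQ(4)) auto
    then have "S a \<in> Q" by simp
    then show ?case using Cons.IH[OF Q(3), of "\<lambda>\<beta>. u (a # \<beta>)"] unfolding S_def by blast
  qed
  then show ?case using \<alpha> by simp
qed

lemma prime_chain_take: "prime_chain P fs \<Longrightarrow> prime_chain P (take k fs)"
proof (induction fs arbitrary: P k)
  case (Cons f fs)
  show ?case
  proof (cases k)
    case 0
    then show ?thesis using prime_chain_prime[OF Cons.prems] by simp
  next
    case (Suc j)
    then show ?thesis using Cons.prems Cons.IH[of _ j] by auto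
  qed
qed simp

text \<open>Cut down to n + 1 witnesses, a longer chain would make them independent, against
  \<open>algebraic_dependence\<close>. This is the upper bound n for the Krull dimension of the
  polynomial ring.\<close>

lemma prime_chain_length:
  fixes fs :: "('v::finite, 'k::field) mpoly list"
  assumes "prime_chain P fs"
  shows "length fs \<le> CARD('v)"
proof (rule ccontr)
  assume "\<not> length fs \<le> CARD('v)"
  then obtain gs where gs: "prime_chain P gs" "length gs = Suc CARD('v)"
    using prime_chain_take[OF assms, of "Suc CARD('v)"] by fastforce
  obtain D u where u: "\<exists>\<alpha>\<in>expos (length gs) D. u \<alpha> \<noteq> 0"
    "(\<Sum>\<alpha>\<in>expos (length gs) D. mconst (u \<alpha>) * monomial gs \<alpha>) = 0"
    using algebraic_dependence[OF gs(2)] by blast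
  have "0 \<in> P" using prime_chain_prime[OF gs(1)] by (simp add: ideal_ofD(1) primeideal_ofD(1))
  then show False using u prime_chain_indep[OF gs(1), of u D] by auto
qed

section \<open>Irreducible polynomials are prime\<close>

text \<open>Primality tested only against factors from k[S], the form in which Gauss's lemma can be
  iterated over the variables.\<close>

definition prime_on :: "'v set \<Rightarrow> ('v::{finite,linorder}, 'k::field) mpoly \<Rightarrow> bool" where
  "prime_on S h \<longleftrightarrow> (\<forall>f\<in>polys_in S. \<forall>g\<in>polys_in S. h dvd f * g \<longrightarrow> h dvd f \<or> h dvd g)"

lemma irreducible_factor_exists:
  fixes p :: "('v::{finite,linorder}, 'k::field) mpoly"
  assumes "p \<noteq> 0" "\<not> p dvd 1"
  shows "\<exists>q. irreducible q \<and> q dvd p"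
  using assms
proof (induction "msize p" arbitrary: p rule: less_induct)
  case less
  show ?case
  proof (cases "irreducible p")
    case False
    then obtain a b where ab: "p = a * b" "\<not> a dvd 1" "\<not> b dvd 1"
      using less.prems by (auto simp: irreducible_def)
    then have nz: "a \<noteq> 0" "b \<noteq> 0" using less.prems by auto
    then have "msize a < msize p" using ab by (auto simp: msize_mult unit_iff_msize)
    then obtain q where "irreducible q" "q dvd a" using less.hyps ab nz by blast
    then show ?thesis using ab by auto
  qed auto
qed

lemma upoly_const: "dg y c = 0 \<Longrightarrow> upoly y c = [:c:]"
proof -
  assume "dg y c = 0"
  then obtain a where a: "upoly y c = [:a:]" unfolding dg_def using degree_eq_zeroE by blast
  then have "c = a" using poly_upoly[of y c] by simp
  with a show ?thesis by simp
qed

lemma dvd_coeff_upoly_iff: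
  fixes c p :: "('v::{finite,linorder}, 'k::field) mpoly"
  assumes "dg y c = 0"
  shows "c dvd p \<longleftrightarrow> (\<forall>j. c dvd coeff (upoly y p) j)"
proof
  assume "c dvd p"
  then show "\<forall>j. c dvd coeff (upoly y p) j"
    by (auto simp: upoly_hom upoly_const[OF assms])
next
  assume "\<forall>j. c dvd coeff (upoly y p) j"
  then have "[:c:] dvd upoly y p" by (rule const_poly_dvd_iff[THEN iffD2])
  then obtain Q where "upoly y p = [:c:] * Q" by blast
  then have "p = c * poly Q (mvar y)" using poly_upoly[of y p] by (simp only: poly_mult) simp
  then show "c dvd p" by simp
qed

lemma polys_in_insert_dg_0:
  "p \<in> polys_in (insert y S) \<Longrightarrow> dg y p = 0 \<Longrightarrow> p \<in> polys_in S"
proof -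
  assume a: "p \<in> polys_in (insert y S)" "dg y p = 0"
  have "dg z p = 0" if "z \<notin> S" for z
    using a that by (cases "z = y") (auto simp: polys_in_def)
  then show ?thesis by (simp add: polys_in_def)
qed

lemma polys_in_insertI: "p \<in> polys_in S \<Longrightarrow> p \<in> polys_in (insert y S)"
  by (auto simp: polys_in_def)

text \<open>Gauss's lemma: take the first coefficients of \<open>f\<close> and \<open>g\<close> in
  \<open>y\<close>, at \<open>i\<close> and \<open>j\<close>, that \<open>\<pi>\<close> does not
  divide. In the coefficient of \<open>f * g\<close> at \<open>i + j\<close> every other product is
  divisible by \<open>\<pi>\<close>.\<close>

lemma prime_on_insert:
  assumes y: "y \<notin> S" and \<pi>: "\<pi> \<in> polys_in S" "prime_on S \<pi>"
  shows "prime_on (insert y S) \<pi>"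
  unfolding prime_on_def
proof (intro ballI impI, rule ccontr)
  fix f g assume fg: "f \<in> polys_in (insert y S)" "g \<in> polys_in (insert y S)" "\<pi> dvd f * g"
    and no: "\<not> (\<pi> dvd f \<or> \<pi> dvd g)"
  have d0: "dg y \<pi> = 0" using y \<pi> by (auto simp: polys_in_def)
  define i where "i = (LEAST i. \<not> \<pi> dvd coeff (upoly y f) i)"
  define j where "j = (LEAST j. \<not> \<pi> dvd coeff (upoly y g) j)"
  have ex: "\<exists>i. \<not> \<pi> dvd coeff (upoly y f) i" "\<exists>j. \<not> \<pi> dvd coeff (upoly y g) j"
    using no dvd_coeff_upoly_iff[OF d0, of f] dvd_coeff_upoly_iff[OF d0, of g] by auto
  have i: "\<not> \<pi> dvd coeff (upoly y f) i" unfolding i_def by (rule LeastI_ex[OF ex(1)])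
  have j: "\<not> \<pi> dvd coeff (upoly y g) j" unfolding j_def by (rule LeastI_ex[OF ex(2)])
  have li: "\<pi> dvd coeff (upoly y f) k" if "k < i" for k using not_less_Least[OF that[unfolded i_def]] by blast
  have lj: "\<pi> dvd coeff (upoly y g) k" if "k < j" for k using not_less_Least[OF that[unfolded j_def]] by blast
  have "coeff (upoly y (f * g)) (i + j) =
      (\<Sum>k\<le>i + j. coeff (upoly y f) k * coeff (upoly y g) (i + j - k))"
    by (simp add: upoly_hom coeff_mult)
  also have "\<dots> = coeff (upoly y f) i * coeff (upoly y g) j +
      (\<Sum>k\<in>{..i + j} - {i}. coeff (upoly y f) k * coeff (upoly y g) (i + j - k))"
    by (subst sum.remove[of _ i]) auto
  finally have e: "coeff (upoly y f) i * coeff (upoly y g) j = coeff (upoly y (f * g)) (i + j) -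
      (\<Sum>k\<in>{..i + j} - {i}. coeff (upoly y f) k * coeff (upoly y g) (i + j - k))" by simp
  have "\<pi> dvd coeff (upoly y f) k * coeff (upoly y g) (i + j - k)" if "k \<in> {..i + j} - {i}" for k
  proof (cases "k < i")
    case False
    with that have "i + j - k < j" by auto
    then show ?thesis using lj by simp
  qed (simp add: li)
  then have "\<pi> dvd coeff (upoly y f) i * coeff (upoly y g) j"
    unfolding e using fg(3) dvd_coeff_upoly_iff[OF d0, of "f * g"] by (intro dvd_diff dvd_sum) auto
  moreover have "coeff (upoly y f) i \<in> polys_in S" "coeff (upoly y g) j \<in> polys_in S"
    using coeff_upoly_in[OF fg(1), of i] coeff_upoly_in[OF fg(2), of j] y by auto
  ultimately show False using \<pi>(2) i j unfolding prime_on_def by blast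
qed

text \<open>The irreducible factors of \<open>c\<close> are handed out one by one to
  \<open>q\<close> or \<open>m\<close>, each being prime on k[T]. It serves to clear denominators
  from k[S].\<close>

lemma split_divisor:
  fixes c :: "('v::{finite,linorder}, 'k::field) mpoly"
  assumes pr: "\<And>\<pi> :: ('v, 'k) mpoly. \<pi> \<in> polys_in S \<Longrightarrow> irreducible \<pi> \<Longrightarrow> prime_on T \<pi>"
    and "c \<in> polys_in S" "c \<noteq> 0" "q \<in> polys_in T" "m \<in> polys_in T" "c dvd q * m"
  shows "\<exists>c1 c2. c = c1 * c2 \<and> c1 dvd q \<and> c2 dvd m"
  using assms(2-)
proof (induction "msize c" arbitrary: c q m rule: less_induct)
  case less
  consider "c dvd 1" | "q = 0" | "m = 0" | "\<not> c dvd 1" "q \<noteq> 0" "m \<noteq> 0" by argo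
  then show ?case
  proof cases
    case 1
    then have "c dvd q" by (rule dvd_trans[OF _ one_dvd])
    then show ?thesis by (intro exI[of _ c] exI[of _ 1]) simp
  next
    case 2
    then show ?thesis by (intro exI[of _ c] exI[of _ 1]) simp
  next
    case 3
    then show ?thesis by (intro exI[of _ 1] exI[of _ c]) simp
  next
    case 4
    then obtain \<pi> where \<pi>: "irreducible \<pi>" "\<pi> dvd c" using irreducible_factor_exists less.prems by blast
    then obtain c' where c': "c = \<pi> * c'" by blast
    have nz: "\<pi> \<noteq> 0" "c' \<noteq> 0" using c' less.prems by auto
    have inS: "\<pi> \<in> polys_in S" "c' \<in> polys_in S"
      using less.prems c' nz polys_in_factor[of \<pi> c' S] polys_in_factor[of c' \<pi> S] by (auto simp: mult.commute)
    have lt: "msize c' < msize c"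
      using nz \<pi> c' by (auto simp: msize_mult irreducible_def unit_iff_msize)
    have "\<pi> dvd q * m" using \<pi> less.prems dvd_trans by blast
    then consider "\<pi> dvd q" | "\<pi> dvd m" using pr[OF inS(1) \<pi>(1)] less.prems unfolding prime_on_def by blast
    then show ?thesis
    proof cases
      case 1
      then obtain q' where q': "q = \<pi> * q'" by blast
      then have T': "q' \<in> polys_in T" using less.prems 4 nz polys_in_factor[of q' \<pi> T] by (auto simp: mult.commute)
      have dv: "c' dvd q' * m" using less.prems(5) nz unfolding c' q' by (simp add: mult.assoc)
      obtain c1 c2 where "c' = c1 * c2" "c1 dvd q'" "c2 dvd m"
        using less.hyps[OF lt inS(2) nz(2) T' less.prems(4) dv] by blast
      then show ?thesis unfolding c' q' by (intro exI[of _ "\<pi> * c1"] exI[of _ c2]) (simp add: mult_ac)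
    next
      case 2
      then obtain m' where m': "m = \<pi> * m'" by blast
      then have T': "m' \<in> polys_in T" using less.prems 4 nz polys_in_factor[of m' \<pi> T] by (auto simp: mult.commute)
      have dv: "c' dvd q * m'" using less.prems(5) nz unfolding c' m' by (simp add: mult.left_commute[of q])
      obtain c1 c2 where "c' = c1 * c2" "c1 dvd q" "c2 dvd m'"
        using less.hyps[OF lt inS(2) nz(2) less.prems(3) T' dv] by blast
      then show ?thesis unfolding c' m' by (intro exI[of _ c1] exI[of _ "\<pi> * c2"]) (simp add: mult_ac)
    qed
  qed
qed

text \<open>This is Euclid's argument in k(S)[y] with denominators cleared. Let \<open>m\<close>
  have least degree in \<open>y\<close> among the nonzero combinations of \<open>h\<close> and
  \<open>f\<close>. If that degree is 0, then \<open>m\<close> is a unit of k(S) and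
  \<open>h\<close> divides \<open>m * g\<close>, hence \<open>g\<close>. Otherwise \<open>m\<close>
  divides both \<open>h\<close> and \<open>f\<close> up to factors from k[S]; irreducibility makes
  \<open>h\<close> divide \<open>m\<close>, hence \<open>f\<close>.\<close>

lemma prime_on_insert_positive_degree:
  fixes h :: "('v::{finite,linorder}, 'k::field) mpoly"
  assumes y: "y \<notin> S" and pr: "\<And>\<pi> :: ('v, 'k) mpoly. \<pi> \<in> polys_in S \<Longrightarrow> irreducible \<pi> \<Longrightarrow> prime_on (insert y S) \<pi>"
    and h: "h \<in> polys_in (insert y S)" "irreducible h" "dg y h \<noteq> 0"
  shows "prime_on (insert y S) h"
  unfolding prime_on_def
proof (intro ballI impI)
  let ?T = "polys_in (insert y S) :: ('v, 'k) mpoly set"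
  fix f g assume fg: "f \<in> ?T" "g \<in> ?T" "h dvd f * g"
  have h0: "h \<noteq> 0" using h by auto
  have dS: "dg y c = 0" if "c \<in> polys_in S" for c :: "('v, 'k) mpoly" using that y by (auto simp: polys_in_def)
  have du: "dg y c = 0" if "c dvd 1" for c :: "('v, 'k) mpoly"
    using that member_le_sum[of y UNIV "\<lambda>y. dg y c"] by (auto simp: unit_iff_msize msize_def)
  \<comment> \<open>A common factor \<open>c1\<close> of \<open>h\<close> and \<open>c\<close> has
    degree 0 in \<open>y\<close>, so the cofactor in \<open>h\<close> carries the positive degree
    and is no unit; then \<open>c1\<close> is one.\<close>
  have cancel: "h dvd z" if c: "c \<in> polys_in S" "c \<noteq> 0" and z: "z \<in> ?T" "h dvd c * z" for c z
  proof (cases "z = 0")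
    case False
    obtain w where w: "c * z = h * w" using z by blast
    then have w0: "w \<noteq> 0" using c False by auto
    have "h * w \<in> ?T" using w c z by (metis polys_in_insertI polys_in_mult)
    then have "w \<in> ?T" using polys_in_factor[of w h] w0 h0 by (simp add: mult.commute)
    moreover have "c dvd h * w" using w by (metis dvd_triv_left)
    ultimately obtain c1 c2 where cc: "c = c1 * c2" "c1 dvd h" "c2 dvd w"
      using split_divisor[OF pr c] h by blast
    obtain h' where h': "h = c1 * h'" using cc by blast
    have nz: "c1 \<noteq> 0" "c2 \<noteq> 0" "h' \<noteq> 0" using cc c h' h0 by auto
    have "dg y c1 = 0" using cc c nz polys_in_factor[of c1 c2 S] by (intro dS) auto
    then have "\<not> h' dvd 1" using du[of h'] h(3) h' nz by (auto simp: dg_mult)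
    then have "c1 dvd 1" using h(2) h' unfolding irreducible_def by blast
    then have "c dvd w" using cc(1,3) mult_dvd_mono[of c1 1 c2 w] by simp
    then obtain w' where "w = c * w'" by blast
    then have "c * z = c * (h * w')" using w by (simp add: mult_ac)
    then show ?thesis using c by simp
  qed simp
  define J where "J = {u * h + v * f | u v. u \<in> ?T \<and> v \<in> ?T}"
  have JI: "u * h + v * f \<in> J" if "u \<in> ?T" "v \<in> ?T" for u v using that by (auto simp: J_def)
  have T01: "0 \<in> ?T" "1 \<in> ?T" using polys_in_mconst[of 0] polys_in_mconst[of 1] by auto
  have hJ: "h \<in> J" using JI[of 1 0] T01 by simp
  have fJ: "f \<in> J" using JI[of 0 1] T01 by simp
  have JT: "J \<subseteq> ?T" using fg h by (auto simp: J_def intro!: polys_in_add polys_in_mult)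
  have Jd: "a * p - b * q \<in> J" if "p \<in> J" "q \<in> J" "a \<in> ?T" "b \<in> ?T" for p q a b
  proof -
    obtain u v u' v' where e: "p = u * h + v * f" "q = u' * h + v' * f" "u \<in> ?T" "v \<in> ?T" "u' \<in> ?T" "v' \<in> ?T"
      using \<open>p \<in> J\<close> \<open>q \<in> J\<close> by (auto simp: J_def)
    have "a * p - b * q = (a * u - b * u') * h + (a * v - b * v') * f" by (simp add: e algebra_simps)
    also have "\<dots> \<in> J" using e that by (intro JI polys_in_diff polys_in_mult)
    finally show ?thesis .
  qed
  obtain m where m: "m \<in> J" "m \<noteq> 0" "\<And>z. z \<in> J \<Longrightarrow> z \<noteq> 0 \<Longrightarrow> dg y m \<le> dg y z"
    using ex_has_least_nat[of "\<lambda>z. z \<in> J \<and> z \<noteq> 0" h "dg y"] hJ h0 by auto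
  have lcS: "lead_coeff (upoly y z) \<in> polys_in S" if "z \<in> ?T" for z
    using coeff_upoly_in[OF that, of "degree (upoly y z)"] y by auto
  \<comment> \<open>Pseudo-division: multiplying by the leading coefficient \<open>a\<close> of
    \<open>m\<close> allows the leading term of \<open>z\<close> to be cancelled; the final
    remainder has smaller degree than \<open>m\<close> and so is zero.\<close>
  have div: "\<exists>c\<in>polys_in S. c \<noteq> 0 \<and> m dvd c * z" if "z \<in> J" for z
    using that
  proof (induction "dg y z" arbitrary: z rule: less_induct)
    case less
    show ?case
    proof (cases "z = 0")
      case True
      then show ?thesis using polys_in_mconst[of 1 S] by (intro bexI[of _ 1]) auto
    next
      case False
      define a b k where "a = lead_coeff (upoly y m)" and "b = lead_coeff (upoly y z)" and "k = dg y z - dg y m"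
      have ab: "a \<in> polys_in S" "b \<in> polys_in S" "a \<noteq> 0"
        using lcS JT less.prems m by (auto simp: a_def b_def)
      define z' where "z' = a * z - b * mvar y ^ k * m"
      have pw: "mvar y ^ k \<in> ?T" 
        by (induction k) (auto intro: polys_in_mult polys_in_mvar T01)
      have z'J: "z' \<in> J" unfolding z'_def
        by (intro Jd less.prems m polys_in_mult pw polys_in_insertI ab)
      have le: "dg y m \<le> dg y z" using m less.prems False by blast
      have up: "upoly y z' = smult a (upoly y z) - monom b k * upoly y m"
        using ab by (simp add: z'_def upoly_hom upoly_const dS upoly_mvar monom_altdef)
      have "coeff (monom b k * upoly y m) (k + dg y m) = b * a"
        by (simp add: coeff_monom_mult a_def dg_def)
      then have "coeff (upoly y z') (dg y z) = 0" using le
        by (simp add: up k_def) (simp add: b_def dg_def mult.commute)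
      moreover have "degree (upoly y z') \<le> dg y z"
        unfolding up
      proof (rule degree_diff_le)
        show "degree (smult a (upoly y z)) \<le> dg y z" by (simp add: dg_def degree_smult_le)
        show "degree (monom b k * upoly y m) \<le> dg y z"
          using degree_mult_le[of "monom b k" "upoly y m"] degree_monom_le[of b k] le
          by (simp add: k_def dg_def)
      qed
      ultimately have "z' = 0 \<or> dg y z' < dg y z"
        using eq_zero_or_degree_less[of "upoly y z'" "dg y z"] by (auto simp: dg_def)
      then obtain c where c: "c \<in> polys_in S" "c \<noteq> 0" "m dvd c * z'"
        using less.hyps[OF _ z'J] polys_in_mconst[of 1 S] by (metis dvd_0_right mconst_1 mult_zero_right one_neq_zero)
      have "c * z' + (c * b * mvar y ^ k) * m = (c * a) * z" by (simp add: z'_def algebra_simps)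
      then have "m dvd (c * a) * z" using c by (metis dvd_add dvd_triv_right)
      then show ?thesis using c ab by (intro bexI[of _ "c * a"]) (auto intro: polys_in_mult)
    qed
  qed
  have mT: "m \<in> ?T" using m JT by auto
  show "h dvd f \<or> h dvd g"
  proof (cases "dg y m = 0")
    case True
    then have mS: "m \<in> polys_in S" using mT polys_in_insert_dg_0 by blast
    obtain u v where uv: "m = u * h + v * f" using m by (auto simp: J_def)
    have "m * g = h * (u * g) + v * (f * g)" by (simp add: uv algebra_simps)
    then have "h dvd m * g" using fg(3) by simp
    then show ?thesis using cancel[OF mS m(2) fg(2)] by blast
  next
    case False
    obtain c where c: "c \<in> polys_in S" "c \<noteq> 0" "m dvd c * h" using div[OF hJ] by blast
    obtain q where q: "c * h = m * q" using c by blast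
    have q0: "q \<noteq> 0" using q c h0 by auto
    have "m * q \<in> ?T" using q c h by (metis polys_in_insertI polys_in_mult)
    then have "q \<in> ?T" using polys_in_factor[of q m] q0 m by (simp add: mult.commute)
    moreover have "c dvd m * q" using q by (metis dvd_triv_left)
    ultimately obtain c1 c2 where cc: "c = c1 * c2" "c1 dvd m" "c2 dvd q"
      using split_divisor[OF pr c(1,2) mT] by blast
    \<comment> \<open>Once \<open>c1 * c2\<close> is cancelled, \<open>m1 * q1\<close> factors
      \<open>h\<close> itself, and \<open>m1\<close> carries the degree of \<open>m\<close> in
      \<open>y\<close>; hence \<open>q1\<close> is a unit.\<close>
    obtain m1 q1 where mq: "m = c1 * m1" "q = c2 * q1" using cc by blast
    have nz: "c1 \<noteq> 0" "c2 \<noteq> 0" "m1 \<noteq> 0" using cc c mq m by auto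
    have "(c1 * c2) * h = (c1 * c2) * (m1 * q1)" using q unfolding cc mq by (simp add: mult_ac)
    then have hm: "h = m1 * q1" using nz by simp
    have "dg y c1 = 0" using cc c nz polys_in_factor[of c1 c2 S] by (intro dS) auto
    then have "\<not> m1 dvd 1" using du[of m1] False mq nz by (auto simp: dg_mult)
    then have "q1 dvd 1" using h(2) hm unfolding irreducible_def by blast
    then have "h dvd m1" unfolding hm using mult_dvd_mono[of m1 m1 q1 1] by simp
    then have hdm: "h dvd m" using mq by simp
    obtain c' where c': "c' \<in> polys_in S" "c' \<noteq> 0" "m dvd c' * f" using div[OF fJ] by blast
    then show ?thesis using cancel[OF c'(1,2) fg(1)] hdm dvd_trans by blast
  qed
qed

lemma irreducible_prime_on:
  fixes h :: "('v::{finite,linorder}, 'k::field) mpoly"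
  assumes "finite S" "h \<in> polys_in S" "irreducible h"
  shows "prime_on S h"
  using assms
proof (induction S arbitrary: h rule: finite_induct)
  case empty
  then have "msize h = 0" by (simp add: polys_in_def msize_def)
  then show ?case using empty msize_0_unit[of h] by (auto simp: irreducible_def)
next
  case (insert y S)
  have pr: "prime_on (insert y S) \<pi>" if "\<pi> \<in> polys_in S" "irreducible \<pi>" for \<pi> :: "('v, 'k) mpoly"
    using prime_on_insert insert.IH insert.hyps that by blast
  show ?case
  proof (cases "dg y h = 0")
    case True
    then show ?thesis using pr insert.prems polys_in_insert_dg_0 by blast
  next
    case False
    then show ?thesis using prime_on_insert_positive_degree[OF _ pr] insert by blast
  qed
qed

lemma irreducible_dvd_mult:
  fixes h :: "('v::{finite,linorder}, 'k::field) mpoly"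
  assumes "irreducible h" "h dvd f * g"
  shows "h dvd f \<or> h dvd g"
  using irreducible_prime_on[of UNIV h] assms by (auto simp: prime_on_def polys_in_UNIV)

section \<open>Traces\<close>

text \<open>The summation set is an argument, so that factors through a smaller index set keep the
  type of the matrices.\<close>

definition mat_mult :: "'j set \<Rightarrow> ('i \<Rightarrow> 'j \<Rightarrow> 'k::comm_ring_1) \<Rightarrow> ('j \<Rightarrow> 'l \<Rightarrow> 'k) \<Rightarrow> 'i \<Rightarrow> 'l \<Rightarrow> 'k" where
  "mat_mult I A B = (\<lambda>i j. \<Sum>l\<in>I. A i l * B l j)"

definition mat_trace :: "'i set \<Rightarrow> ('i \<Rightarrow> 'i \<Rightarrow> 'k::comm_ring_1) \<Rightarrow> 'k" where
  "mat_trace I A = (\<Sum>i\<in>I. A i i)"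

text \<open>Powers start at exponent one: \<open>mat_pow I A k\<close> is the power with exponent \<open>k + 1\<close>.\<close>

fun mat_pow :: "'i set \<Rightarrow> ('i \<Rightarrow> 'i \<Rightarrow> 'k::comm_ring_1) \<Rightarrow> nat \<Rightarrow> 'i \<Rightarrow> 'i \<Rightarrow> 'k" where
  "mat_pow I A 0 = A"
| "mat_pow I A (Suc k) = mat_mult I A (mat_pow I A k)"

definition mat_eq :: "'i set \<Rightarrow> ('i \<Rightarrow> 'i \<Rightarrow> 'k) \<Rightarrow> ('i \<Rightarrow> 'i \<Rightarrow> 'k) \<Rightarrow> bool" where
  "mat_eq I A B \<longleftrightarrow> (\<forall>i\<in>I. \<forall>j\<in>I. A i j = B i j)"

lemma mat_mult_assoc: "mat_mult I A (mat_mult J B C) = mat_mult J (mat_mult I A B) C"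
  unfolding mat_mult_def sum_distrib_left sum_distrib_right 
  by (intro ext) (subst sum.swap, simp add: mult.assoc)

lemma mat_trace_mult: "mat_trace I (mat_mult K A B) = mat_trace K (mat_mult I B A)"
  unfolding mat_trace_def mat_mult_def by (subst sum.swap) (simp add: mult.commute)

lemma mat_eq_mult: "mat_eq I A A' \<Longrightarrow> mat_eq I B B' \<Longrightarrow> mat_eq I (mat_mult I A B) (mat_mult I A' B')"
  unfolding mat_eq_def mat_mult_def by (auto intro!: sum.cong)

lemma mat_eq_pow: "mat_eq I A A' \<Longrightarrow> mat_eq I (mat_pow I A k) (mat_pow I A' k)"
  by (induction k) (auto intro: mat_eq_mult)

lemma mat_eq_trace: "mat_eq I A A' \<Longrightarrow> mat_trace I A = mat_trace I A'"
  unfolding mat_eq_def mat_trace_def by (auto intro!: sum.cong)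

lemma mat_pow_Suc2: "mat_mult I (mat_pow I A k) A = mat_pow I A (Suc k)"
  by (induction k) (simp_all flip: mat_mult_assoc)

lemma mat_pow_shift:
  "mat_pow K (mat_mult I Q P) (Suc k) = mat_mult I Q (mat_mult I (mat_pow I (mat_mult K P Q) k) P)"
proof (induction k)
  case 0
  show ?case by (simp add: mat_mult_assoc)
next
  case (Suc k)
  have "mat_pow K (mat_mult I Q P) (Suc (Suc k)) = mat_mult K (mat_mult I Q P) (mat_pow K (mat_mult I Q P) (Suc k))"
    by simp
  also have "\<dots> = mat_mult I Q (mat_mult I (mat_pow I (mat_mult K P Q) (Suc k)) P)"
    unfolding Suc by (simp add: mat_mult_assoc)
  finally show ?case .
qed

text \<open>The trace is invariant under cyclic permutation. If a singular matrix is written as P Q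
  through a smaller index set, the smaller matrix Q P has the same power traces; both inductions on
  the size rest on such a passage.\<close>

lemma mat_trace_pow_shift:
  "mat_trace K (mat_pow K (mat_mult I Q P) k) = mat_trace I (mat_pow I (mat_mult K P Q) k)"
proof (cases k)
  case 0
  then show ?thesis using mat_trace_mult[of K I Q P] by simp
next
  case (Suc l)
  have "mat_trace K (mat_pow K (mat_mult I Q P) k) =
      mat_trace I (mat_mult K (mat_mult I (mat_pow I (mat_mult K P Q) l) P) Q)"
    unfolding Suc mat_pow_shift by (rule mat_trace_mult)
  also have "\<dots> = mat_trace I (mat_mult I (mat_pow I (mat_mult K P Q) l) (mat_mult K P Q))"
    by (simp add: mat_mult_assoc)
  finally show ?thesis by (simp only: mat_pow_Suc2 Suc)
qed

definition singular_on :: "'i set \<Rightarrow> ('i \<Rightarrow> 'i \<Rightarrow> 'k::field) \<Rightarrow> bool" where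
  "singular_on I A \<longleftrightarrow> (\<exists>c. (\<exists>j\<in>I. c j \<noteq> 0) \<and> (\<forall>i\<in>I. (\<Sum>l\<in>I. A i l * c l) = 0))"

text \<open>A kernel vector with \<open>c j \<noteq> 0\<close> expresses column \<open>j\<close> by
  the other columns, so \<open>A\<close> factors through \<open>I - {j}\<close>.\<close>

lemma singular_factor:
  fixes A :: "'i \<Rightarrow> 'i \<Rightarrow> 'k::field"
  assumes "finite I" "singular_on I A"
  shows "\<exists>j\<in>I. \<exists>P Q :: 'i \<Rightarrow> 'i \<Rightarrow> 'k. mat_eq I A (mat_mult (I - {j}) P Q)"
proof -
  obtain c j where j: "j \<in> I" "c j \<noteq> 0" and c: "\<And>i. i \<in> I \<Longrightarrow> (\<Sum>l\<in>I. A i l * c l) = 0"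
    using assms by (auto simp: singular_on_def)
  define Q where "Q l m = (if m = j then - c l / c j else if l = m then 1 else 0)" for l m
  have "A i m = (\<Sum>l\<in>I - {j}. A i l * Q l m)" if "i \<in> I" "m \<in> I" for i m
  proof (cases "m = j")
    case True
    have "A i j * c j + (\<Sum>l\<in>I - {j}. A i l * c l) = 0"
      using c[OF that(1)] sum.remove[OF assms(1) j(1), of "\<lambda>l. A i l * c l"] by simp
    then have "A i j * c j = - (\<Sum>l\<in>I - {j}. A i l * c l)" by (simp add: eq_neg_iff_add_eq_0)
    then have "A i j = - (\<Sum>l\<in>I - {j}. A i l * c l) / c j" by (rule eq_divide_imp[OF j(2)])
    moreover have "(\<Sum>l\<in>I - {j}. A i l * Q l m) = - (\<Sum>l\<in>I - {j}. A i l * c l) / c j"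
      by (simp add: True Q_def sum_divide_distrib sum_negf)
    ultimately show ?thesis using True by simp
  next
    case False
    then have "(\<Sum>l\<in>I - {j}. A i l * Q l m) = (\<Sum>l\<in>I - {j}. if l = m then A i l else 0)"
      by (intro sum.cong) (auto simp: Q_def)
    then show ?thesis using assms that False by simp
  qed
  then have "mat_eq I A (mat_mult (I - {j}) A Q)" unfolding mat_eq_def mat_mult_def by blast
  then show ?thesis using j by blast
qed

text \<open>A nonzero column of the last nonzero power is a kernel vector, so \<open>A\<close> is
  singular and factors as P Q; then Q P is smaller, again nilpotent, and has the same trace.\<close>

lemma nilpotent_trace:
  fixes A :: "'i \<Rightarrow> 'i \<Rightarrow> 'k::field"
  assumes "finite I" "mat_eq I (mat_pow I A M) (\<lambda>_ _. 0)"
  shows "mat_trace I A = 0"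
  using assms
proof (induction "card I" arbitrary: I A M rule: less_induct)
  case less
  show ?case
  proof (cases "I = {}")
    case False
    have "singular_on I A"
    proof -
      define k where "k = (LEAST k. mat_eq I (mat_pow I A k) (\<lambda>_ _. 0))"
      have k: "mat_eq I (mat_pow I A k) (\<lambda>_ _. 0)"
        unfolding k_def by (rule LeastI[of "\<lambda>k. mat_eq I (mat_pow I A k) (\<lambda>_ _. 0)", OF less.prems(2)])
      show ?thesis
      proof (cases k)
        case 0
        then show ?thesis using k False unfolding singular_on_def
          by (intro exI[of _ "\<lambda>_. 1"]) (auto simp: mat_eq_def)
      next
        case (Suc l)
        then have "\<not> mat_eq I (mat_pow I A l) (\<lambda>_ _. 0)"
          using not_less_Least[of l "\<lambda>k. mat_eq I (mat_pow I A k) (\<lambda>_ _. 0)"] by (simp add: k_def)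
        then obtain a b where ab: "a \<in> I" "b \<in> I" "mat_pow I A l a b \<noteq> 0" by (auto simp: mat_eq_def)
        then show ?thesis using k unfolding singular_on_def Suc
          by (intro exI[of _ "\<lambda>i. mat_pow I A l i b"]) (auto simp: mat_eq_def mat_mult_def)
      qed
    qed
    then obtain j P Q where j: "j \<in> I" and PQ: "mat_eq I A (mat_mult (I - {j}) P Q)"
      using singular_factor less.prems by blast
    have z: "mat_pow I (mat_mult (I - {j}) P Q) M a b = 0" if "a \<in> I" "b \<in> I" for a b
      using mat_eq_pow[OF PQ, of M] less.prems(2) that by (auto simp: mat_eq_def)
    have "mat_mult I (mat_pow I (mat_mult (I - {j}) P Q) M) P a b = 0" if "a \<in> I" for a b
      by (subst mat_mult_def) (simp add: z that)
    then have "mat_mult I Q (mat_mult I (mat_pow I (mat_mult (I - {j}) P Q) M) P) a b = 0" for a b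
      by (subst mat_mult_def) simp
    then have n: "mat_eq (I - {j}) (mat_pow (I - {j}) (mat_mult I Q P) (Suc M)) (\<lambda>_ _. 0)"
      unfolding mat_pow_shift by (simp add: mat_eq_def)
    have "mat_trace (I - {j}) (mat_mult I Q P) = 0"
      by (rule less.hyps[OF card_Diff1_less[OF less.prems(1) j] _ n]) (use less.prems in simp)
    then show ?thesis using mat_eq_trace[OF PQ] mat_trace_mult[of I "I - {j}" P Q] by simp
  qed (simp add: mat_trace_def)
qed

text \<open>A singular \<open>A\<close> = P Q is replaced by the smaller Q P, with \<open>y\<close>
  replaced by y P. For a nonsingular \<open>A\<close>, a linear relation between its powers can be
  divided by the lowest power in it; the trace of the result is the lowest coefficient times the
  size, so in characteristic zero the size is 0.\<close>

lemma trace_powers_zero: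
  fixes A :: "'i \<Rightarrow> 'i \<Rightarrow> 'k::field_char_0"
  assumes "finite I" "\<And>k. mat_trace I (mat_pow I A k) = 0"
    "\<And>j. j \<in> I \<Longrightarrow> (\<Sum>i\<in>I. y i * A i j) = y j" "i \<in> I"
  shows "y i = 0"
  using assms
proof (induction "card I" arbitrary: I A y i rule: less_induct)
  case less
  note I = \<open>finite I\<close>
  show ?case
  proof (cases "singular_on I A")
    case True
    then obtain j P Q where j: "j \<in> I" and PQ: "mat_eq I A (mat_mult (I - {j}) P Q)"
      using singular_factor[OF I] by blast
    let ?K = "I - {j}"
    define y' where "y' l = (\<Sum>i\<in>I. y i * P i l)" for l
    have yQ: "(\<Sum>l\<in>?K. y' l * Q l m) = y m" if "m \<in> I" for m
    proof -
      have "(\<Sum>l\<in>?K. y' l * Q l m) = (\<Sum>l\<in>?K. \<Sum>i\<in>I. y i * (P i l * Q l m))"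
        by (simp add: y'_def sum_distrib_right mult.assoc)
      also have "\<dots> = (\<Sum>i\<in>I. y i * mat_mult ?K P Q i m)"
        by (subst sum.swap) (simp add: mat_mult_def sum_distrib_left)
      also have "\<dots> = (\<Sum>i\<in>I. y i * A i m)"
        using PQ that by (intro sum.cong) (auto simp: mat_eq_def)
      finally show ?thesis using less.prems that by simp
    qed
    have "y' l = 0" if "l \<in> ?K" for l
    proof (rule less.hyps[of ?K "mat_mult I Q P" y' l])
      show "card ?K < card I" using I j by (intro card_Diff1_less)
      show "finite ?K" using I by simp
      show "l \<in> ?K" by fact
      show "mat_trace ?K (mat_pow ?K (mat_mult I Q P) k) = 0" for k
        by (rule trans[OF mat_trace_pow_shift trans[OF mat_eq_trace[OF mat_eq_pow[OF PQ], symmetric] less.prems(2)]])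
      show "(\<Sum>l\<in>?K. y' l * mat_mult I Q P l m) = y' m" if "m \<in> ?K" for m
      proof -
        have "(\<Sum>l\<in>?K. y' l * mat_mult I Q P l m) = (\<Sum>l\<in>?K. \<Sum>i\<in>I. (y' l * Q l i) * P i m)"
          by (simp add: mat_mult_def sum_distrib_left mult.assoc)
        also have "\<dots> = (\<Sum>i\<in>I. (\<Sum>l\<in>?K. y' l * Q l i) * P i m)"
          by (subst sum.swap) (simp add: sum_distrib_right)
        also have "\<dots> = (\<Sum>i\<in>I. y i * P i m)" by (intro sum.cong refl) (simp only: yQ)
        also have "\<dots> = y' m" by (simp add: y'_def)
        finally show ?thesis .
      qed
    qed
    then show ?thesis using yQ[OF less.prems(4)] by simp
  next
    case ns: False
    \<comment> \<open>Powers with the exponent 0 included: the identity matrix is what remains of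
      the lowest term after division.\<close>
    define W where "W k = (case k of 0 \<Rightarrow> (\<lambda>i j. if i = j then 1 else 0) | Suc l \<Rightarrow> mat_pow I A l)" for k
    have WS: "mat_mult I A (W k) i j = W (Suc k) i j" if "i \<in> I" "j \<in> I" for k i j
    proof (cases k)
      case 0
      have "(\<Sum>l\<in>I. A i l * (if l = j then 1 else 0)) = (\<Sum>l\<in>I. if l = j then A i l else 0)"
        by (rule sum.cong) auto
      then show ?thesis using 0 I that by (simp add: W_def mat_mult_def)
    qed (simp add: W_def)
    \<comment> \<open>There are \<open>N + 1\<close> powers against \<open>N\<close> matrix
      entries.\<close>
    define N where "N = card I * card I"
    have "card (I \<times> I) < card {..N}" by (simp add: N_def card_cartesian_product)
    from homogeneous_system[OF finite_cartesian_product[OF I I] finite_atMost this, of "\<lambda>x k. W k (fst x) (snd x)"]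
    obtain u where u: "\<exists>k\<in>{..N}. u k \<noteq> 0"
      and uX: "\<forall>x\<in>I \<times> I. (\<Sum>k\<le>N. u k * W k (fst x) (snd x)) = 0" by blast
    have u0: "(\<Sum>k\<le>N. u k * W k i j) = 0" if "i \<in> I" "j \<in> I" for i j
      using bspec[OF uX, of "(i, j)"] that by simp
    define k0 where "k0 = (LEAST k. u k \<noteq> 0)"
    have k0: "u k0 \<noteq> 0" unfolding k0_def by (rule LeastI_ex) (use u in blast)
    have lt: "u k = 0" if "k < k0" for k using not_less_Least[of k "\<lambda>k. u k \<noteq> 0"] that by (simp add: k0_def)
    have k0N: "k0 \<le> N"
    proof -
      obtain k where "k \<le> N" "u k \<noteq> 0" using u by auto
      then show ?thesis using Least_le[of "\<lambda>k. u k \<noteq> 0" k] by (simp add: k0_def)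
    qed
    \<comment> \<open>The relation divided by the power of \<open>A\<close> with exponent
      \<open>d\<close>. Nonsingularity lets each division preserve the value zero.\<close>
    define T where "T d i j = (\<Sum>k\<in>{k0..N}. u k * W (k - d) i j)" for d i j
    have T: "\<forall>i\<in>I. \<forall>j\<in>I. T d i j = 0" if "d \<le> k0" for d
      using that
    proof (induction d)
      case 0
      have "T 0 i j = (\<Sum>k\<le>N. u k * W k i j)" for i j
        unfolding T_def by (rule sum.mono_neutral_cong_left) (auto simp: lt)
      then show ?case using u0 by simp
    next
      case (Suc d)
      have AT: "(\<Sum>l\<in>I. A i l * T (Suc d) l j) = 0" if "i \<in> I" "j \<in> I" for i j
      proof -
        have "(\<Sum>l\<in>I. A i l * T (Suc d) l j) = (\<Sum>l\<in>I. \<Sum>k\<in>{k0..N}. u k * (A i l * W (k - Suc d) l j))"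
          by (simp add: T_def sum_distrib_left mult.left_commute)
        also have "\<dots> = (\<Sum>k\<in>{k0..N}. u k * mat_mult I A (W (k - Suc d)) i j)"
          by (subst sum.swap) (simp add: mat_mult_def sum_distrib_left)
        also have "\<dots> = T d i j"
          unfolding T_def
        proof (intro sum.cong refl)
          fix k assume "k \<in> {k0..N}"
          then have "Suc (k - Suc d) = k - d" using Suc.prems by auto
          then show "u k * mat_mult I A (W (k - Suc d)) i j = u k * W (k - d) i j"
            using WS[OF that, of "k - Suc d"] by simp
        qed
        also have "\<dots> = 0" using Suc that by simp
        finally show ?thesis .
      qed
      show ?case
      proof (intro ballI, rule ccontr)
        fix i j assume ij: "i \<in> I" "j \<in> I" "T (Suc d) i j \<noteq> 0"
        then have "singular_on I A" unfolding singular_on_def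
          by (intro exI[of _ "\<lambda>l. T (Suc d) l j"]) (auto simp: AT)
        then show False using ns by simp
      qed
    qed
    have tr: "mat_trace I (W k) = (if k = 0 then of_nat (card I) else 0)" for k
      using less.prems(2)[of "k - 1"] by (cases k) (simp_all add: W_def, simp add: mat_trace_def)
    have "0 = mat_trace I (T k0)" using T[of k0] by (simp add: mat_trace_def)
    also have "\<dots> = (\<Sum>k\<in>{k0..N}. u k * mat_trace I (W (k - k0)))"
      unfolding mat_trace_def T_def by (subst sum.swap) (simp add: sum_distrib_left)
    also have "\<dots> = (\<Sum>k\<in>{k0..N}. if k = k0 then u k0 * of_nat (card I) else 0)"
      by (rule sum.cong) (auto simp: tr)
    also have "\<dots> = u k0 * of_nat (card I)" using k0N by simp
    finally have "I = {}" using k0 I by simp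
    then show ?thesis using less.prems by simp
  qed
qed

lemma mpeval_of_nat [simp]: "mpeval (of_nat j) x = of_nat j"
  by (induction j) simp_all

section \<open>The action on polynomials\<close>

locale unipotent_action =
  fixes G :: "('m::finite \<Rightarrow> 'k::field_char_0) monoid" (structure)
    and \<phi> :: "('m \<Rightarrow> 'k) \<Rightarrow> ('n::{finite,linorder} \<Rightarrow> 'k) \<Rightarrow> ('n \<Rightarrow> 'k)"
  assumes unip: "unipotent_algebraic_group G" and act: "regular_action G \<phi>"
begin

sublocale group G
  using unip by (simp add: unipotent_algebraic_group_def affine_algebraic_group_def)

sublocale ga: group_action G UNIV \<phi>
  using act by (simp add: regular_action_def)

lemma act_mult: "g \<in> carrier G \<Longrightarrow> h \<in> carrier G \<Longrightarrow> \<phi> (g \<otimes> h) a = \<phi> g (\<phi> h a)"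
  by (rule ga.composition_rule) auto

lemma act_one [simp]: "\<phi> \<one> a = a"
  using fun_cong[OF ga.id_eq_one, of a] by simp

lemma coordinate_polys:
  "\<exists>\<Phi> :: 'n \<Rightarrow> ('m + 'n, 'k) mpoly. \<forall>u\<in>carrier G. \<forall>a i. \<phi> u a i = mpeval (\<Phi> i) (case_sum u a)"
proof -
  have "\<forall>i. \<exists>p. \<forall>z. z \<circ> Inl \<in> carrier G \<longrightarrow> \<phi> (z \<circ> Inl) (z \<circ> Inr) i = mpeval p z"
    using act by (simp add: regular_action_def regular_map_on_def regular_fun_on_def)
  then obtain \<Phi> :: "'n \<Rightarrow> ('m + 'n, 'k) mpoly" where
    \<Phi>: "\<And>i z. z \<circ> Inl \<in> carrier G \<Longrightarrow> \<phi> (z \<circ> Inl) (z \<circ> Inr) i = mpeval (\<Phi> i) z" by metis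
  have "case_sum u a \<circ> Inl = u" "case_sum u a \<circ> Inr = a" for u :: "'m \<Rightarrow> 'k" and a :: "'n \<Rightarrow> 'k"
    by (auto simp: fun_eq_iff)
  then have "\<phi> u a i = mpeval (\<Phi> i) (case_sum u a)" if "u \<in> carrier G" for u a i
    using \<Phi>[of "case_sum u a" i] that by simp
  then show ?thesis by blast
qed

text \<open>By regularity \<open>p\<close> composed with the action is a polynomial in the group and
  space coordinates together. Sorted by space monomials it becomes \<open>Q\<close>, with
  polynomials in the group coordinates as coefficients. Its finite support gives local finiteness,
  its coefficients are regular functions on the group.\<close>

lemma pull_family:
  "\<exists>Q :: ('n, ('m, 'k) mpoly) mpoly. \<forall>u\<in>carrier G. \<exists>q :: ('n, 'k) mpoly. (\<forall>a. mpeval q a = mpeval p (\<phi> u a)) \<and>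
     (\<forall>m. lookup q m = mpeval (lookup Q m) u)"
proof -
  obtain \<Phi> :: "'n \<Rightarrow> ('m + 'n, 'k) mpoly" where
    \<Phi>: "\<And>u a i. u \<in> carrier G \<Longrightarrow> \<phi> u a i = mpeval (\<Phi> i) (case_sum u a)"
    using coordinate_polys by blast
  \<comment> \<open>\<open>F\<close> sorts a joint polynomial by its space monomials;
    \<open>E u\<close> below specialises the coefficients at \<open>u\<close>.\<close>
  define F :: "('m + 'n, 'k) mpoly \<Rightarrow> ('n, ('m, 'k) mpoly) mpoly" where
    "F = mpsubst (\<lambda>c. mconst (mconst c)) (case_sum (\<lambda>j. mconst (mvar j)) mvar)"
  have rF: "ring_map F" unfolding F_def
    by (intro ring_map_mpsubst ring_map_comp[OF ring_map_mconst] ring_map_mconst)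
  define E :: "('m \<Rightarrow> 'k) \<Rightarrow> ('n, ('m, 'k) mpoly) mpoly \<Rightarrow> ('n, 'k) mpoly" where
    "E u = mpsubst (\<lambda>r. mconst (mpeval r u)) mvar" for u
  have rE0: "ring_map (\<lambda>r. mconst (mpeval r u))" for u :: "'m \<Rightarrow> 'k"
    by (intro ring_map_comp[OF ring_map_mconst] ring_map_mpeval)
  have rE: "ring_map (E u)" for u unfolding E_def by (intro ring_map_mpsubst rE0)
  have lookup_E: "lookup (E u Q) m = mpeval (lookup Q m) u" for u Q m
  proof -
    have "E u Q = (\<Sum>m\<in>keys Q. single m (mpeval (lookup Q m) u))"
      unfolding E_def mpsubst_def by (simp flip: single_eq_prod)
    then show ?thesis by (auto simp: lookup_sum lookup_single when_def in_keys_iff)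
  qed
  have EF: "mpeval (E u (F r)) a = mpeval r (case_sum u a)" for u r a
  proof (rule ring_map_mpoly_eq[OF _ ring_map_mpeval])
    show "ring_map (\<lambda>r. mpeval (E u (F r)) a)"
      by (rule ring_map_comp[OF ring_map_mpeval ring_map_comp[OF rE rF]])
    have c: "F (mconst c) = mconst (mconst c)" for c
      unfolding F_def by (rule mpsubst_mconst) (intro ring_map_comp[OF ring_map_mconst] ring_map_mconst)
    have v: "F (mvar i) = case_sum (\<lambda>j. mconst (mvar j)) mvar i" for i
      unfolding F_def by (rule mpsubst_mvar) (intro ring_map_comp[OF ring_map_mconst] ring_map_mconst)
    have Ec: "E u (mconst r) = mconst (mpeval r u)" for r
      unfolding E_def by (rule mpsubst_mconst) (rule rE0)
    have Ev: "E u (mvar i) = mvar i" for i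
      unfolding E_def by (rule mpsubst_mvar) (rule rE0)
    show "mpeval (E u (F (mconst c))) a = mpeval (mconst c) (case_sum u a)" for c
      by (simp add: c Ec)
    show "mpeval (E u (F (mvar i))) a = mpeval (mvar i) (case_sum u a)" for i
      by (cases i) (simp_all add: v Ec Ev)
  qed
  define q :: "('m + 'n, 'k) mpoly" where "q = mpsubst mconst \<Phi> p"
  have q: "mpeval q (case_sum u a) = mpeval p (\<phi> u a)" if "u \<in> carrier G" for u a
    unfolding q_def
  proof (rule ring_map_mpoly_eq[OF _ ring_map_mpeval])
    show "ring_map (\<lambda>p. mpeval (mpsubst mconst \<Phi> p) (case_sum u a))"
      by (rule ring_map_comp[OF ring_map_mpeval ring_map_mpsubst[OF ring_map_mconst]])
  qed (simp_all add: mpsubst_mconst[OF ring_map_mconst] mpsubst_mvar[OF ring_map_mconst] \<Phi>[OF that])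
  show ?thesis
    by (intro exI[of _ "F q"] ballI exI[of _ "E _ (F q)"] conjI allI) (simp_all add: EF q lookup_E)
qed

text \<open>The choice is unique by \<open>mpeval_ext\<close>. On polynomials the group acts from
  the right: the pullback along \<open>g \<otimes> h\<close> applies \<open>pull g\<close>
  first.\<close>

definition pull :: "('m \<Rightarrow> 'k) \<Rightarrow> ('n, 'k) mpoly \<Rightarrow> ('n, 'k) mpoly" where
  "pull u p = (SOME q. \<forall>a. mpeval q a = mpeval p (\<phi> u a))"

lemma mpeval_pull [simp]: "u \<in> carrier G \<Longrightarrow> mpeval (pull u p) a = mpeval p (\<phi> u a)"
proof -
  assume "u \<in> carrier G"
  then have "\<exists>q. \<forall>a. mpeval q a = mpeval p (\<phi> u a)" using pull_family[of p] by blast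
  from someI_ex[OF this] show ?thesis unfolding pull_def by blast
qed

lemma pull_eqI: "u \<in> carrier G \<Longrightarrow> (\<And>a. mpeval q a = mpeval p (\<phi> u a)) \<Longrightarrow> pull u p = q"
  by (rule mpeval_ext) simp

lemma ring_map_pull: "u \<in> carrier G \<Longrightarrow> ring_map (pull u)"
  unfolding ring_map_def by (intro conjI allI pull_eqI) simp_all

lemma pull_mconst [simp]: "u \<in> carrier G \<Longrightarrow> pull u (mconst c) = mconst c"
  by (rule pull_eqI) simp_all

lemmas pull_hom = ring_mapD[OF ring_map_pull]

lemma pull_mult_group:
  "g \<in> carrier G \<Longrightarrow> h \<in> carrier G \<Longrightarrow> pull (g \<otimes> h) p = pull h (pull g p)"
  by (rule pull_eqI) (simp_all add: act_mult)

lemma pull_one [simp]: "pull \<one> p = p" by (rule pull_eqI) simp_all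

lemma pull_inj: "u \<in> carrier G \<Longrightarrow> pull u p = pull u q \<longleftrightarrow> p = q"
proof
  assume u: "u \<in> carrier G" and e: "pull u p = pull u q"
  have "pull (inv u) (pull u x) = x" for x using u by (simp flip: pull_mult_group)
  then show "p = q" using e by metis
qed simp

lemma pull_eq_0 [simp]: "u \<in> carrier G \<Longrightarrow> pull u p = 0 \<longleftrightarrow> p = 0"
  using pull_inj[of u p 0] by (simp add: pull_hom)

lemma pull_coeffs:
  "\<exists>Q :: ('n, ('m, 'k) mpoly) mpoly. \<forall>u\<in>carrier G. \<forall>m. lookup (pull u p) m = mpeval (lookup Q m) u"
proof -
  obtain Q :: "('n, ('m, 'k) mpoly) mpoly" where Q: "\<forall>u\<in>carrier G. \<exists>q :: ('n, 'k) mpoly. (\<forall>a. mpeval q a = mpeval p (\<phi> u a)) \<and>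
     (\<forall>m. lookup q m = mpeval (lookup Q m) u)" using pull_family by blast
  have "lookup (pull u p) m = mpeval (lookup Q m) u" if u: "u \<in> carrier G" for u m
  proof -
    obtain q where q: "\<And>a. mpeval q a = mpeval p (\<phi> u a)" "\<And>m. lookup q m = mpeval (lookup Q m) u"
      using Q u by blast
    then show ?thesis using pull_eqI[OF u q(1)] by simp
  qed
  then show ?thesis by blast
qed

text \<open>Only monomials from the finite set \<open>keys Q\<close> can occur, whatever
  \<open>u\<close> is: the orbit of \<open>p\<close> spans a finite-dimensional space.\<close>

lemma pull_orbit_box: "\<exists>d. \<forall>u\<in>carrier G. pull u p \<in> box d"
proof -
  obtain Q :: "('n, ('m, 'k) mpoly) mpoly" where
    Q: "\<And>u m. u \<in> carrier G \<Longrightarrow> lookup (pull u p) m = mpeval (lookup Q m) u" using pull_coeffs by blast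
  obtain d where d: "{Q} \<subseteq> box d" using ex_box[of "{Q}"] by auto
  have "pull u p \<in> box d" if "u \<in> carrier G" for u
    unfolding box_keys
  proof
    fix m assume "m \<in> keys (pull u p)"
    then have "m \<in> keys Q" using Q[OF that, of m] by (auto simp: in_keys_iff)
    then show "m \<in> exponents d" using d by (auto simp: box_keys)
  qed
  then show ?thesis by blast
qed

text \<open>Degrees grow at most by a factor that bounds the images of the n coordinates. That it
  depends on neither \<open>D\<close> nor \<open>u\<close> keeps the counts in
  \<open>dim_bound_sweep\<close> polynomial of the right order.\<close>

lemma pull_box: "\<exists>\<delta>. \<forall>D. \<forall>p\<in>box D. \<forall>u\<in>carrier G. pull u p \<in> box (\<delta> * D)"
proof -
  have "\<forall>i. \<exists>d. \<forall>u\<in>carrier G. pull u (mvar i) \<in> box d" using pull_orbit_box by blast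
  then obtain d where d: "\<And>i u. u \<in> carrier G \<Longrightarrow> pull u (mvar i) \<in> box (d i)" by metis
  define e where "e = (\<Sum>i\<in>UNIV. d i)"
  have e: "pull u (mvar i) \<in> box e" if "u \<in> carrier G" for i u
  proof -
    have "d i \<le> e" unfolding e_def by (rule member_le_sum) auto
    then show ?thesis using box_mono d[OF that] by blast
  qed
  have "pull u p \<in> box (CARD('n) * e * D)" if p: "p \<in> box D" and u: "u \<in> carrier G" for D p u
  proof -
    have "pull u p = (\<Sum>m\<in>keys p. pull u (single m (lookup p m)))"
      by (subst mpoly_sum_monomials[symmetric]) (simp add: pull_hom[OF u])
    also have "\<dots> \<in> box (CARD('n) * e * D)"
    proof (rule box_sum)
      fix m assume m: "m \<in> keys p"
      have "pull u (single m (lookup p m)) = mconst (lookup p m) * (\<Prod>i\<in>UNIV. pull u (mvar i) ^ lookup m i)"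
        by (subst single_eq_prod) (simp add: pull_hom[OF u] u)
      moreover have "(\<Prod>i\<in>UNIV. pull u (mvar i) ^ lookup m i) \<in> box (CARD('n) * e * D)"
        unfolding box_def
      proof (intro CollectI allI)
        fix y
        have "dg y (\<Prod>i\<in>UNIV. pull u (mvar i) ^ lookup m i) \<le> (\<Sum>i\<in>UNIV. dg y (pull u (mvar i) ^ lookup m i))"
          by (rule dg_prod_le) simp
        also have "\<dots> \<le> (\<Sum>i\<in>(UNIV :: 'n set). D * e)"
        proof (rule sum_mono)
          fix i
          have "lookup m i \<le> D" using p m by (auto simp: box_keys exponents_def)
          moreover have "dg y (pull u (mvar i)) \<le> e" using e[OF u] by (simp add: box_def)
          ultimately have "lookup m i * dg y (pull u (mvar i)) \<le> D * e" by (rule mult_le_mono)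
          then show "dg y (pull u (mvar i) ^ lookup m i) \<le> D * e"
            using dg_power_le order_trans by blast
        qed
        finally show "dg y (\<Prod>i\<in>UNIV. pull u (mvar i) ^ lookup m i) \<le> CARD('n) * e * D"
          by (simp add: mult_ac)
      qed
      ultimately show "pull u (single m (lookup p m)) \<in> box (CARD('n) * e * D)"
        using box_mult[OF box_mconst[of "lookup p m" 0]] by simp
    qed
    finally show ?thesis .
  qed
  then show ?thesis by blast
qed

definition dif :: "('m \<Rightarrow> 'k) \<Rightarrow> ('n, 'k) mpoly \<Rightarrow> ('n, 'k) mpoly" where
  "dif g p = pull g p - p"

lemma dif_lin:
  assumes "g \<in> carrier G"
  shows "dif g (p + q) = dif g p + dif g q" "dif g (mconst c * p) = mconst c * dif g p"
    "dif g (p - q) = dif g p - dif g q" "dif g 0 = 0"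
  using assms by (simp_all add: dif_def pull_hom algebra_simps)

lemma dif_pow_lin:
  assumes "g \<in> carrier G"
  shows "(dif g ^^ N) (p + q) = (dif g ^^ N) p + (dif g ^^ N) q"
    "(dif g ^^ N) (p - q) = (dif g ^^ N) p - (dif g ^^ N) q" "(dif g ^^ N) 0 = 0"
  by (induction N) (simp_all add: dif_lin[OF assms])

text \<open>Each coefficient of \<open>pull u p\<close> is a regular function of \<open>u\<close>,
  and right translation by \<open>g\<close> minus the identity acts on it as \<open>dif g\<close>
  does on \<open>p\<close>. Unipotency of \<open>g\<close> kills it after finitely many steps;
  evaluation at \<open>\<one>\<close> returns to \<open>p\<close>.\<close>

lemma dif_nilpotent:
  assumes g: "g \<in> carrier G"
  shows "\<exists>N. (dif g ^^ N) p = 0"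
proof -
  obtain Q :: "('n, ('m, 'k) mpoly) mpoly" where
    Q: "\<And>u m. u \<in> carrier G \<Longrightarrow> lookup (pull u p) m = mpeval (lookup Q m) u" using pull_coeffs by blast
  define \<rho> :: "(('m \<Rightarrow> 'k) \<Rightarrow> 'k) \<Rightarrow> ('m \<Rightarrow> 'k) \<Rightarrow> 'k" where "\<rho> = (\<lambda>h x. h (x \<otimes> g) - h x)"
  \<comment> \<open>The clause \<open>N = 0\<close> off \<open>keys Q\<close> lets a finite sum of
    exponents serve for all \<open>m\<close>.\<close>
  have *: "\<exists>N. (\<forall>j\<ge>N. lookup ((dif g ^^ j) p) m = 0) \<and> (m \<notin> keys Q \<longrightarrow> N = 0)" for m
  proof -
    define f where "f u = mpeval (lookup Q m) u" for u
    have key: "\<forall>u\<in>carrier G. (\<rho> ^^ j) f u = lookup ((dif g ^^ j) (pull u p)) m" for j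
    proof (induction j)
      case 0
      then show ?case using Q by (simp add: f_def)
    next
      case (Suc j)
      show ?case
      proof
        fix u assume u: "u \<in> carrier G"
        have "(\<rho> ^^ Suc j) f u =
            lookup ((dif g ^^ j) (pull (u \<otimes> g) p)) m - lookup ((dif g ^^ j) (pull u p)) m"
          using Suc u g by (simp add: \<rho>_def)
        also have "\<dots> = lookup ((dif g ^^ j) (dif g (pull u p))) m"
          using u g by (simp add: dif_def pull_mult_group dif_pow_lin lookup_minus)
        also have "\<dots> = lookup ((dif g ^^ Suc j) (pull u p)) m" by (simp add: funpow_swap1)
        finally show "(\<rho> ^^ Suc j) f u = lookup ((dif g ^^ Suc j) (pull u p)) m" .
      qed
    qed
    then have key1: "(\<rho> ^^ j) f \<one> = lookup ((dif g ^^ j) p) m" for j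
      using bspec[OF key[of j] one_closed] by simp
    show ?thesis
    proof (cases "m \<in> keys Q")
      case False
      then have "f = (\<lambda>_. 0)" by (simp add: f_def fun_eq_iff in_keys_iff)
      moreover have "(\<rho> ^^ j) (\<lambda>_. 0) = (\<lambda>_. 0)" for j by (induction j) (simp_all add: \<rho>_def)
      ultimately have "lookup ((dif g ^^ j) p) m = 0" for j using key1[of j] by simp
      then show ?thesis by blast
    next
      case True
      have "regular_fun_on (carrier G) f" by (auto simp: regular_fun_on_def f_def)
      then obtain N where N: "\<forall>x\<in>carrier G. (\<rho> ^^ N) f x = 0"
        using unip g unfolding unipotent_algebraic_group_def unipotent_element_def \<rho>_def by blast
      have "\<forall>x\<in>carrier G. (\<rho> ^^ (i + N)) f x = 0" for i
        using N g by (induction i) (simp_all add: \<rho>_def)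
      then have "(\<rho> ^^ (i + N)) f \<one> = 0" for i by (rule bspec) simp
      then have "lookup ((dif g ^^ j) p) m = 0" if "j \<ge> N" for j
        using key1[of j] le_add_diff_inverse2[OF that] by metis
      then show ?thesis using True by blast
    qed
  qed
  obtain N where N: "\<And>m j. j \<ge> N m \<Longrightarrow> lookup ((dif g ^^ j) p) m = 0" and N0: "\<And>m. m \<notin> keys Q \<Longrightarrow> N m = 0"
  proof -
    define N where "N m = (SOME N. (\<forall>j\<ge>N. lookup ((dif g ^^ j) p) m = 0) \<and> (m \<notin> keys Q \<longrightarrow> N = 0))" for m
    have "(\<forall>j\<ge>N m. lookup ((dif g ^^ j) p) m = 0) \<and> (m \<notin> keys Q \<longrightarrow> N m = 0)" for m
      unfolding N_def by (rule someI_ex[OF *])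
    then show thesis using that[of N] by blast
  qed
  have "N m \<le> (\<Sum>m\<in>keys Q. N m)" for m
    by (cases "m \<in> keys Q") (simp_all add: N0 member_le_sum)
  then have "(dif g ^^ (\<Sum>m\<in>keys Q. N m)) p = 0" by (intro poly_mapping_eqI) (simp add: N)
  then show ?thesis by blast
qed

lemma dif_pow_mono: "g \<in> carrier G \<Longrightarrow> (dif g ^^ N) p = 0 \<Longrightarrow> N \<le> j \<Longrightarrow> (dif g ^^ j) p = 0"
  by (metis dif_pow_lin(3) funpow_add le_add_diff_inverse2 o_apply)

lemma dif_nilpotent_finite:
  assumes g: "g \<in> carrier G" and "finite S"
  shows "\<exists>N. \<forall>p\<in>S. (dif g ^^ N) p = 0"
proof -
  obtain N where N: "\<And>p. (dif g ^^ N p) p = 0" using dif_nilpotent[OF g] by metis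
  have "(dif g ^^ (\<Sum>p\<in>S. N p)) p = 0" if "p \<in> S" for p
    by (rule dif_pow_mono[OF g N]) (use that assms(2) in \<open>simp add: member_le_sum\<close>)
  then show ?thesis by blast
qed

text \<open>The binomial theorem for \<open>pull g\<close>, the sum of the identity and
  \<open>dif g\<close>.\<close>

lemma pull_pow:
  assumes g: "g \<in> carrier G"
  shows "pull (g [^] s) p = (\<Sum>j\<le>s. of_nat (s choose j) * (dif g ^^ j) p)"
proof (induction s arbitrary: p)
  case 0
  then show ?case by simp
next
  case (Suc s)
  let ?t = "\<lambda>j. (dif g ^^ j) p"
  have "pull (g [^] Suc s) p = pull (g [^] s) (pull g p)"
  proof -
    have "g [^] Suc s = g \<otimes> g [^] s" using g nat_pow_Suc2 by blast
    then show ?thesis using g by (simp add: pull_mult_group)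
  qed
  also have "\<dots> = (\<Sum>j\<le>s. of_nat (s choose j) * (dif g ^^ j) (p + dif g p))"
    unfolding Suc by (simp add: dif_def)
  also have "\<dots> = (\<Sum>j\<le>s. of_nat (s choose j) * ?t j) + (\<Sum>j\<le>s. of_nat (s choose j) * ?t (Suc j))"
    by (simp add: dif_pow_lin[OF g] algebra_simps sum.distrib funpow_swap1)
  also have "(\<Sum>j\<le>s. of_nat (s choose j) * ?t j) = (\<Sum>j\<le>Suc s. of_nat (s choose j) * ?t j)"
    by simp
  also have "\<dots> = ?t 0 + (\<Sum>j\<le>s. of_nat (s choose Suc j) * ?t (Suc j))"
    by (subst sum.atMost_Suc_shift) simp
  also have "?t 0 + (\<Sum>j\<le>s. of_nat (s choose Suc j) * ?t (Suc j)) + (\<Sum>j\<le>s. of_nat (s choose j) * ?t (Suc j))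
     = ?t 0 + (\<Sum>j\<le>s. of_nat (Suc s choose Suc j) * ?t (Suc j))"
    by (simp add: sum.distrib[symmetric] algebra_simps)
  also have "\<dots> = (\<Sum>j\<le>Suc s. of_nat (Suc s choose j) * ?t j)"
    by (subst sum.atMost_Suc_shift) simp
  finally show ?case .
qed

end

section \<open>Orbits of powers of one element as polynomial curves\<close>

lemma binomial_poly:
  "\<exists>b :: 'k::field_char_0 poly. degree b \<le> j \<and> (\<forall>s. poly b (of_nat s) = of_nat (s choose j))"
proof -
  define b :: "'k poly" where "b = smult (inverse (fact j)) (\<Prod>i<j. [:- of_nat i, 1:])"
  have "degree b \<le> j"
  proof -
    have "degree (\<Prod>i<j. [:- of_nat i, 1 :: 'k:]) \<le> (\<Sum>i<j. degree [:- of_nat i, 1 :: 'k:])"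
      by (rule order_trans[OF degree_prod_sum_le]) simp_all
    then show ?thesis by (simp add: b_def)
  qed
  moreover have "poly b (of_nat s) = of_nat (s choose j)" for s
  proof -
    have "poly b (of_nat s) = (of_nat s gchoose j)"
      by (simp add: b_def poly_prod gbinomial_prod_rev field_simps atLeast0LessThan)
    then show ?thesis by (simp add: binomial_gbinomial)
  qed
  ultimately show ?thesis by blast
qed

lemma degree_mpsubst_le:
  fixes \<gamma> :: "'n::finite \<Rightarrow> 'k::field poly"
  assumes "p \<in> box D" "\<And>i. degree (\<gamma> i) \<le> N"
  shows "degree (mpsubst (\<lambda>c. [:c:]) \<gamma> p) \<le> CARD('n) * D * N"
  unfolding mpsubst_def
proof (rule degree_sum_le)
  fix m assume m: "m \<in> keys p"
  have "degree ([:lookup p m:] * (\<Prod>i\<in>UNIV. \<gamma> i ^ lookup m i)) \<le> degree (\<Prod>i\<in>UNIV. \<gamma> i ^ lookup m i)"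
    by (simp add: degree_smult_le)
  also have "\<dots> \<le> (\<Sum>i\<in>UNIV. degree (\<gamma> i ^ lookup m i))"
    by (rule order_trans[OF degree_prod_sum_le]) (simp_all add: o_def)
  also have "\<dots> \<le> (\<Sum>i\<in>(UNIV :: 'n set). D * N)"
  proof (rule sum_mono)
    fix i
    have "lookup m i \<le> D" using assms(1) m by (auto simp: box_keys exponents_def)
    then have "degree (\<gamma> i) * lookup m i \<le> N * D" using assms(2) by (intro mult_le_mono) auto
    then show "degree (\<gamma> i ^ lookup m i) \<le> D * N" using degree_power_le[of "\<gamma> i" "lookup m i"] by (simp add: mult.commute)
  qed
  finally show "degree ([:lookup p m:] * (\<Prod>i\<in>UNIV. \<gamma> i ^ lookup m i)) \<le> CARD('n) * D * N" by simp
qed simp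

context unipotent_action
begin

text \<open>\<open>dif g\<close> is nilpotent on the finitely many coordinates, so a fixed number of
  binomial coefficients survives, each polynomial in \<open>s\<close>. The degree bound is linear in
  \<open>D\<close> with a factor independent of \<open>p\<close> and \<open>a\<close>.\<close>

lemma curve_poly:
  assumes g: "g \<in> carrier G"
  shows "\<exists>N. \<forall>D. \<forall>p\<in>box D. \<forall>a. \<exists>\<gamma> :: 'k poly. degree \<gamma> \<le> N * D \<and>
     (\<forall>s. mpeval p (\<phi> (g [^] (s::nat)) a) = poly \<gamma> (of_nat s))"
proof -
  obtain N where N: "\<And>i. (dif g ^^ N) (mvar i) = 0"
    using dif_nilpotent_finite[OF g, of "range mvar"] by auto
  obtain b :: "nat \<Rightarrow> 'k poly" where b: "\<And>j. degree (b j) \<le> j" "\<And>j s. poly (b j) (of_nat s) = of_nat (s choose j)"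
    using binomial_poly by metis
  have "\<exists>\<gamma> :: 'k poly. degree \<gamma> \<le> CARD('n) * N * D \<and> (\<forall>s. mpeval p (\<phi> (g [^] (s::nat)) a) = poly \<gamma> (of_nat s))"
    if p: "p \<in> box D" for p D a
  proof -
    define \<gamma> where "\<gamma> i = (\<Sum>j<N. smult (mpeval ((dif g ^^ j) (mvar i)) a) (b j))" for i
    have dg: "degree (\<gamma> i) \<le> N" for i unfolding \<gamma>_def
    proof (rule degree_sum_le)
      fix j assume "j \<in> {..<N}"
      then show "degree (smult (mpeval ((dif g ^^ j) (mvar i)) a) (b j)) \<le> N"
        using b(1)[of j] order_trans[OF degree_smult_le] by fastforce
    qed simp
    have c: "\<phi> (g [^] s) a i = poly (\<gamma> i) (of_nat s)" for s :: nat and i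
    proof -
      have "\<phi> (g [^] s) a i = mpeval (pull (g [^] s) (mvar i)) a" using g by simp
      also have "\<dots> = (\<Sum>j\<le>s. of_nat (s choose j) * mpeval ((dif g ^^ j) (mvar i)) a)"
        unfolding pull_pow[OF g] mpeval_sum mpeval_mult by (simp add: ring_mapD(2)[OF ring_map_mpeval] mpeval_of_nat)
      \<comment> \<open>A common range for two truncations: terms with \<open>j > s\<close> vanish
        by the binomial coefficient, those with \<open>j \<ge> N\<close> by nilpotency.\<close>
      also have "\<dots> = (\<Sum>j<N + Suc s. of_nat (s choose j) * mpeval ((dif g ^^ j) (mvar i)) a)"
        by (rule sum.mono_neutral_left) (auto simp: binomial_eq_0)
      also have "\<dots> = (\<Sum>j<N. of_nat (s choose j) * mpeval ((dif g ^^ j) (mvar i)) a)"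
        by (rule sum.mono_neutral_right) (auto simp: dif_pow_mono[OF g N])
      also have "\<dots> = poly (\<gamma> i) (of_nat s)" by (simp add: \<gamma>_def poly_sum b(2) mult.commute)
      finally show ?thesis .
    qed
    have "mpeval p (\<phi> (g [^] s) a) = poly (mpsubst (\<lambda>c. [:c:]) \<gamma> p) (of_nat s)" for s :: nat
      by (rule ring_map_mpoly_eq[OF ring_map_mpeval ring_map_comp[OF ring_map_poly ring_map_mpsubst[OF ring_map_const_poly]]])
         (simp_all add: mpsubst_mconst[OF ring_map_const_poly] mpsubst_mvar[OF ring_map_const_poly] c)
    moreover have "degree (mpsubst (\<lambda>c. [:c:]) \<gamma> p) \<le> CARD('n) * N * D"
      using degree_mpsubst_le[OF p dg] by (simp add: mult_ac)
    ultimately show ?thesis by blast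
  qed
  then show ?thesis by blast
qed

text \<open>Distinct naturals are distinct parameters in characteristic zero. The lemma stands in
  for irreducibility of a line: two nonvanishing conditions, each met somewhere on the curve, are
  met together.\<close>

lemma curve_finite:
  assumes g: "g \<in> carrier G" and "mpeval p (\<phi> (g [^] (t::nat)) a) \<noteq> 0"
  shows "finite {s :: nat. mpeval p (\<phi> (g [^] s) a) = 0}"
proof -
  obtain D where D: "p \<in> box D" using ex_box[of "{p}"] by auto
  obtain \<gamma> :: "'k poly" where \<gamma>: "\<And>s. mpeval p (\<phi> (g [^] (s::nat)) a) = poly \<gamma> (of_nat s)"
    using curve_poly[OF g] D by blast
  have "\<gamma> \<noteq> 0" using assms(2) \<gamma> by auto
  then have "finite {x. poly \<gamma> x = 0}" by (rule poly_roots_finite)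
  then have "finite ((of_nat :: nat \<Rightarrow> 'k) -` {x. poly \<gamma> x = 0})" by (rule finite_vimageI) (simp add: inj_of_nat)
  then show ?thesis by (simp add: \<gamma> vimage_def)
qed

end

section \<open>Fixed vectors\<close>

lemma vector_space_mpoly: "vector_space (\<lambda>c (p :: ('v, 'k::field) mpoly). mconst c * p)"
  by unfold_locales (simp_all add: algebra_simps mconst_add mconst_mult)

context unipotent_action
begin

text \<open>The augmentation ideal of the group algebra, acting on polynomials.\<close>

inductive aug :: "(('n, 'k) mpoly \<Rightarrow> ('n, 'k) mpoly) \<Rightarrow> bool" where
  dif: "g \<in> carrier G \<Longrightarrow> aug (dif g)"
| zero: "aug (\<lambda>_. 0)"
| add: "aug A \<Longrightarrow> aug B \<Longrightarrow> aug (\<lambda>p. A p + B p)"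
| scale: "aug A \<Longrightarrow> aug (\<lambda>p. mconst c * A p)"

lemma aug_lin:
  assumes "aug A"
  shows "A (p + q) = A p + A q \<and> A (mconst c * p) = mconst c * A p"
  using assms by induction (simp_all add: dif_lin distrib_left mult.left_commute add_ac)

lemma aug_sum: "aug A \<Longrightarrow> A (sum f S) = (\<Sum>s\<in>S. A (f s))"
proof (induction S rule: infinite_finite_induct)
  case (infinite S)
  then show ?case using aug_lin[of A 0 0 0] by simp
next
  case empty
  then show ?case using aug_lin[of A 0 0 0] by simp
qed (simp add: aug_lin)

lemma aug_finite_sum: "(\<And>s. s \<in> S \<Longrightarrow> aug (A s)) \<Longrightarrow> aug (\<lambda>p. \<Sum>s\<in>S. A s p)"
  by (induction S rule: infinite_finite_induct) (auto intro: aug.zero aug.add)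

lemma aug_dif_comp: "g \<in> carrier G \<Longrightarrow> aug B \<Longrightarrow> aug (\<lambda>p. dif g (B p))"
proof (rotate_tac, induction rule: aug.induct)
  case (dif h)
  \<comment> \<open>In the group algebra, (g - 1)(h - 1) = (hg - 1) - (g - 1) - (h - 1), with the
    product reversed for the right action.\<close>
  have "(\<lambda>p. dif g (dif h p)) = (\<lambda>p. dif (h \<otimes> g) p + (mconst (- 1) * dif g p + mconst (- 1) * dif h p))"
    using dif by (intro ext) (simp add: dif_def pull_mult_group pull_hom mconst_minus)
  then show ?case using dif by (simp only:) (intro aug.intros m_closed)
next
  case zero
  then show ?case by (simp add: dif_lin aug.zero)
next
  case (add A B)
  then show ?case using aug.add by (simp add: dif_lin)
next
  case (scale A c)
  then show ?case using aug.scale by (simp add: dif_lin)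
qed

lemma aug_comp: "aug A \<Longrightarrow> aug B \<Longrightarrow> aug (\<lambda>p. A (B p))"
  by (induction rule: aug.induct) (auto intro: aug_dif_comp aug.zero aug.add aug.scale)

lemma aug_pow: "aug A \<Longrightarrow> aug (A ^^ Suc k)"
  by (induction k) (auto intro: aug_comp simp: o_def)

lemma aug_closed:
  assumes "aug A" and S: "0 \<in> S" "\<And>p q. p \<in> S \<Longrightarrow> q \<in> S \<Longrightarrow> p + q \<in> S" "\<And>c p. p \<in> S \<Longrightarrow> mconst c * p \<in> S"
    and d: "\<And>g. g \<in> carrier G \<Longrightarrow> dif g p \<in> S"
  shows "A p \<in> S"
  using assms(1) by induction (auto intro: S d)

lemma box_span: "module.span (\<lambda>c p. mconst c * p) ((\<lambda>m. single m 1) ` exponents d) \<supseteq> (box d :: ('n, 'k) mpoly set)"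
proof
  interpret vs: vector_space "\<lambda>c (p :: ('n, 'k) mpoly). mconst c * p" by (rule vector_space_mpoly)
  fix p :: "('n, 'k) mpoly" assume p: "p \<in> box d"
  have "p = (\<Sum>m\<in>keys p. mconst (lookup p m) * single m 1)"
    by (subst mpoly_sum_monomials[symmetric]) (simp add: mconst_def mult_single)
  also have "\<dots> \<in> vs.span ((\<lambda>m. single m 1) ` exponents d)"
    using p by (intro vs.span_sum vs.span_scale vs.span_base) (auto simp: box_keys)
  finally show "p \<in> vs.span ((\<lambda>m. single m 1) ` exponents d)" .
qed

text \<open>
  On the span of the orbit of \<open>v\<close> the operators \<open>dif g\<close> are nilpotent, so the augmentation ideal, being
  closed under composition, consists of operators all of whose powers have trace zero.
\<close>

lemma aug_no_fixed:
  assumes A: "aug A" and v: "A v = v"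
  shows "v = 0"
proof -
  interpret vs: vector_space "\<lambda>c (p :: ('n, 'k) mpoly). mconst c * p" by (rule vector_space_mpoly)
  define Orb where "Orb = (\<lambda>u. pull u v) ` carrier G"
  \<comment> \<open>A basis of the span taken from the orbit itself, so that the translate of a
    basis element is again an orbit element.\<close>
  obtain E where E: "E \<subseteq> Orb" "vs.independent E" "Orb \<subseteq> vs.span E"
    using vs.maximal_independent_subset[of Orb] by blast
  obtain d where d: "\<And>u. u \<in> carrier G \<Longrightarrow> pull u v \<in> box d" using pull_orbit_box by blast
  have "E \<subseteq> vs.span ((\<lambda>m. single m 1) ` exponents d)"
    using E(1) d box_span[of d] by (auto simp: Orb_def)
  then have fin: "finite E"
    using vs.independent_span_bound[OF finite_imageI[OF finite_exponents] E(2)] by blast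
  let ?R = "vs.representation E"
  have Rsum: "(\<Sum>f\<in>E. mconst (?R x f) * f) = x" if "x \<in> vs.span E" for x
    by (rule vs.sum_representation_eq[OF E(2) that fin order_refl])
  have pE: "pull g e \<in> vs.span E" if g: "g \<in> carrier G" and e: "e \<in> E" for g e
  proof -
    obtain u where u: "u \<in> carrier G" "e = pull u v" using E(1) e by (auto simp: Orb_def)
    then have "pull g e = pull (u \<otimes> g) v" using g by (simp add: pull_mult_group)
    then have "pull g e \<in> Orb" using u g by (simp add: Orb_def)
    then show ?thesis using E(3) by blast
  qed
  have dE: "dif g e \<in> vs.span E" if "g \<in> carrier G" "e \<in> E" for g e
    unfolding dif_def by (intro vs.span_diff pE that vs.span_base)
  have augE: "A e \<in> vs.span E" if "aug A" "e \<in> E" for A e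
    using that(1) by (rule aug_closed) (use dE that(2) in \<open>auto intro: vs.span_zero vs.span_add vs.span_scale\<close>)
  \<comment> \<open>Row \<open>e\<close> holds the coordinates of \<open>A e\<close>; a vector fixed
    by an operator therefore becomes a fixed row vector, as \<open>trace_powers_zero\<close>
    expects.\<close>
  define M :: "(('n, 'k) mpoly \<Rightarrow> ('n, 'k) mpoly) \<Rightarrow> ('n, 'k) mpoly \<Rightarrow> ('n, 'k) mpoly \<Rightarrow> 'k" where
    "M A e f = ?R (A e) f" for A e f
  have Rlin: "?R (B x) f = (\<Sum>e\<in>E. ?R x e * M B e f)" if B: "aug B" and x: "x \<in> vs.span E" for B x f
  proof -
    have "B x = B (\<Sum>e\<in>E. mconst (?R x e) * e)" using Rsum[OF x] by simp
    also have "\<dots> = (\<Sum>e\<in>E. mconst (?R x e) * B e)" by (simp add: aug_sum[OF B] aug_lin[OF B])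
    finally have "?R (B x) = ?R (\<Sum>e\<in>E. mconst (?R x e) * B e)" by simp
    also have "\<dots> = (\<lambda>f. \<Sum>e\<in>E. ?R (mconst (?R x e) * B e) f)"
      by (rule vs.representation_sum[OF E(2)]) (intro vs.span_scale augE B)
    finally show ?thesis by (simp add: vs.representation_scale[OF E(2) augE[OF B]] M_def)
  qed
  have Mpow: "M (B ^^ Suc k) e f = mat_pow E (M B) k e f" if B: "aug B" and e: "e \<in> E" for B k e f
    using e
  proof (induction k arbitrary: e f)
    case (Suc k)
    have "M (B ^^ Suc (Suc k)) e f = ?R ((B ^^ Suc k) (B e)) f" by (simp add: M_def funpow_swap1)
    also have "\<dots> = (\<Sum>e'\<in>E. M B e e' * M (B ^^ Suc k) e' f)"
      using Rlin[OF aug_pow[OF B] augE[OF B Suc.prems]] by (simp add: M_def)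
    also have "\<dots> = mat_pow E (M B) (Suc k) e f" unfolding mat_pow.simps mat_mult_def by (intro sum.cong refl) (simp only: Suc.IH)
    finally show ?case .
  qed simp
  \<comment> \<open>The trace is linear in the operator, so only the nilpotent generators
    \<open>dif g\<close> need an argument.\<close>
  have tr: "mat_trace E (M B) = 0" if "aug B" for B
    using that
  proof induction
    case (dif g)
    obtain N where N: "\<And>e. e \<in> E \<Longrightarrow> (dif g ^^ N) e = 0" using dif_nilpotent_finite[OF dif fin] by blast
    have "M (dif g ^^ Suc N) e f = 0" if "e \<in> E" for e f
      using N[OF that] by (simp add: M_def dif_lin[OF dif] vs.representation_zero)
    then have "mat_eq E (mat_pow E (M (dif g)) N) (\<lambda>_ _. 0)"
      using Mpow[OF aug.dif[OF dif]] by (simp add: mat_eq_def)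
    then show ?case by (rule nilpotent_trace[OF fin])
  next
    case zero
    show ?case by (simp add: mat_trace_def M_def vs.representation_zero)
  next
    case (add A B)
    have "M (\<lambda>p. A p + B p) e e = M A e e + M B e e" if "e \<in> E" for e
      unfolding M_def using vs.representation_add[OF E(2) augE[OF add(2) that] augE[OF add(1) that]] by simp
    then show ?case using add by (simp add: mat_trace_def sum.distrib)
  next
    case (scale A c)
    have "M (\<lambda>p. mconst c * A p) e e = c * M A e e" if "e \<in> E" for e
      unfolding M_def using vs.representation_scale[OF E(2) augE[OF scale(1) that]] by simp
    then show ?case using scale by (simp add: mat_trace_def flip: sum_distrib_left)
  qed
  have vE: "v \<in> vs.span E" using E(3) by (auto simp: Orb_def image_subset_iff dest: bspec[of _ _ \<one>])
  have "?R v e = 0" if "e \<in> E" for e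
  proof (rule trace_powers_zero[OF fin])
    show "mat_trace E (mat_pow E (M A) k) = 0" for k
    proof -
      have "mat_eq E (M (A ^^ Suc k)) (mat_pow E (M A) k)" using Mpow[OF A] unfolding mat_eq_def by blast
      from mat_eq_trace[OF this] show ?thesis using tr[OF aug_pow[OF A]] by simp
    qed
    show "(\<Sum>e\<in>E. ?R v e * M A e f) = ?R v f" for f using Rlin[OF A vE, of f] v by simp
  qed (rule that)
  then show "v = 0" using Rsum[OF vE] by simp
qed

text \<open>Otherwise applying suitable \<open>dif g\<close> over and over to \<open>p\<close> gives
  vectors \<open>x i\<close> that never enter \<open>W\<close>. They lie in one finite-dimensional
  box, so some \<open>x i\<close> is a combination of later ones, each of which is an augmentation
  operator applied to \<open>x i\<close>. Thus one such operator fixes \<open>x i\<close>, which is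
  0 by \<open>aug_no_fixed\<close> and so lies in \<open>W\<close>.\<close>

lemma fixed_vector:
  assumes W: "0 \<in> W" and p: "p \<in> W'" "p \<notin> W"
    and W': "\<And>g q. g \<in> carrier G \<Longrightarrow> q \<in> W' \<Longrightarrow> dif g q \<in> W'"
  shows "\<exists>v\<in>W' - W. \<forall>g\<in>carrier G. dif g v \<in> W"
proof (rule ccontr)
  assume "\<not> ?thesis"
  then have "\<forall>v. \<exists>g. v \<in> W' - W \<longrightarrow> g \<in> carrier G \<and> dif g v \<notin> W" by blast
  then obtain \<gamma> where \<gamma>: "\<And>v. v \<in> W' - W \<Longrightarrow> \<gamma> v \<in> carrier G \<and> dif (\<gamma> v) v \<notin> W" by metis
  define x where "x i = ((\<lambda>v. dif (\<gamma> v) v) ^^ i) p" for i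
  have x0: "x 0 = p" and xS: "x (Suc i) = dif (\<gamma> (x i)) (x i)" for i by (simp_all add: x_def)
  have xW: "x i \<in> W' - W" for i
    by (induction i) (use p W' \<gamma> in \<open>auto simp: x0 xS\<close>)
  have later: "\<exists>A. aug A \<and> x (Suc (i + k)) = A (x i)" for i k
  proof (induction k)
    case 0
    have "aug (dif (\<gamma> (x i)))" using \<gamma>[OF xW] by (intro aug.dif) blast
    then show ?case by (intro exI[of _ "dif (\<gamma> (x i))"]) (simp add: xS)
  next
    case (Suc k)
    then obtain A where A: "aug A" "x (Suc (i + k)) = A (x i)" by blast
    have "aug (\<lambda>p. dif (\<gamma> (x (Suc (i + k)))) (A p))" using \<gamma>[OF xW] A by (intro aug_dif_comp) blast+
    moreover have "x (Suc (i + Suc k)) = dif (\<gamma> (x (Suc (i + k)))) (A (x i))"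
      by (simp only: add_Suc_right xS[of "Suc (i + k)"] A(2))
    ultimately show ?case by blast
  qed
  obtain d where d: "\<And>u. u \<in> carrier G \<Longrightarrow> pull u p \<in> box d" using pull_orbit_box by blast
  have bp: "p \<in> box d" using d[OF one_closed] by simp
  have badd: "q + r \<in> box d" if "q \<in> box d" "r \<in> box d" for q r :: "('n, 'k) mpoly"
    using box_sum[of UNIV "\<lambda>b. if b then q else r" d] that by (simp add: UNIV_bool add.commute)
  have bscale: "mconst c * q \<in> box d" if "q \<in> box d" for c and q :: "('n, 'k) mpoly"
    using box_mult[OF box_mconst[of c 0] that] by simp
  have bdif: "dif g p \<in> box d" if "g \<in> carrier G" for g
    using badd[OF d[OF that] bscale[OF bp, of "- 1"]] by (simp add: dif_def mconst_minus)
  have xb: "x i \<in> box d" for i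
  proof (cases i)
    case (Suc k)
    then obtain A where "aug A" "x i = A p" using later[of 0 k] x0 by auto
    then show ?thesis using aug_closed[OF \<open>aug A\<close>, of "box d" p] badd bscale bdif box_mconst[of 0 d] by simp
  qed (simp add: x0 bp)
  define N where "N = card (exponents d :: ('n \<Rightarrow>\<^sub>0 nat) set)"
  have "card (exponents d :: ('n \<Rightarrow>\<^sub>0 nat) set) < card {..N}" by (simp add: N_def)
  from homogeneous_system[OF finite_exponents finite_atMost this, of "\<lambda>m i. lookup (x i) m"]
  obtain u where u: "\<exists>i\<in>{..N}. u i \<noteq> 0" and
    u0: "\<forall>m\<in>exponents d. (\<Sum>i\<le>N. u i * lookup (x i) m) = 0" by blast
  have s0: "(\<Sum>i\<le>N. mconst (u i) * x i) = 0"
  proof (rule poly_mapping_eqI)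
    fix m
    have "(\<Sum>i\<le>N. u i * lookup (x i) m) = 0"
    proof (cases "m \<in> exponents d")
      case False
      then have "lookup (x i) m = 0" for i using xb[of i] by (auto simp: box_keys in_keys_iff)
      then show ?thesis by simp
    qed (use u0 in blast)
    then show "lookup (\<Sum>i\<le>N. mconst (u i) * x i) m = lookup 0 m" by (simp add: lookup_sum lookup_mconst_mult)
  qed
  define i where "i = (LEAST i. u i \<noteq> 0)"
  have ui: "u i \<noteq> 0" unfolding i_def by (rule LeastI_ex) (use u in blast)
  have lt: "u j = 0" if "j < i" for j using not_less_Least[of j "\<lambda>i. u i \<noteq> 0"] that by (simp add: i_def)
  have iN: "i \<le> N"
  proof -
    obtain k where "k \<le> N" "u k \<noteq> 0" using u by auto
    then show ?thesis using Least_le[of "\<lambda>k. u k \<noteq> 0" k] by (simp add: i_def)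
  qed
  obtain A where A: "\<And>k. aug (A k)" "\<And>k. x (Suc (i + k)) = A k (x i)" using later[of i] by metis
  have "(\<Sum>j\<le>N. mconst (u j) * x j) = (\<Sum>j\<in>{i..N}. mconst (u j) * x j)"
    by (rule sum.mono_neutral_right) (auto simp: lt)
  also have "\<dots> = mconst (u i) * x i + (\<Sum>j\<in>{Suc i..N}. mconst (u j) * x j)"
    using iN by (simp add: sum.atLeast_Suc_atMost)
  finally have e: "mconst (u i) * x i = - (\<Sum>j\<in>{Suc i..N}. mconst (u j) * x j)"
    using s0 by (simp add: eq_neg_iff_add_eq_0)
  have "x i = mconst (inverse (u i)) * (mconst (u i) * x i)"
    using ui by (simp flip: mult.assoc mconst_mult)
  also have "\<dots> = (\<Sum>j\<in>{Suc i..N}. mconst (- inverse (u i) * u j) * A (j - Suc i) (x i))"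
    unfolding e by (simp add: sum_negf[symmetric] sum_distrib_left mconst_mult mconst_minus mult.assoc A(2)[symmetric])
  finally have xi: "(\<Sum>j\<in>{Suc i..N}. mconst (- inverse (u i) * u j) * A (j - Suc i) (x i)) = x i" by simp
  have "aug (\<lambda>p. \<Sum>j\<in>{Suc i..N}. mconst (- inverse (u i) * u j) * A (j - Suc i) p)"
    by (intro aug_finite_sum aug.scale A)
  from aug_no_fixed[OF this xi] have "x i = 0" .
  then show False using xW[of i] W by simp
qed

end

section \<open>Vanishing ideals and dimension of orbits\<close>

definition van :: "('v::finite \<Rightarrow> 'k::comm_ring_1) set \<Rightarrow> ('v, 'k) mpoly set" where
  "van S = {p. \<forall>x\<in>S. mpeval p x = 0}"

lemma vanD: "p \<in> van S \<Longrightarrow> x \<in> S \<Longrightarrow> mpeval p x = 0" by (simp add: van_def)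

lemma van_antimono: "S \<subseteq> T \<Longrightarrow> van T \<subseteq> van S" by (auto simp: van_def)

text \<open>The second assumption is irreducibility: two nonempty basic open subsets of
  \<open>S\<close> meet.\<close>

lemma primeideal_van:
  assumes "S \<noteq> {}" "\<And>p q x y. x \<in> S \<Longrightarrow> y \<in> S \<Longrightarrow> mpeval p x \<noteq> 0 \<Longrightarrow> mpeval q y \<noteq> 0 \<Longrightarrow>
    \<exists>z\<in>S. mpeval p z \<noteq> 0 \<and> mpeval q z \<noteq> 0"
  shows "primeideal_of (van (S :: ('v::finite \<Rightarrow> 'k::idom) set))"
  unfolding primeideal_of_def
proof (intro conjI allI impI)
  show "ideal_of (van S)" by (simp add: ideal_of_def van_def)
  show "1 \<notin> van S" using assms(1) by (auto simp: van_def)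
  fix p q assume pq: "p * q \<in> van S"
  show "p \<in> van S \<or> q \<in> van S"
  proof (rule ccontr)
    assume "\<not> (p \<in> van S \<or> q \<in> van S)"
    then obtain x y where "x \<in> S" "y \<in> S" "mpeval p x \<noteq> 0" "mpeval q y \<noteq> 0" by (auto simp: van_def)
    then obtain z where "z \<in> S" "mpeval p z \<noteq> 0" "mpeval q z \<noteq> 0" using assms(2) by blast
    then show False using vanD[OF pq, of z] by simp
  qed
qed

lemma closedin_sub_zariski:
  "closedin (subtopology zariski S) T \<longleftrightarrow> (\<exists>P. T = {x\<in>S. \<forall>p\<in>P. mpeval p x = 0})"
  unfolding closedin_subtopology closedin_zariski by blast

text \<open>The sets produced by sweeping need not be closed; their closures in the orbit are the
  members of the chain that bounds its dimension from below.\<close>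

lemma irreducible_closure:
  fixes S :: "('v::finite \<Rightarrow> 'k::idom) set"
  assumes Z: "Z \<subseteq> S" "Z \<noteq> {}" and pr: "primeideal_of (van Z)"
  shows "irreducible_closedin (subtopology zariski S) {x\<in>S. \<forall>p\<in>van Z. mpeval p x = 0}"
    (is "irreducible_closedin _ ?C")
  unfolding irreducible_closedin_def
proof (intro conjI allI impI)
  show "closedin (subtopology zariski S) ?C" unfolding closedin_sub_zariski by blast
  have ZC: "Z \<subseteq> ?C" using Z by (auto simp: vanD)
  then show "?C \<noteq> {}" using Z by blast
  fix A B assume "closedin (subtopology zariski S) A" "closedin (subtopology zariski S) B" and C: "?C = A \<union> B"
  then obtain P Q where A: "A = {x\<in>S. \<forall>p\<in>P. mpeval p x = 0}" and B: "B = {x\<in>S. \<forall>p\<in>Q. mpeval p x = 0}"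
    unfolding closedin_sub_zariski by blast
  show "?C = A \<or> ?C = B"
  proof (rule ccontr)
    assume "\<not> (?C = A \<or> ?C = B)"
    then obtain x y where x: "x \<in> ?C" "x \<notin> A" and y: "y \<in> ?C" "y \<notin> B" using C by blast
    then obtain p where p: "p \<in> P" "mpeval p x \<noteq> 0" using A by blast
    obtain q where q: "q \<in> Q" "mpeval q y \<noteq> 0" using B y by blast
    have "mpeval (p * q) z = 0" if "z \<in> Z" for z
    proof -
      have "z \<in> A \<or> z \<in> B" using that ZC C by blast
      then show ?thesis using p q A B by auto
    qed
    then have "p * q \<in> van Z" by (simp add: van_def)
    then have "p \<in> van Z \<or> q \<in> van Z" by (rule primeideal_ofD(3)[OF pr])
    then show False using p q x y by blast
  qed
qed

lemma irreducible_closedinD: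
  fixes S :: "('v::finite \<Rightarrow> 'k::idom) set"
  assumes irr: "irreducible_closedin (subtopology zariski S) Z"
  shows "primeideal_of (van Z)" "Z \<subseteq> S" "Z = {x\<in>S. \<forall>p\<in>van Z. mpeval p x = 0}"
proof -
  have irr': "closedin (subtopology zariski S) Z" "Z \<noteq> {}"
    "\<And>A B. closedin (subtopology zariski S) A \<Longrightarrow> closedin (subtopology zariski S) B \<Longrightarrow> Z = A \<union> B \<Longrightarrow> Z = A \<or> Z = B"
    using irr by (simp_all add: irreducible_closedin_def)
  obtain P where P: "Z = {x\<in>S. \<forall>p\<in>P. mpeval p x = 0}"
    using irr'(1) unfolding closedin_sub_zariski by (rule exE)
  then show "Z \<subseteq> S" by blast
  have "P \<subseteq> van Z" using P by (auto simp: van_def)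
  then show "Z = {x\<in>S. \<forall>p\<in>van Z. mpeval p x = 0}" using P vanD by blast
  have cl: "closedin (subtopology zariski S) {x\<in>Z. mpeval p x = 0}" for p
    unfolding closedin_sub_zariski by (rule exI[of _ "insert p P"]) (use P in blast)
  show "primeideal_of (van Z)"
    unfolding primeideal_of_def
  proof (intro conjI allI impI)
    show "ideal_of (van Z)" by (simp add: ideal_of_def van_def)
    show "1 \<notin> van Z" using irr'(2) by (auto simp: van_def)
    fix p q assume pq: "p * q \<in> van Z"
    have "mpeval p x = 0 \<or> mpeval q x = 0" if "x \<in> Z" for x using vanD[OF pq that] by simp
    then have "Z = {x\<in>Z. mpeval p x = 0} \<union> {x\<in>Z. mpeval q x = 0}" by blast
    then have "Z = {x\<in>Z. mpeval p x = 0} \<or> Z = {x\<in>Z. mpeval q x = 0}"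
      by (rule irr'(3)[OF cl cl])
    then show "p \<in> van Z \<or> q \<in> van Z" unfolding van_def by blast
  qed
qed

text \<open>Vanishing ideals reverse inclusions, so the chain of primes starts at the largest set
  \<open>Z d\<close>; a relatively closed set is recovered from its ideal, which keeps inclusions
  strict.\<close>

lemma prime_chain_of_irreducibles:
  fixes S :: "('v::finite \<Rightarrow> 'k::idom) set"
  assumes "\<And>i. i \<le> d \<Longrightarrow> irreducible_closedin (subtopology zariski S) (Z i)" "\<And>i. i < d \<Longrightarrow> Z i \<subset> Z (Suc i)"
  shows "\<exists>fs. prime_chain (van (Z d)) fs \<and> length fs = d"
  using assms
proof (induction d)
  case 0
  then show ?case using irreducible_closedinD(1)[of S "Z 0"] by (intro exI[of _ "[]"]) simp
next
  case (Suc d)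
  then obtain fs where fs: "prime_chain (van (Z d)) fs" "length fs = d" by auto
  have i: "irreducible_closedin (subtopology zariski S) (Z d)"
    "irreducible_closedin (subtopology zariski S) (Z (Suc d))" using Suc.prems(1) by auto
  have lt: "Z d \<subset> Z (Suc d)" using Suc.prems(2) by simp
  then have sub: "van (Z (Suc d)) \<subseteq> van (Z d)" by (intro van_antimono) blast
  have "van (Z d) \<noteq> van (Z (Suc d))"
    using irreducible_closedinD(3)[OF i(1)] irreducible_closedinD(3)[OF i(2)] lt by auto
  then obtain f where "f \<in> van (Z d)" "f \<notin> van (Z (Suc d))" using sub by blast
  then show ?case using fs sub irreducible_closedinD(1)[OF i(2)]
    by (intro exI[of _ "f # fs"]) auto
qed

text \<open>An infinite set of extended naturals has infinite supremum, so \<open>A\<close> is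
  finite and contains its maximum; \<open>d \<noteq> 0\<close> excludes the empty set, whose
  supremum is 0.\<close>

lemma Sup_enat_attained:
  assumes "Sup A = enat d" "d \<noteq> 0"
  shows "enat d \<in> A"
proof -
  have "A \<noteq> {}" using assms by (auto simp: Sup_enat_def enat_0_iff)
  moreover have "finite A" using assms(1) by (auto simp: Sup_enat_def split: if_splits)
  ultimately show ?thesis using assms Max_in[of A] by (simp add: Sup_enat_def)
qed

text \<open>A counting substitute for the closure of \<open>S\<close> having dimension at most \<open>r\<close>.\<close>

definition dim_bound :: "('v::finite \<Rightarrow> 'k::comm_ring_1) set \<Rightarrow> nat \<Rightarrow> bool" where
  "dim_bound S r \<longleftrightarrow> (\<exists>C. \<forall>D. \<exists>X\<subseteq>S. finite X \<and> card X \<le> (C * (D + 1)) ^ r \<and>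
     (\<forall>p\<in>box D. (\<forall>x\<in>X. mpeval p x = 0) \<longrightarrow> p \<in> van S))"

text \<open>For \<open>D = C ^ r\<close> the (D + 1)^n monomials of the box outnumber the test
  points, so a nonzero polynomial of the box vanishes on them and hence on \<open>S\<close>.\<close>

lemma dim_bound_nonzero:
  fixes S :: "('v::finite \<Rightarrow> 'k::field) set"
  assumes "dim_bound S r" "r < CARD('v)"
  shows "\<exists>p\<in>van S. p \<noteq> 0"
proof -
  obtain C where C: "\<forall>D. \<exists>X\<subseteq>S. finite X \<and> card X \<le> (C * (D + 1)) ^ r \<and>
     (\<forall>p\<in>box D. (\<forall>x\<in>X. mpeval p x = 0) \<longrightarrow> p \<in> van S)" using assms(1) unfolding dim_bound_def by blast
  define D where "D = C ^ r"
  obtain X where X': "X \<subseteq> S \<and> finite X \<and> card X \<le> (C * (D + 1)) ^ r \<and>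
     (\<forall>p\<in>box (D). (\<forall>x\<in>X. mpeval p x = 0) \<longrightarrow> p \<in> van S)"
      using spec[OF C, of "D"] by (rule exE)
    then have X: "X \<subseteq> S" "finite X" "card X \<le> (C * (D + 1)) ^ r"
      and van: "\<And>p. p \<in> box (D) \<Longrightarrow> (\<forall>x\<in>X. mpeval p x = 0) \<Longrightarrow> p \<in> van S" by simp_all
  have "(C * (D + 1)) ^ r = D * (D + 1) ^ r" by (simp only: D_def power_mult_distrib)
  also have "\<dots> < (D + 1) ^ Suc r" by simp
  also have "\<dots> \<le> (D + 1) ^ CARD('v)" using assms(2) by (intro power_increasing) auto
  finally have lt: "card X < card (exponents D :: ('v \<Rightarrow>\<^sub>0 nat) set)" using X(3) by (simp add: card_exponents)
  obtain u where u: "\<exists>m\<in>exponents D. u m \<noteq> 0"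
    and u0: "\<forall>x\<in>X. (\<Sum>m\<in>exponents D. u m * (\<Prod>i\<in>UNIV. x i ^ lookup m i)) = 0"
    using homogeneous_system[OF X(2) finite_exponents lt, of "\<lambda>x m. \<Prod>i\<in>UNIV. x i ^ lookup m i"] by blast
  define p where "p = (\<Sum>m\<in>exponents D. single m (u m))"
  have lk: "lookup p m = (if m \<in> exponents D then u m else 0)" for m
    by (simp add: p_def lookup_sum lookup_single when_def)
  have "p \<in> box D" by (auto simp: box_keys in_keys_iff lk split: if_splits)
  moreover have "\<forall>x\<in>X. mpeval p x = 0" using u0 by (simp add: p_def mpeval_sum mpeval_single)
  ultimately have "p \<in> van S" by (rule van)
  moreover obtain m where "m \<in> exponents D" "u m \<noteq> 0" using u by blast
  then have "lookup p m \<noteq> 0" using lk[of m] by simp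
  then have "p \<noteq> 0" by auto
  ultimately show ?thesis by blast
qed

lemma poly_many_roots:
  fixes \<gamma> :: "'k::field_char_0 poly"
  assumes "degree \<gamma> \<le> N" "\<And>s. s \<le> N \<Longrightarrow> poly \<gamma> (of_nat s) = 0"
  shows "\<gamma> = 0"
proof (rule ccontr)
  assume g: "\<gamma> \<noteq> 0"
  have "of_nat ` {..N} \<subseteq> {x. poly \<gamma> x = 0}" using assms(2) by auto
  then have "card (of_nat ` {..N} :: 'k set) \<le> card {x. poly \<gamma> x = 0}" by (rule card_mono[OF poly_roots_finite[OF g]])
  also have "card (of_nat ` {..N} :: 'k set) = Suc N" by (simp add: card_image inj_on_def)
  also have "card {x. poly \<gamma> x = 0} \<le> degree \<gamma>" by (rule card_poly_roots_bound[OF g])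
  finally show False using assms(1) by simp
qed

section \<open>Orbits: irreducibility, and the dimension of a dense orbit\<close>

context unipotent_action
begin

lemma orbit_memI: "g \<in> carrier G \<Longrightarrow> \<phi> g a \<in> orbit G \<phi> a" by (auto simp: orbit_def)

lemma orbit_self: "a \<in> orbit G \<phi> a" using orbit_memI[OF one_closed, of a] by simp

lemma orbit_closed: "x \<in> orbit G \<phi> a \<Longrightarrow> g \<in> carrier G \<Longrightarrow> \<phi> g x \<in> orbit G \<phi> a"
  by (auto simp: orbit_def act_mult[symmetric])

lemma orbit_transitive:
  assumes "x \<in> orbit G \<phi> a" "y \<in> orbit G \<phi> a"
  obtains g where "g \<in> carrier G" "y = \<phi> g x"
proof -
  obtain u w where uw: "u \<in> carrier G" "w \<in> carrier G" "x = \<phi> u a" "y = \<phi> w a"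
    using assms by (auto simp: orbit_def)
  have "\<phi> (w \<otimes> inv u) x = \<phi> (w \<otimes> inv u \<otimes> u) a" using uw by (simp add: act_mult)
  also have "w \<otimes> inv u \<otimes> u = w" using uw by (simp add: m_assoc)
  finally show thesis using uw that[of "w \<otimes> inv u"] by simp
qed

lemma curve_both_nonzero:
  assumes "g \<in> carrier G" "mpeval p (\<phi> (g [^] (s::nat)) a) \<noteq> 0" "mpeval q (\<phi> (g [^] (t::nat)) b) \<noteq> 0"
  shows "\<exists>s::nat. mpeval p (\<phi> (g [^] s) a) \<noteq> 0 \<and> mpeval q (\<phi> (g [^] s) b) \<noteq> 0"
proof -
  have "finite ({s. mpeval p (\<phi> (g [^] (s::nat)) a) = 0} \<union> {s. mpeval q (\<phi> (g [^] (s::nat)) b) = 0})"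
    using curve_finite[OF assms(1,2)] curve_finite[OF assms(1,3)] by simp
  from ex_new_if_finite[OF infinite_UNIV_nat this] show ?thesis by blast
qed

text \<open>Two points of the orbit are the values at s = 0 and s = 1 of a curve
  \<open>\<phi> (g [^] s) x\<close> inside it, on which two nonvanishing conditions can be met at
  once.\<close>

lemma primeideal_van_orbit: "primeideal_of (van (orbit G \<phi> a))"
proof (rule primeideal_van)
  show "orbit G \<phi> a \<noteq> {}" using orbit_self by blast
  fix p q x y assume xy: "x \<in> orbit G \<phi> a" "y \<in> orbit G \<phi> a" and nz: "mpeval p x \<noteq> 0" "mpeval q y \<noteq> 0"
  obtain g where g: "g \<in> carrier G" "y = \<phi> g x" using orbit_transitive[OF xy] by blast
  obtain s :: nat where "mpeval p (\<phi> (g [^] s) x) \<noteq> 0" "mpeval q (\<phi> (g [^] s) x) \<noteq> 0"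
    using curve_both_nonzero[OF g(1), of p 0 x q 1 x] nz g by auto
  then show "\<exists>z\<in>orbit G \<phi> a. mpeval p z \<noteq> 0 \<and> mpeval q z \<noteq> 0"
    using orbit_closed[OF xy(1)] g by blast
qed

lemma pull_van_orbit: "p \<in> van (orbit G \<phi> a) \<Longrightarrow> g \<in> carrier G \<Longrightarrow> pull g p \<in> van (orbit G \<phi> a)"
  using orbit_closed by (simp add: van_def)

text \<open>Natural powers stand for the one-parameter subgroup through \<open>g\<close>: a
  polynomial in s that vanishes at all naturals is zero.\<close>

definition sweep :: "('m \<Rightarrow> 'k) \<Rightarrow> ('n \<Rightarrow> 'k) set \<Rightarrow> ('n \<Rightarrow> 'k) set" where
  "sweep g S = (\<Union>s::nat. \<phi> (g [^] s) ` S)"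

lemma sweep_superset: "S \<subseteq> sweep g S"
proof
  fix x assume "x \<in> S"
  then have "\<phi> (g [^] (0::nat)) x \<in> sweep g S" unfolding sweep_def by blast
  then show "x \<in> sweep g S" by simp
qed

lemma sweep_image: "g \<in> carrier G \<Longrightarrow> x \<in> S \<Longrightarrow> \<phi> g x \<in> sweep g S"
proof -
  assume g: "g \<in> carrier G" and "x \<in> S"
  then have "\<phi> (g [^] (1::nat)) x \<in> sweep g S" unfolding sweep_def by blast
  then show "\<phi> g x \<in> sweep g S" using g by simp
qed

text \<open>Witnesses on the curves through \<open>e\<close> and \<open>f\<close> can be moved to a
  common time \<open>r\<close>; pulling back along \<open>g [^] r\<close> then leaves a question
  about \<open>S\<close>, whose ideal is prime.\<close>

lemma primeideal_van_sweep:
  assumes g: "g \<in> carrier G" and S: "S \<noteq> {}" "primeideal_of (van S)"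
  shows "primeideal_of (van (sweep g S))"
proof (rule primeideal_van)
  show "sweep g S \<noteq> {}" using S(1) sweep_superset by blast
  fix p q x y assume xy: "x \<in> sweep g S" "y \<in> sweep g S" and nz: "mpeval p x \<noteq> 0" "mpeval q y \<noteq> 0"
  obtain s t :: nat and e f where e: "e \<in> S" "x = \<phi> (g [^] s) e" and f: "f \<in> S" "y = \<phi> (g [^] t) f"
    using xy by (auto simp: sweep_def)
  obtain r :: nat where r: "mpeval p (\<phi> (g [^] r) e) \<noteq> 0" "mpeval q (\<phi> (g [^] r) f) \<noteq> 0"
    using curve_both_nonzero[OF g, of p s e q t f] nz e f by blast
  have gr: "g [^] r \<in> carrier G" using g by simp
  have "pull (g [^] r) p \<notin> van S" "pull (g [^] r) q \<notin> van S"
    using vanD[of "pull (g [^] r) p" S e] vanD[of "pull (g [^] r) q" S f] r e f gr by auto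
  then have "pull (g [^] r) p * pull (g [^] r) q \<notin> van S" using primeideal_ofD(3)[OF S(2)] by blast
  then obtain z where "z \<in> S" "mpeval p (\<phi> (g [^] r) z) \<noteq> 0" "mpeval q (\<phi> (g [^] r) z) \<noteq> 0"
    using gr by (auto simp: van_def)
  then show "\<exists>z\<in>sweep g S. mpeval p z \<noteq> 0 \<and> mpeval q z \<noteq> 0" unfolding sweep_def by blast
qed

text \<open>Along a curve \<open>p\<close> has degree at most \<open>N * D\<close> in the parameter,
  so the times up to \<open>N * D\<close> decide whether it vanishes. At each time the pullback lies
  in \<open>box (\<delta> * D)\<close> and is tested by the points for \<open>S\<close>. One new
  factor linear in \<open>D\<close> costs one dimension.\<close>

lemma dim_bound_sweep:
  assumes g: "g \<in> carrier G" and S: "dim_bound S r"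
  shows "dim_bound (sweep g S) (Suc r)"
proof -
  obtain C where C: "\<forall>D. \<exists>X\<subseteq>S. finite X \<and> card X \<le> (C * (D + 1)) ^ r \<and>
     (\<forall>p\<in>box D. (\<forall>x\<in>X. mpeval p x = 0) \<longrightarrow> p \<in> van S)" using S unfolding dim_bound_def by blast
  obtain \<delta> where \<delta>: "\<And>D p u. p \<in> box D \<Longrightarrow> u \<in> carrier G \<Longrightarrow> pull u p \<in> box (\<delta> * D)" using pull_box by blast
  obtain N where N: "\<And>D p a. p \<in> box D \<Longrightarrow> \<exists>\<gamma> :: 'k poly. degree \<gamma> \<le> N * D \<and>
     (\<forall>s. mpeval p (\<phi> (g [^] (s::nat)) a) = poly \<gamma> (of_nat s))" using curve_poly[OF g] by blast
  \<comment> \<open>Chosen to dominate both the number of times and the side of the old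
    count.\<close>
  define C' where "C' = (N + 1) * (C * (\<delta> + 1) + 1)"
  have "\<exists>X\<subseteq>sweep g S. finite X \<and> card X \<le> (C' * (D + 1)) ^ Suc r \<and>
     (\<forall>p\<in>box D. (\<forall>x\<in>X. mpeval p x = 0) \<longrightarrow> p \<in> van (sweep g S))" for D
  proof -
    obtain X where X': "X \<subseteq> S \<and> finite X \<and> card X \<le> (C * (\<delta> * D + 1)) ^ r \<and>
     (\<forall>p\<in>box (\<delta> * D). (\<forall>x\<in>X. mpeval p x = 0) \<longrightarrow> p \<in> van S)"
      using spec[OF C, of "\<delta> * D"] by (rule exE)
    then have X: "X \<subseteq> S" "finite X" "card X \<le> (C * (\<delta> * D + 1)) ^ r"
      and van: "\<And>p. p \<in> box (\<delta> * D) \<Longrightarrow> (\<forall>x\<in>X. mpeval p x = 0) \<Longrightarrow> p \<in> van S" by simp_all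
    define Y where "Y = (\<lambda>(s::nat, x). \<phi> (g [^] s) x) ` ({..N * D} \<times> X)"
    have "card Y \<le> card ({..N * D} \<times> X)" unfolding Y_def by (rule card_image_le) (simp add: X)
    also have "\<dots> = (N * D + 1) * card X" by (simp add: card_cartesian_product)
    also have "\<dots> \<le> (C' * (D + 1)) * (C' * (D + 1)) ^ r"
    proof (rule mult_le_mono)
      have "N * D + 1 \<le> (N + 1) * (D + 1)" by simp
      also have "\<dots> \<le> (N + 1) * (C * (\<delta> + 1) + 1) * (D + 1)" by (intro mult_le_mono) auto
      finally show "N * D + 1 \<le> C' * (D + 1)" by (simp only: C'_def)
      have "C * (\<delta> * D + 1) \<le> C * ((\<delta> + 1) * (D + 1))" by (intro mult_le_mono) auto
      also have "\<dots> \<le> (C * (\<delta> + 1) + 1) * (D + 1)" by (simp add: algebra_simps)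
      also have "\<dots> \<le> (N + 1) * (C * (\<delta> + 1) + 1) * (D + 1)" by (intro mult_le_mono) auto
      finally have "C * (\<delta> * D + 1) \<le> C' * (D + 1)" by (simp only: C'_def)
      then show "card X \<le> (C' * (D + 1)) ^ r" using X(3) power_mono order_trans by blast
    qed
    finally have "card Y \<le> (C' * (D + 1)) ^ Suc r" by simp
    moreover have "Y \<subseteq> sweep g S" using X(1) unfolding Y_def sweep_def by auto
    moreover have "finite Y" using X(2) by (simp add: Y_def)
    moreover have "p \<in> van (sweep g S)" if p: "p \<in> box D" and Yp: "\<forall>y\<in>Y. mpeval p y = 0" for p
    proof -
      have "mpeval p (\<phi> (g [^] s) e) = 0" if e: "e \<in> S" for s :: nat and e
      proof -
        obtain \<gamma> :: "'k poly" where \<gamma>: "degree \<gamma> \<le> N * D"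
          "\<And>s. mpeval p (\<phi> (g [^] (s::nat)) e) = poly \<gamma> (of_nat s)" using N[OF p] by blast
        have "poly \<gamma> (of_nat t) = 0" if t: "t \<le> N * D" for t
        proof -
          have gt: "g [^] t \<in> carrier G" using g by simp
          have "\<forall>x\<in>X. mpeval (pull (g [^] t) p) x = 0"
          proof
            fix x assume "x \<in> X"
            then have "\<phi> (g [^] t) x \<in> Y" using t unfolding Y_def by force
            then show "mpeval (pull (g [^] t) p) x = 0" using Yp gt by simp
          qed
          then have "pull (g [^] t) p \<in> van S" by (rule van[OF \<delta>[OF p gt]])
          then show ?thesis using vanD[OF _ e] gt \<gamma>(2)[of t] by fastforce
        qed
        then have "\<gamma> = 0" by (rule poly_many_roots[OF \<gamma>(1)])
        then show ?thesis using \<gamma>(2) by simp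
      qed
      then show ?thesis by (auto simp: van_def sweep_def)
    qed
    ultimately show ?thesis by blast
  qed
  then show ?thesis unfolding dim_bound_def by blast
qed

text \<open>If the orbit of \<open>a\<close> is dense, sweeping out \<open>a\<close> by suitable one-parameter subgroups raises the dimension \<open>n\<close> times.\<close>

lemma dense_orbit_chain:
  assumes dense: "van (orbit G \<phi> a) = {0}" and "r \<le> CARD('n)"
  shows "\<exists>Z. (\<forall>i\<le>r. Z i \<subseteq> orbit G \<phi> a \<and> Z i \<noteq> {} \<and> primeideal_of (van (Z i))) \<and>
    (\<forall>i<r. Z i \<subseteq> Z (Suc i) \<and> van (Z (Suc i)) \<noteq> van (Z i)) \<and> dim_bound (Z r) r"
  using assms(2)
proof (induction r)
  case 0
  have "primeideal_of (van {a})" by (rule primeideal_van) auto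
  moreover have "dim_bound {a} 0" unfolding dim_bound_def
    by (intro exI[of _ 0] allI exI[of _ "{a}"]) (simp add: van_def)
  ultimately show ?case using orbit_self by (intro exI[of _ "\<lambda>_. {a}"]) simp
next
  case (Suc r)
  then obtain Z where Z: "\<And>i. i \<le> r \<Longrightarrow> Z i \<subseteq> orbit G \<phi> a \<and> Z i \<noteq> {} \<and> primeideal_of (van (Z i))"
    "\<And>i. i < r \<Longrightarrow> Z i \<subseteq> Z (Suc i) \<and> van (Z (Suc i)) \<noteq> van (Z i)" "dim_bound (Z r) r" by auto
  have Zr: "Z r \<subseteq> orbit G \<phi> a" "Z r \<noteq> {}" "primeideal_of (van (Z r))" using Z(1)[of r] by auto
  \<comment> \<open>While \<open>r\<close> is below n, counting gives a nonzero \<open>p\<close>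
    vanishing on \<open>Z r\<close>. By density the orbit has a point \<open>y\<close> off its zero
    set, and sweeping by the element that carries \<open>x\<close> to \<open>y\<close> reaches
    it.\<close>
  obtain p where p: "p \<in> van (Z r)" "p \<noteq> 0" using dim_bound_nonzero[OF Z(3)] Suc.prems by auto
  then have "p \<notin> van (orbit G \<phi> a)" using dense by simp
  then obtain y where y: "y \<in> orbit G \<phi> a" "mpeval p y \<noteq> 0" by (auto simp: van_def)
  obtain x where x: "x \<in> Z r" using Zr(2) by blast
  obtain g where g: "g \<in> carrier G" "y = \<phi> g x" using orbit_transitive[of x a y] x y Zr(1) by blast
  define Z' where "Z' = Z(Suc r := sweep g (Z r))"
  have "\<phi> (g [^] (s::nat)) z \<in> orbit G \<phi> a" if "z \<in> Z r" for s z
    using orbit_closed[of z a "g [^] s"] that Zr(1) g(1) by auto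
  then have "sweep g (Z r) \<subseteq> orbit G \<phi> a" by (auto simp: sweep_def)
  moreover have "sweep g (Z r) \<noteq> {}" using Zr(2) sweep_superset by blast
  moreover have "primeideal_of (van (sweep g (Z r)))" by (rule primeideal_van_sweep[OF g(1) Zr(2,3)])
  ultimately have 1: "\<forall>i\<le>Suc r. Z' i \<subseteq> orbit G \<phi> a \<and> Z' i \<noteq> {} \<and> primeideal_of (van (Z' i))"
    using Z(1) by (simp add: Z'_def le_Suc_eq)
  have "p \<notin> van (sweep g (Z r))" using vanD[of p _ y] sweep_image[OF g(1) x] y g by auto
  then have "van (sweep g (Z r)) \<noteq> van (Z r)" using p by blast
  then have 2: "\<forall>i<Suc r. Z' i \<subseteq> Z' (Suc i) \<and> van (Z' (Suc i)) \<noteq> van (Z' i)"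
    using Z(2) sweep_superset by (simp add: Z'_def less_Suc_eq)
  have "dim_bound (Z' (Suc r)) (Suc r)" using dim_bound_sweep[OF g(1) Z(3)] by (simp add: Z'_def)
  then show ?case using 1 2 by blast
qed

text \<open>Passing to closures inside the orbit keeps the vanishing ideals, hence the strictness of
  the chain of length n.\<close>

lemma dense_orbit_dim:
  assumes "van (orbit G \<phi> a) = {0}"
  shows "enat CARD('n) \<le> orbit_dim G \<phi> a"
proof -
  let ?O = "orbit G \<phi> a"
  obtain Z where Z: "\<And>i. i \<le> CARD('n) \<Longrightarrow> Z i \<subseteq> ?O \<and> Z i \<noteq> {} \<and> primeideal_of (van (Z i))"
    "\<And>i. i < CARD('n) \<Longrightarrow> Z i \<subseteq> Z (Suc i) \<and> van (Z (Suc i)) \<noteq> van (Z i)"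
    using dense_orbit_chain[OF assms order_refl] by blast
  define C where "C i = {x\<in>?O. \<forall>p\<in>van (Z i). mpeval p x = 0}" for i
  have irr: "irreducible_closedin (subtopology zariski ?O) (C i)" if "i \<le> CARD('n)" for i
    unfolding C_def using Z(1)[OF that] by (intro irreducible_closure) auto
  have vC: "van (C i) = van (Z i)" if "i \<le> CARD('n)" for i
    using Z(1)[OF that] vanD unfolding C_def van_def by blast
  have "C i \<subset> C (Suc i)" if "i < CARD('n)" for i
  proof -
    have "van (Z (Suc i)) \<subseteq> van (Z i)" using Z(2)[OF that] by (intro van_antimono) simp
    then have "C i \<subseteq> C (Suc i)" unfolding C_def by blast
    moreover have "C i \<noteq> C (Suc i)" using vC[of i] vC[of "Suc i"] Z(2)[OF that] that by auto
    ultimately show ?thesis by blast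
  qed
  then have "enat CARD('n) \<in> {enat d | d. \<exists>Z :: nat \<Rightarrow> ('n \<Rightarrow> 'k) set.
     (\<forall>i\<le>d. irreducible_closedin (subtopology zariski ?O) (Z i)) \<and> (\<forall>i<d. Z i \<subset> Z (Suc i))}"
    using irr by blast
  then show ?thesis unfolding orbit_dim_def krull_dim_def by (rule Sup_upper)
qed

end

section \<open>The ring of invariants\<close>

context unipotent_action
begin

lemma invariant_iff: "p \<in> invariant_polys G \<phi> \<longleftrightarrow> (\<forall>g\<in>carrier G. pull g p = p)"
proof
  assume p: "p \<in> invariant_polys G \<phi>"
  show "\<forall>g\<in>carrier G. pull g p = p"
    by (intro ballI pull_eqI) (use p in \<open>simp_all add: invariant_polys_def\<close>)
next
  assume p: "\<forall>g\<in>carrier G. pull g p = p"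
  have "mpeval p (\<phi> g a) = mpeval p a" if "g \<in> carrier G" for g a
    using mpeval_pull[OF that, of p a] p that by simp
  then show "p \<in> invariant_polys G \<phi>" by (simp add: invariant_polys_def)
qed

text \<open>Along each curve the degrees in the parameter add up, so a divisor of an invariant is constant on it.\<close>

lemma pull_factor:
  assumes g: "g \<in> carrier G" and nz: "u * v \<noteq> 0" and uv: "pull g (u * v) = u * v"
  shows "pull g u = u"
proof -
  define w where "w = u * v"
  have w1: "mpeval w (\<phi> g a) = mpeval w a" for a using mpeval_pull[OF g, of w a] uv by (simp add: w_def)
  have ws: "mpeval w (\<phi> (g [^] (s::nat)) a) = mpeval w a" for s a
  proof (induction s arbitrary: a)
    case (Suc s)
    have "mpeval w (\<phi> (g [^] Suc s) a) = mpeval w (\<phi> (g [^] s) (\<phi> g a))" using g by (simp add: act_mult)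
    then show ?case by (simp add: Suc w1)
  qed simp
  obtain D where D: "{u, v} \<subseteq> box D" using ex_box[of "{u, v}"] by auto
  \<comment> \<open>The degree argument requires \<open>w\<close> to be nonzero at \<open>a\<close>;
    the factor \<open>w\<close> covers the other points and is cancelled at the end.\<close>
  have "mpeval (w * (pull g u - u)) a = mpeval 0 a" for a
  proof (cases "mpeval w a = 0")
    case False
    obtain \<gamma> :: "'k poly" where \<gamma>: "\<And>s. mpeval u (\<phi> (g [^] (s::nat)) a) = poly \<gamma> (of_nat s)"
      using curve_poly[OF g] D by blast
    obtain \<eta> :: "'k poly" where \<eta>: "\<And>s. mpeval v (\<phi> (g [^] (s::nat)) a) = poly \<eta> (of_nat s)"
      using curve_poly[OF g] D by blast
    have "\<gamma> * \<eta> - [:mpeval w a:] = 0"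
    proof (rule poly_many_roots[OF order_refl])
      show "poly (\<gamma> * \<eta> - [:mpeval w a:]) (of_nat s) = 0" for s
        using ws[of s a] by (simp add: w_def \<gamma> \<eta>)
    qed
    then have e: "\<gamma> * \<eta> = [:mpeval w a:]" by simp
    then have "\<gamma> \<noteq> 0" "\<eta> \<noteq> 0" using False by auto
    then have "degree \<gamma> + degree \<eta> = 0" using e degree_mult_eq[of \<gamma> \<eta>] by simp
    then obtain c where c: "\<gamma> = [:c:]" using degree_eq_zeroE by auto
    have "mpeval u (\<phi> g a) = mpeval u a" using \<gamma>[of 0] \<gamma>[of 1] g by (simp add: c)
    then show ?thesis using g by simp
  qed simp
  then have "w * (pull g u - u) = 0" by (rule mpeval_ext)
  then show ?thesis using nz by (simp add: w_def)
qed

lemma orbit_ideal_nonzero: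
  assumes "orbit_dim G \<phi> a = enat (CARD('n) - 1)"
  shows "van (orbit G \<phi> a) \<noteq> {0}"
proof
  assume "van (orbit G \<phi> a) = {0}"
  from dense_orbit_dim[OF this] have "CARD('n) \<le> CARD('n) - 1" by (simp only: assms enat_ord_simps)
  \<comment> \<open>Positivity matters: for n = 0 the truncated \<open>n - 1\<close> would equal
    n.\<close>
  moreover have "CARD('n) > 0" by (simp add: card_gt_0_iff)
  ultimately show False by linarith
qed

lemma orbit_prime_chain:
  assumes "orbit_dim G \<phi> a = enat (CARD('n) - 1)"
  shows "\<exists>Q fs. van (orbit G \<phi> a) \<subseteq> Q \<and> prime_chain Q fs \<and> length fs = CARD('n) - 1"
proof (cases "CARD('n) - 1 = 0")
  \<comment> \<open>\<open>Sup_enat_attained\<close> excludes the value 0; for n = 1 the chain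
    without witnesses serves.\<close>
  case True
  then show ?thesis using primeideal_van_orbit[of a] by (intro exI[of _ "van (orbit G \<phi> a)"] exI[of _ "[]"]) simp
next
  case False
  let ?O = "orbit G \<phi> a"
  have "enat (CARD('n) - 1) \<in> {enat d | d. \<exists>Z :: nat \<Rightarrow> ('n \<Rightarrow> 'k) set.
     (\<forall>i\<le>d. irreducible_closedin (subtopology zariski ?O) (Z i)) \<and> (\<forall>i<d. Z i \<subset> Z (Suc i))}"
    using assms unfolding orbit_dim_def krull_dim_def by (rule Sup_enat_attained[OF _ False])
  then obtain Z :: "nat \<Rightarrow> ('n \<Rightarrow> 'k) set" where
    Z: "\<forall>i\<le>CARD('n) - 1. irreducible_closedin (subtopology zariski ?O) (Z i)" "\<forall>i<CARD('n) - 1. Z i \<subset> Z (Suc i)"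
    by auto
  obtain fs where "prime_chain (van (Z (CARD('n) - 1))) fs" "length fs = CARD('n) - 1"
    using prime_chain_of_irreducibles[of "CARD('n) - 1" ?O Z] Z by blast
  moreover have "van ?O \<subseteq> van (Z (CARD('n) - 1))"
    using Z(1) irreducible_closedinD(2)[of ?O "Z (CARD('n) - 1)"] by (intro van_antimono) simp
  ultimately show ?thesis by blast
qed

lemma primeideal_zero: "primeideal_of {0 :: 'a::idom}"
  by (auto simp: primeideal_of_def ideal_of_def)

lemma primeideal_multiples:
  fixes h :: "('n, 'k) mpoly"
  assumes "irreducible h"
  shows "primeideal_of {f. h dvd f}"
  using assms irreducible_dvd_mult[OF assms] by (auto simp: primeideal_of_def ideal_of_def irreducible_def)

text \<open>Take a nonzero element of least size. Of two factors one lies in \<open>P\<close> and so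
  already has the whole size, which leaves size 0, a unit, for the other.\<close>

lemma prime_ideal_irreducible:
  fixes P :: "('n, 'k) mpoly set"
  assumes P: "primeideal_of P" "P \<noteq> {0}"
  shows "\<exists>h\<in>P. irreducible h"
proof -
  have i: "ideal_of P" "1 \<notin> P" "\<And>p q. p * q \<in> P \<Longrightarrow> p \<in> P \<or> q \<in> P" using P(1) by (auto simp: primeideal_of_def)
  obtain h0 where "h0 \<in> P" "h0 \<noteq> 0" using P(2) ideal_ofD(1)[OF i(1)] by blast
  then obtain h where h: "h \<in> P" "h \<noteq> 0" "\<And>f. f \<in> P \<Longrightarrow> f \<noteq> 0 \<Longrightarrow> msize h \<le> msize f"
    using ex_has_least_nat[of "\<lambda>f. f \<in> P \<and> f \<noteq> 0" h0 msize] by blast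
  have "irreducible h"
    unfolding irreducible_def
  proof (intro conjI allI impI)
    show "h \<noteq> 0" by (rule h)
    show "\<not> h dvd 1"
    proof
      assume "h dvd 1"
      then obtain k where "1 = h * k" by blast
      then show False using i(2) ideal_ofD(4)[OF i(1) h(1), of k] by simp
    qed
    fix u v assume uv: "h = u * v"
    then have nz: "u \<noteq> 0" "v \<noteq> 0" using h(2) by auto
    have m: "msize h = msize u + msize v" using nz by (simp add: uv msize_mult)
    have "u \<in> P \<or> v \<in> P" using i(3) h(1) uv by simp
    then show "u dvd 1 \<or> v dvd 1"
    proof
      assume "u \<in> P"
      then have "msize v = 0" using h(3)[of u] nz m by simp
      then show ?thesis using msize_0_unit nz by blast
    next
      assume "v \<in> P"
      then have "msize u = 0" using h(3)[of v] nz m by simp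
      then show ?thesis using msize_0_unit nz by blast
    qed
  qed
  then show ?thesis using h(1) by blast
qed

text \<open>If \<open>h\<close> did not divide some \<open>f\<close> in the ideal, the primes 0 and
  (h) would go below the chain given by the dimension of the orbit, with witnesses \<open>h\<close>
  and \<open>f\<close>: n + 1 witnesses in all, one too many.\<close>

lemma orbit_ideal_principal:
  assumes "orbit_dim G \<phi> a = enat (CARD('n) - 1)"
  shows "\<exists>h. irreducible h \<and> van (orbit G \<phi> a) = {f. h dvd f}"
proof -
  let ?P = "van (orbit G \<phi> a)"
  obtain h where h: "h \<in> ?P" "irreducible h"
    using prime_ideal_irreducible[OF primeideal_van_orbit orbit_ideal_nonzero[OF assms]] by blast
  have iP: "ideal_of ?P" using primeideal_van_orbit by (rule primeideal_ofD)
  have "h dvd f" if f: "f \<in> ?P" for f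
  proof (rule ccontr)
    assume n: "\<not> h dvd f"
    obtain Q fs where Q: "?P \<subseteq> Q" "prime_chain Q fs" "length fs = CARD('n) - 1"
      using orbit_prime_chain[OF assms] by blast
    have hQ: "{f. h dvd f} \<subseteq> Q"
    proof
      fix x assume "x \<in> {f. h dvd f}"
      then obtain k where "x = h * k" by blast
      then show "x \<in> Q" using ideal_ofD(4)[OF iP h(1)] Q(1) by auto
    qed
    have "prime_chain {f. h dvd f} (f # fs)"
      using primeideal_multiples[OF h(2)] n f Q hQ by auto
    moreover have "h \<noteq> 0" using h(2) by (auto simp: irreducible_def)
    ultimately have "prime_chain {0} (h # f # fs)"
      unfolding prime_chain.simps(2)[of "{0}" h] using primeideal_zero
      by (intro conjI exI[of _ "{f. h dvd f}"]) simp_all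
    from prime_chain_length[OF this] show False using Q(3) by simp
  qed
  moreover have "f \<in> ?P" if "h dvd f" for f
    using that ideal_ofD(4)[OF iP h(1)] by (elim dvdE) simp
  ultimately show ?thesis using h(2) by blast
qed

text \<open>The last nonzero vector \<open>w\<close> among the iterates of \<open>dif g\<close> on
  \<open>h\<close> is fixed by \<open>g\<close>, and \<open>h\<close> divides it because the orbit
  ideal is stable. A factor of a fixed nonzero polynomial is fixed, by
  \<open>pull_factor\<close>.\<close>

lemma generator_invariant:
  assumes h: "irreducible h" and P: "van (orbit G \<phi> a) = {f. h dvd f}"
  shows "h \<in> invariant_polys G \<phi>"
  unfolding invariant_iff
proof
  fix g assume g: "g \<in> carrier G"
  have h0: "h \<noteq> 0" using h by (auto simp: irreducible_def)
  define N where "N = (LEAST N. (dif g ^^ N) h = 0)"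
  have N: "(dif g ^^ N) h = 0" unfolding N_def by (rule LeastI_ex[OF dif_nilpotent[OF g]])
  obtain M where M: "N = Suc M" using N h0 by (cases N) auto
  define w where "w = (dif g ^^ M) h"
  have "w \<noteq> 0" using not_less_Least[of M "\<lambda>N. (dif g ^^ N) h = 0"] M by (simp add: w_def N_def)
  have "dif g w = 0" using N by (simp add: M w_def)
  then have w: "pull g w = w" by (simp add: dif_def)
  have "(dif g ^^ j) h \<in> van (orbit G \<phi> a)" for j
  proof (induction j)
    case 0
    then show ?case by (simp add: P)
  next
    case (Suc j)
    have "pull g x - x \<in> van (orbit G \<phi> a)" if "x \<in> van (orbit G \<phi> a)" for x
      using pull_van_orbit[OF that g] that by (simp add: van_def)
    then show ?case using Suc by (simp add: dif_def)
  qed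
  then have "h dvd w" using P by (simp add: w_def)
  then obtain q where q: "w = h * q" by blast
  then show "pull g h = h" using pull_factor[OF g, of h q] w \<open>w \<noteq> 0\<close> by simp
qed

lemma invariants_generated:
  assumes h: "irreducible h" and P: "van (orbit G \<phi> a) = {f. h dvd f}"
  shows "invariant_polys G \<phi> = generated_algebra h"
proof
  note hinv = generator_invariant[OF assms]
  show "generated_algebra h \<subseteq> invariant_polys G \<phi>"
  proof
    fix p assume "p \<in> generated_algebra h"
    then obtain q :: "'k poly" where q: "p = poly (map_poly mconst q) h" by (auto simp: generated_algebra_def)
    have "pull g (poly (map_poly mconst q) h) = poly (map_poly mconst q) h" if g: "g \<in> carrier G" for g
    proof (induction q)
      case (pCons c q)
      then show ?case using hinv g by (simp add: map_poly_pCons pull_hom[OF g] invariant_iff)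
    qed (simp add: g)
    then show "p \<in> invariant_polys G \<phi>" by (simp add: q invariant_iff)
  qed
  have "p \<in> generated_algebra h" if "p \<in> invariant_polys G \<phi>" for p
    using that
  proof (induction "msize p" arbitrary: p rule: less_induct)
    case less
    define c where "c = mpeval p a"
    have "p - mconst c \<in> van (orbit G \<phi> a)"
      using less.prems by (auto simp: van_def orbit_def c_def invariant_polys_def)
    then have "h dvd p - mconst c" using P by simp
    then obtain r where r: "p - mconst c = h * r" by blast
    then have p: "p = mconst c + h * r" by (simp add: algebra_simps)
    show ?case
    proof (cases "r = 0")
      case True
      then have "p = poly (map_poly mconst [:c:]) h" using p by (simp add: map_poly_pCons)
      then show ?thesis unfolding generated_algebra_def by blast
    next
      case False
      have h0: "h \<noteq> 0" "msize h \<noteq> 0" using h by (auto simp: irreducible_def unit_iff_msize)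
      have "pull g r = r" if g: "g \<in> carrier G" for g
      proof -
        have "h * pull g r = pull g (p - mconst c)" unfolding r using hinv g by (simp add: pull_hom[OF g] invariant_iff)
        also have "\<dots> = h * r" using less.prems g by (simp add: r[symmetric] pull_hom[OF g] invariant_iff)
        finally show ?thesis using h0 by simp
      qed
      then have rinv: "r \<in> invariant_polys G \<phi>" by (simp add: invariant_iff)
      have "msize h + msize r = msize (p - mconst c)" using r msize_mult[OF h0(1) False] by simp
      also have "\<dots> \<le> msize p" unfolding msize_def
        by (rule sum_mono) (use dg_diff_le[of _ p "mconst c"] in simp)
      finally have "msize r < msize p" using h0(2) by simp
      then obtain q :: "'k poly" where q: "r = poly (map_poly mconst q) h"
        using less.hyps rinv by (auto simp: generated_algebra_def)
      have "p = poly (map_poly mconst (pCons c q)) h" by (simp add: p q map_poly_pCons)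
      then show ?thesis unfolding generated_algebra_def by blast
    qed
  qed
  then show "invariant_polys G \<phi> \<subseteq> generated_algebra h" by blast
qed

end

section \<open>Transcendence over the invariants\<close>

text \<open>Pulling back a relation for \<open>v\<close> replaces \<open>v\<close> by
  \<open>v + a\<close> with \<open>a = dif g v\<close>. The sum \<open>S\<close> is the relation
  rewritten in \<open>v\<close>: the top coefficient stays, the next gains d times the top times
  \<open>a\<close>.\<close>

lemma shift_coeffs:
  fixes c :: "nat \<Rightarrow> 'a::comm_ring_1" and a :: 'a and d :: nat
  defines "S \<equiv> \<Sum>i\<le>d. smult (c i) ([:a, 1:] ^ i)"
  shows "poly S v = (\<Sum>i\<le>d. c i * (v + a) ^ i)" "coeff S d = c d" "degree S \<le> d"
    "d > 0 \<Longrightarrow> coeff S (d - 1) = c (d - 1) + c d * (of_nat d * a)"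
proof -
  show "poly S v = (\<Sum>i\<le>d. c i * (v + a) ^ i)" by (simp add: S_def poly_sum add.commute)
  have dg: "degree ([:a, 1:] ^ i) \<le> i" for i using degree_power_le[of "[:a, 1:]" i] by simp
  show "degree S \<le> d" unfolding S_def
  proof (rule degree_sum_le)
    fix i assume "i \<in> {..d}"
    then show "degree (smult (c i) ([:a, 1:] ^ i)) \<le> d"
      using degree_smult_le[of "c i" "[:a, 1:] ^ i"] dg[of i] by simp
  qed simp
  have z: "coeff ([:a, 1:] ^ i) j = 0" if "i < j" for i j using that dg[of i] by (intro coeff_eq_0) simp
  have "coeff S d = (\<Sum>i\<le>d. if i = d then c d else 0)"
    unfolding S_def coeff_sum by (rule sum.cong) (auto simp: coeff_linear_power z)
  then show "coeff S d = c d" by simp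
  show "coeff S (d - 1) = c (d - 1) + c d * (of_nat d * a)" if d: "d > 0"
  proof -
    obtain e where e: "d = Suc e" using d by (cases d) auto
    have "coeff S e = (\<Sum>i\<le>e. c i * coeff ([:a, 1:] ^ i) e) + c d * coeff ([:a, 1:] ^ d) e"
      by (simp add: S_def e coeff_sum del: power_Suc)
    also have "(\<Sum>i\<le>e. c i * coeff ([:a, 1:] ^ i) e) = (\<Sum>i\<le>e. if i = e then c e else 0)"
      by (rule sum.cong) (auto simp: coeff_linear_power z)
    also have "coeff ([:a, 1:] ^ d) e = of_nat d * a" by (subst coeff_linear_poly_power) (simp_all add: e)
    finally show ?thesis by (simp add: e)
  qed
qed

context unipotent_action
begin

lemma pull_of_nat: "g \<in> carrier G \<Longrightarrow> pull g (of_nat j) = of_nat j"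
  by (rule pull_eqI) simp_all

text \<open>The traces on polynomials of \<open>G\<close>-stable fields of rational functions that contain the invariant ones.\<close>

definition stable_trace :: "('n, 'k) mpoly set \<Rightarrow> bool" where
  "stable_trace K \<longleftrightarrow> invariant_polys G \<phi> \<subseteq> K \<and> (\<forall>p\<in>K. \<forall>q\<in>K. p + q \<in> K \<and> p * q \<in> K) \<and>
     (\<forall>q\<in>K. \<forall>b. q \<noteq> 0 \<longrightarrow> q * b \<in> K \<longrightarrow> b \<in> K) \<and> (\<forall>g\<in>carrier G. \<forall>p\<in>K. pull g p \<in> K)"

lemma stable_traceD:
  assumes "stable_trace K"
  shows "p \<in> invariant_polys G \<phi> \<Longrightarrow> p \<in> K" "p \<in> K \<Longrightarrow> q \<in> K \<Longrightarrow> p + q \<in> K" "p \<in> K \<Longrightarrow> q \<in> K \<Longrightarrow> p * q \<in> K"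
    "q \<in> K \<Longrightarrow> q \<noteq> 0 \<Longrightarrow> q * b \<in> K \<Longrightarrow> b \<in> K" "g \<in> carrier G \<Longrightarrow> p \<in> K \<Longrightarrow> pull g p \<in> K"
    "mconst c \<in> K" "0 \<in> K" "1 \<in> K" "p \<in> K \<Longrightarrow> - p \<in> K" "p \<in> K \<Longrightarrow> q \<in> K \<Longrightarrow> p - q \<in> K"
    "p \<in> K \<Longrightarrow> p ^ j \<in> K" "of_nat j \<in> K" "(\<And>s. s \<in> S \<Longrightarrow> f s \<in> K) \<Longrightarrow> sum f S \<in> K"
proof -
  show 1: "\<And>p. p \<in> invariant_polys G \<phi> \<Longrightarrow> p \<in> K" "\<And>p q. p \<in> K \<Longrightarrow> q \<in> K \<Longrightarrow> p + q \<in> K"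
    "\<And>p q. p \<in> K \<Longrightarrow> q \<in> K \<Longrightarrow> p * q \<in> K"
    "\<And>q b. q \<in> K \<Longrightarrow> q \<noteq> 0 \<Longrightarrow> q * b \<in> K \<Longrightarrow> b \<in> K" "\<And>g p. g \<in> carrier G \<Longrightarrow> p \<in> K \<Longrightarrow> pull g p \<in> K"
    using assms unfolding stable_trace_def by blast+
  show c: "mconst c \<in> K" for c by (rule 1(1)) (simp add: invariant_polys_def)
  show z: "0 \<in> K" "1 \<in> K" using c[of 0] c[of 1] by simp_all
  show m: "- p \<in> K" if "p \<in> K" for p using 1(3)[OF c[of "- 1"] that] by (simp add: mconst_minus)
  show "p - q \<in> K" if "p \<in> K" "q \<in> K" for p q using 1(2)[OF that(1) m[OF that(2)]] by simp
  show "p ^ j \<in> K" if "p \<in> K" for p using that by (induction j) (simp_all add: z 1(3))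
  show "of_nat j \<in> K" by (induction j) (simp_all add: z 1(2))
  show "(\<And>s. s \<in> S \<Longrightarrow> f s \<in> K) \<Longrightarrow> sum f S \<in> K"
    by (induction S rule: infinite_finite_induct) (simp_all add: z 1(2))
qed

text \<open>
  The leading coefficients of the relations of minimal degree \<open>d\<close> form a stable subspace, so one of them,
  \<open>m\<close>, is invariant; comparing subleading coefficients, \<open>m\<^sub>1 + d m v\<close> is then invariant as well.
\<close>

lemma transcendental:
  assumes K: "stable_trace K" and v: "v \<notin> K" "\<And>g. g \<in> carrier G \<Longrightarrow> dif g v \<in> K"
    and P: "\<And>i. coeff P i \<in> K" "poly P v = 0"
  shows "P = 0"
proof (rule ccontr)
  assume "P \<noteq> 0"
  note KD = stable_traceD[OF K]
  \<comment> \<open>The degree is only bounded by \<open>d\<close>, so 0 is allowed as a coefficient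
    and the possible \<open>m\<close> form a group under subtraction.\<close>
  define rel where "rel d m \<longleftrightarrow> (\<exists>P. (\<forall>i. coeff P i \<in> K) \<and> degree P \<le> d \<and> coeff P d = m \<and> poly P v = 0)" for d m
  have ex: "\<exists>d m. m \<noteq> 0 \<and> rel d m"
    using P \<open>P \<noteq> 0\<close> unfolding rel_def
    by (intro exI[of _ "degree P"] exI[of _ "lead_coeff P"] conjI exI[of _ P]) simp_all
  define d where "d = (LEAST d. \<exists>m. m \<noteq> 0 \<and> rel d m)"
  have d: "\<exists>m. m \<noteq> 0 \<and> rel d m" unfolding d_def using ex by (rule LeastI_ex)
  have low: "R = 0" if R: "\<And>i. coeff R i \<in> K" "poly R v = 0" "R = 0 \<or> degree R < d" for R
  proof (rule ccontr)
    assume R0: "R \<noteq> 0"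
    then have "lead_coeff R \<noteq> 0 \<and> rel (degree R) (lead_coeff R)"
      unfolding rel_def using R by (intro conjI exI[of _ R]) simp_all
    then have "d \<le> degree R" unfolding d_def by (intro Least_le exI)
    then show False using R R0 by simp
  qed
  have shift: "\<exists>S. (\<forall>i. coeff S i \<in> K) \<and> degree S \<le> d \<and> coeff S d = pull g (coeff R d) \<and> poly S v = 0 \<and>
      (d > 0 \<longrightarrow> coeff S (d - 1) = pull g (coeff R (d - 1)) + pull g (coeff R d) * (of_nat d * dif g v))"
    if g: "g \<in> carrier G" and R: "\<And>i. coeff R i \<in> K" "degree R \<le> d" "poly R v = 0" for g R
  proof (intro exI[of _ "\<Sum>i\<le>d. smult (pull g (coeff R i)) ([:dif g v, 1:] ^ i)"] conjI allI impI shift_coeffs)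
    show "coeff (\<Sum>i\<le>d. smult (pull g (coeff R i)) ([:dif g v, 1:] ^ i)) j \<in> K" for j
      unfolding coeff_sum
    proof (intro KD(13))
      fix i
      have "coeff ([:dif g v, 1:] ^ i) j \<in> K"
      proof (cases "j \<le> i")
        case True
        then show ?thesis using v(2)[OF g] by (subst coeff_linear_poly_power) (auto intro!: KD(3) KD(11) KD(12))
      next
        case False
        then have "coeff ([:dif g v, 1:] ^ i) j = 0"
          using degree_power_le[of "[:dif g v, 1:]" i] by (intro coeff_eq_0) simp
        then show ?thesis using KD(7) by simp
      qed
      then show "coeff (smult (pull g (coeff R i)) ([:dif g v, 1:] ^ i)) j \<in> K"
        using KD(3) KD(5)[OF g] R(1) by simp
    qed
    have "(\<Sum>i\<le>d. pull g (coeff R i) * (v + dif g v) ^ i) = pull g (\<Sum>i\<le>d. coeff R i * v ^ i)"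
      by (simp add: pull_hom[OF g] dif_def)
    also have "(\<Sum>i\<le>d. coeff R i * v ^ i) = poly R v"
      unfolding poly_altdef by (rule sum.mono_neutral_right) (use R(2) in \<open>auto simp: coeff_eq_0\<close>)
    finally show "poly (\<Sum>i\<le>d. smult (pull g (coeff R i)) ([:dif g v, 1:] ^ i)) v = 0"
      using R(3) g by (simp add: shift_coeffs(1))
  qed
  have relpull: "rel d (pull g m)" if r: "rel d m" and g: "g \<in> carrier G" for g m
  proof -
    obtain R where "\<And>i. coeff R i \<in> K" "degree R \<le> d" "poly R v = 0" "coeff R d = m"
      using r unfolding rel_def by blast
    then show ?thesis using shift[OF g, of R] unfolding rel_def by blast
  qed
  have reldif: "rel d (m - m')" if r: "rel d m" "rel d m'" for m m'
  proof -
    obtain R R' where R: "\<And>i. coeff R i \<in> K" "degree R \<le> d" "poly R v = 0" "coeff R d = m"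
      "\<And>i. coeff R' i \<in> K" "degree R' \<le> d" "poly R' v = 0" "coeff R' d = m'"
      using r unfolding rel_def by blast
    then show ?thesis unfolding rel_def
      by (intro exI[of _ "R - R'"]) (auto intro!: KD(10) degree_diff_le)
  qed
  obtain m0 where m0: "rel d m0" "m0 \<noteq> 0" using d by blast
  have "\<exists>m\<in>{m. rel d m} - {0}. \<forall>g\<in>carrier G. dif g m \<in> {0}"
    by (rule fixed_vector[of "{0}" m0]) (use m0 in \<open>auto simp: dif_def intro!: reldif relpull\<close>)
  then obtain m where m: "rel d m" "m \<noteq> 0" "\<And>g. g \<in> carrier G \<Longrightarrow> dif g m = 0" by blast
  obtain R where R: "\<And>i. coeff R i \<in> K" "degree R \<le> d" "poly R v = 0" "coeff R d = m"
    using m(1) unfolding rel_def by blast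
  have mK: "m \<in> K" using R(1)[of d] R(4) by simp
  have d0: "d > 0"
  proof (rule ccontr)
    assume "\<not> d > 0"
    then have "degree R = 0" "coeff R 0 = m" using R by simp_all
    then have "poly R v = m" by (simp add: poly_altdef)
    then show False using R m by simp
  qed
  define w where "w = coeff R (d - 1) + of_nat d * m * v"
  have "pull g w = w" if g: "g \<in> carrier G" for g
  proof -
    obtain S where S: "\<And>i. coeff S i \<in> K" "degree S \<le> d" "coeff S d = pull g m" "poly S v = 0"
      "coeff S (d - 1) = pull g (coeff R (d - 1)) + pull g m * (of_nat d * dif g v)"
      using shift[OF g R(1,2,3)] d0 R(4) by blast
    have gm: "pull g m = m" using m(3)[OF g] by (simp add: dif_def)
    \<comment> \<open>The leading coefficients agree because \<open>m\<close> is invariant, so the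
      difference is a relation of degree below the minimum \<open>d\<close>.\<close>
    have "S - R = 0"
    proof (rule low)
      show "coeff (S - R) i \<in> K" for i using S R KD(10) by simp
      show "poly (S - R) v = 0" using S R by simp
      show "S - R = 0 \<or> degree (S - R) < d"
        using eq_zero_or_degree_less[of "S - R" d] degree_diff_le[OF S(2) R(2)] S(3) R(4) gm by simp
    qed
    then have "S = R" by simp
    then have e: "pull g (coeff R (d - 1)) + m * (of_nat d * dif g v) = coeff R (d - 1)"
      using S(5) unfolding gm by (simp only:)
    have "pull g w = pull g (coeff R (d - 1)) + of_nat d * m * pull g v"
      unfolding w_def by (simp only: pull_hom[OF g] gm pull_of_nat[OF g])
    also have "\<dots> = pull g (coeff R (d - 1)) + m * (of_nat d * dif g v) + of_nat d * m * v"
      by (simp add: dif_def algebra_simps)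
    finally show ?thesis unfolding e w_def .
  qed
  \<comment> \<open>Now \<open>v\<close> is a quotient of elements of \<open>K\<close>, with
    denominator d m nonzero in characteristic zero, and \<open>K\<close> is closed under such
    division.\<close>
  then have "w \<in> K" by (intro KD(1)) (simp add: invariant_iff)
  then have "w - coeff R (d - 1) \<in> K" using R(1) by (intro KD(10))
  then have "(of_nat d * m) * v \<in> K" by (simp add: w_def)
  moreover have "of_nat d * m \<in> K" using mK by (intro KD(3) KD(12))
  moreover have "of_nat d * m \<noteq> 0" using d0 m(2) by simp
  ultimately have "v \<in> K" using KD(4) by blast
  then show False using v(1) by simp
qed

end

section \<open>Adjoining transcendental elements\<close>

definition polyval :: "'a::comm_ring_1 set \<Rightarrow> 'a \<Rightarrow> 'a set" where
  "polyval K v = {poly P v | P. \<forall>i. coeff P i \<in> K}"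

text \<open>The polynomials in the fraction field of K[v], with denominators cleared;
  \<open>polyval K v\<close> is K[v].\<close>

definition adjoin :: "'a::comm_ring_1 set \<Rightarrow> 'a \<Rightarrow> 'a set" where
  "adjoin K v = {b. \<exists>q\<in>polyval K v. q \<noteq> 0 \<and> q * b \<in> polyval K v}"

lemma ring_map_mfract: "ring_map (mfract :: ('n::linorder, 'k::field) mpoly \<Rightarrow> _)"
  by (simp add: ring_map_def mfract_def One_fract_def)

lemma mfract_eq_0: "mfract p = 0 \<longleftrightarrow> p = 0"
  by (simp add: mfract_def Zero_fract_def eq_fract)

lemma is_subfieldD:
  assumes "is_subfield F"
  shows "x \<in> F \<Longrightarrow> y \<in> F \<Longrightarrow> x + y \<in> F" "x \<in> F \<Longrightarrow> y \<in> F \<Longrightarrow> x * y \<in> F" "x \<in> F \<Longrightarrow> inverse x \<in> F" "0 \<in> F"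
proof -
  have d: "\<And>x y. x \<in> F \<Longrightarrow> y \<in> F \<Longrightarrow> x - y \<in> F" and one: "1 \<in> F"
    and m: "\<And>x y. x \<in> F \<Longrightarrow> y \<in> F \<Longrightarrow> x * y \<in> F" "\<And>x. x \<in> F \<Longrightarrow> inverse x \<in> F"
    using assms unfolding is_subfield_def by blast+
  show z: "0 \<in> F" using d[OF one one] by simp
  show "x \<in> F \<Longrightarrow> y \<in> F \<Longrightarrow> x + y \<in> F" using d[OF _ d[OF z], of x y] by simp
  show "x \<in> F \<Longrightarrow> y \<in> F \<Longrightarrow> x * y \<in> F" "x \<in> F \<Longrightarrow> inverse x \<in> F" by (rule m, assumption+)+
qed

lemma mfract_poly_mem:
  fixes v :: "('n::linorder, 'k::field) mpoly"
  assumes F: "is_subfield F" and v: "mfract v \<in> F" and P: "\<And>i. mfract (coeff P i) \<in> F"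
  shows "mfract (poly P v) \<in> F"
  using P
proof (induction P)
  case 0
  then show ?case by (simp add: ring_mapD[OF ring_map_mfract] is_subfieldD(4)[OF F])
next
  case (pCons a P)
  have "mfract a \<in> F" using pCons.prems[of 0] by simp
  moreover have "mfract (coeff P i) \<in> F" for i using pCons.prems[of "Suc i"] by simp
  ultimately show ?case using pCons.IH v
    by (simp add: ring_mapD[OF ring_map_mfract] is_subfieldD[OF F])
qed

lemma adjoin_mfract_mem:
  fixes v :: "('n::linorder, 'k::field) mpoly"
  assumes F: "is_subfield F" and v: "mfract v \<in> F" and K: "\<And>b. b \<in> K \<Longrightarrow> mfract b \<in> F" and b: "b \<in> adjoin K v"
  shows "mfract b \<in> F"
proof -
  have pv: "mfract q \<in> F" if "q \<in> polyval K v" for q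
    using that mfract_poly_mem[OF F v] K by (auto simp: polyval_def)
  obtain q where q: "q \<in> polyval K v" "q \<noteq> 0" "q * b \<in> polyval K v" using b by (auto simp: adjoin_def)
  have "mfract b = inverse (mfract q) * mfract (q * b)"
    using q(2) by (simp add: ring_mapD[OF ring_map_mfract] mfract_eq_0 flip: mult.assoc)
  also have "\<dots> \<in> F" by (intro is_subfieldD(2,3)[OF F] pv q)
  finally show ?thesis .
qed

context unipotent_action
begin

lemma polyval_ring:
  assumes K: "stable_trace K"
  shows "b \<in> K \<Longrightarrow> b \<in> polyval K v" "v \<in> polyval K v"
    "p \<in> polyval K v \<Longrightarrow> q \<in> polyval K v \<Longrightarrow> p + q \<in> polyval K v"
    "p \<in> polyval K v \<Longrightarrow> q \<in> polyval K v \<Longrightarrow> p * q \<in> polyval K v"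
proof -
  note KD = stable_traceD[OF K]
  show "b \<in> polyval K v" if "b \<in> K"
    unfolding polyval_def
    by (intro CollectI exI[of _ "[:b:]"]) (use that KD(7) in \<open>simp add: coeff_pCons split: nat.splits\<close>)
  show "v \<in> polyval K v"
    unfolding polyval_def
    by (intro CollectI exI[of _ "[:0, 1:]"]) (use KD(7,8) in \<open>simp add: coeff_pCons split: nat.splits\<close>)
  assume "p \<in> polyval K v" "q \<in> polyval K v"
  then obtain P Q where PQ: "p = poly P v" "q = poly Q v" "\<And>i. coeff P i \<in> K" "\<And>i. coeff Q i \<in> K"
    by (auto simp: polyval_def)
  have "coeff (P * Q) i \<in> K" for i unfolding coeff_mult by (intro KD(13) KD(3) PQ)
  then show "p * q \<in> polyval K v" unfolding polyval_def using PQ(1,2)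
    by (intro CollectI exI[of _ "P * Q"]) simp
  show "p + q \<in> polyval K v" unfolding polyval_def using PQ
    by (intro CollectI exI[of _ "P + Q"]) (simp add: KD(2))
qed

lemma adjoin_superset:
  assumes K: "stable_trace K"
  shows "polyval K v \<subseteq> adjoin K v"
proof
  fix b assume "b \<in> polyval K v"
  then show "b \<in> adjoin K v"
    using polyval_ring(1)[OF K stable_traceD(8)[OF K], of v] unfolding adjoin_def
    by (intro CollectI bexI[of _ 1]) simp_all
qed

text \<open>\<open>pull g\<close> sends \<open>v\<close> to \<open>v + dif g v\<close> with second
  summand in \<open>K\<close>, so it preserves K[v]; closure under the field operations is a matter
  of common denominators.\<close>

lemma stable_trace_adjoin:
  assumes K: "stable_trace K" and v: "\<And>g. g \<in> carrier G \<Longrightarrow> dif g v \<in> K"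
  shows "stable_trace (adjoin K v)"
proof -
  note KD = stable_traceD[OF K] and pv = polyval_ring[OF K, where v = v]
  have pvs: "sum f S \<in> polyval K v" if "\<And>s. s \<in> S \<Longrightarrow> f s \<in> polyval K v" for f and S :: "nat set"
    using that by (induction S rule: infinite_finite_induct) (auto intro: pv KD(7))
  have pvp: "p ^ j \<in> polyval K v" if "p \<in> polyval K v" for p j
    using that by (induction j) (auto intro: pv KD(8))
  have pull_pv: "pull g p \<in> polyval K v" if g: "g \<in> carrier G" and p: "p \<in> polyval K v" for g p
  proof -
    obtain P where P: "p = poly P v" "\<And>i. coeff P i \<in> K" using p by (auto simp: polyval_def)
    have "pull g p = (\<Sum>i\<le>degree P. pull g (coeff P i) * (v + dif g v) ^ i)"
      by (simp add: P(1) poly_altdef pull_hom[OF g] dif_def)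
    also have "\<dots> \<in> polyval K v"
      by (intro pvs pv(4) pvp pv(3) pv(1) pv(2) v[OF g] KD(5)[OF g] P(2))
    finally show ?thesis .
  qed
  show ?thesis
    unfolding stable_trace_def
  proof (intro conjI ballI allI impI)
    show "invariant_polys G \<phi> \<subseteq> adjoin K v" using KD(1) pv(1) adjoin_superset[OF K] by blast
    fix p assume p: "p \<in> adjoin K v"
    then obtain s where s: "s \<in> polyval K v" "s \<noteq> 0" "s * p \<in> polyval K v" by (auto simp: adjoin_def)
    show "pull g p \<in> adjoin K v" if g: "g \<in> carrier G" for g
      unfolding adjoin_def
    proof (intro CollectI bexI conjI)
      show "pull g s \<in> polyval K v" "pull g s \<noteq> 0" using pull_pv[OF g] s g by simp_all
      show "pull g s * pull g p \<in> polyval K v" using pull_pv[OF g s(3)] by (simp add: pull_hom[OF g])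
    qed
    fix q assume q: "q \<in> adjoin K v"
    then obtain t where t: "t \<in> polyval K v" "t \<noteq> 0" "t * q \<in> polyval K v" by (auto simp: adjoin_def)
    have st: "s * t \<in> polyval K v" "s * t \<noteq> 0" using s t pv(4) by auto
    have "t * (s * p) + s * (t * q) \<in> polyval K v" by (intro pv(3) pv(4) s t)
    also have "t * (s * p) + s * (t * q) = (s * t) * (p + q)" by (simp add: algebra_simps)
    finally have "(s * t) * (p + q) \<in> polyval K v" .
    then show "p + q \<in> adjoin K v" using st unfolding adjoin_def by blast
    have "(s * p) * (t * q) \<in> polyval K v" by (intro pv(4) s t)
    also have "(s * p) * (t * q) = (s * t) * (p * q)" by (simp add: mult_ac)
    finally have "(s * t) * (p * q) \<in> polyval K v" .
    then show "p * q \<in> adjoin K v" using st unfolding adjoin_def by blast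
  next
    fix q b assume "q \<in> adjoin K v" "q \<noteq> 0" "q * b \<in> adjoin K v"
    then obtain s t where s: "s \<in> polyval K v" "s \<noteq> 0" "s * q \<in> polyval K v"
      and t: "t \<in> polyval K v" "t \<noteq> 0" "t * (q * b) \<in> polyval K v" by (auto simp: adjoin_def)
    have tsq: "t * (s * q) \<in> polyval K v" "t * (s * q) \<noteq> 0" using s t \<open>q \<noteq> 0\<close> by (simp_all add: pv(4))
    have "s * (t * (q * b)) \<in> polyval K v" by (intro pv(4) s t)
    also have "s * (t * (q * b)) = t * (s * q) * b" by (simp add: mult_ac)
    finally have "t * (s * q) * b \<in> polyval K v" .
    then show "b \<in> adjoin K v" using tsq unfolding adjoin_def by blast
  qed
qed

section \<open>Towers from the invariants up to all rational functions\<close>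

inductive tower :: "('n, 'k) mpoly list \<Rightarrow> ('n, 'k) mpoly set \<Rightarrow> bool" where
  base: "tower [] (invariant_polys G \<phi>)"
| step: "tower ts K \<Longrightarrow> v \<notin> K \<Longrightarrow> (\<And>g. g \<in> carrier G \<Longrightarrow> dif g v \<in> K) \<Longrightarrow> tower (v # ts) (adjoin K v)"

lemma stable_trace_invariants: "stable_trace (invariant_polys G \<phi>)"
  unfolding stable_trace_def
proof (intro conjI ballI allI impI)
  fix q b assume q: "q \<in> invariant_polys G \<phi>" "q \<noteq> 0" "q * b \<in> invariant_polys G \<phi>"
  have "pull g b = b" if g: "g \<in> carrier G" for g
  proof -
    have "q * pull g b = pull g q * pull g b" using q(1) g by (simp add: invariant_iff)
    also have "\<dots> = pull g (q * b)" by (simp only: pull_hom[OF g])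
    also have "\<dots> = q * b" using q(3) g by (simp add: invariant_iff)
    finally have "q * pull g b = q * b" .
    then show ?thesis using q(2) by simp
  qed
  then show "b \<in> invariant_polys G \<phi>" by (simp add: invariant_iff)
qed (simp_all add: invariant_iff pull_hom)

lemma tower_stable:
  assumes "tower ts K"
  shows "stable_trace K \<and> set ts \<subseteq> K \<and> invariant_polys G \<phi> \<subseteq> K"
  using assms
proof induction
  case base
  then show ?case using stable_trace_invariants by simp
next
  case (step ts K v)
  then have K: "stable_trace K" and sub: "set ts \<subseteq> K" "invariant_polys G \<phi> \<subseteq> K" by simp_all
  have "K \<subseteq> adjoin K v" "v \<in> adjoin K v"
    using polyval_ring(1,2)[OF K] adjoin_superset[OF K] by blast+
  then have "set (v # ts) \<subseteq> adjoin K v" "invariant_polys G \<phi> \<subseteq> adjoin K v"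
    using sub by auto
  then show ?case using stable_trace_adjoin[OF K step(3)] by blast
qed

text \<open>A relation is read as a polynomial in the newest generator \<open>v\<close> over
  \<open>K\<close>. By \<open>transcendental\<close> its coefficients vanish, and these are
  relations for the shorter list. At the bottom, the chain of primes 0 and (c) shows that
  \<open>c\<close> satisfies no relation over the constants.\<close>

lemma tower_indep:
  assumes "tower ts K" and c: "irreducible c" "c \<in> invariant_polys G \<phi>"
    and "(\<Sum>\<alpha>\<in>expos (length (ts @ [c])) D. mconst (u \<alpha>) * monomial (ts @ [c]) \<alpha>) = 0"
    and "\<alpha> \<in> expos (length (ts @ [c])) D"
  shows "u \<alpha> = 0"
  using assms(1,4,5)
proof (induction arbitrary: u \<alpha>)
  case base
  have "c \<noteq> 0" using c by auto
  then have "prime_chain {0} [c]"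
    using primeideal_zero primeideal_multiples[OF c(1)] by (auto intro!: exI[of _ "{f. c dvd f}"])
  from prime_chain_indep[OF this, of u D \<alpha>] base show ?case by simp
next
  case (step ts K v)
  have K: "stable_trace K" "set ts \<subseteq> K" "invariant_polys G \<phi> \<subseteq> K" using tower_stable[OF step(1)] by auto
  note KD = stable_traceD[OF K(1)]
  let ?fs = "ts @ [c]"
  define S where "S a = (\<Sum>\<beta>\<in>expos (length ?fs) D. mconst (u (a # \<beta>)) * monomial ?fs \<beta>)" for a
  have mon: "monomial fs \<beta> \<in> K" if "set fs \<subseteq> K" for fs \<beta>
    using that by (induction fs \<beta> rule: monomial.induct) (auto intro: KD)
  have fsK: "set ?fs \<subseteq> K" using K c(2) by auto
  have SK: "S a \<in> K" for a unfolding S_def by (intro KD(13) KD(3) KD(6) mon fsK)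
  define P where "P = (\<Sum>a\<le>D. monom (S a) a)"
  have cP: "coeff P a = (if a \<le> D then S a else 0)" for a by (simp add: P_def coeff_sum)
  have "poly P v = (\<Sum>a\<le>D. S a * v ^ a)" by (simp add: P_def poly_sum poly_monom)
  also have "\<dots> = 0"
    using step.prems(1) unfolding append_Cons monomial_sum_Cons S_def .
  finally have "poly P v = 0" .
  moreover have "coeff P i \<in> K" for i using SK KD(7) by (simp add: cP)
  ultimately have "P = 0" using transcendental[OF K(1) step(2) step(3)] by blast
  then have S0: "S a = 0" if "a \<le> D" for a using cP[of a] that by simp
  obtain a \<beta> where \<alpha>: "\<alpha> = a # \<beta>" "a \<le> D" "\<beta> \<in> expos (length ?fs) D"
    using step.prems(2) by (auto simp: expos_def length_Suc_conv)
  have "(\<Sum>\<beta>\<in>expos (length ?fs) D. mconst (u (a # \<beta>)) * monomial ?fs \<beta>) = 0"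
    using S0[OF \<alpha>(2)] unfolding S_def .
  from step.IH[OF this \<alpha>(3)] show ?case by (simp add: \<alpha>)
qed

lemma tower_length:
  assumes "tower ts K" "irreducible c" "c \<in> invariant_polys G \<phi>"
  shows "length ts \<noteq> CARD('n)"
proof
  assume "length ts = CARD('n)"
  then have "length (ts @ [c]) = Suc CARD('n)" by simp
  from algebraic_dependence[OF this] obtain D u where
    u: "\<exists>\<alpha>\<in>expos (length (ts @ [c])) D. u \<alpha> \<noteq> 0"
    "(\<Sum>\<alpha>\<in>expos (length (ts @ [c])) D. mconst (u \<alpha>) * monomial (ts @ [c]) \<alpha>) = 0" by blast
  from u(1) tower_indep[OF assms u(2)] show False by blast
qed

text \<open>While \<open>K\<close> misses a polynomial, \<open>fixed_vector\<close> for
  \<open>K\<close> inside all polynomials supplies the next \<open>v\<close>. If no short tower were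
  complete, towers would reach length n, and with \<open>c\<close> this makes n + 1 independent
  polynomials.\<close>

lemma complete_tower:
  assumes c: "irreducible c" "c \<in> invariant_polys G \<phi>"
  shows "\<exists>ts. tower ts UNIV \<and> length ts < CARD('n)"
proof (rule ccontr)
  assume no: "\<not> ?thesis"
  have "\<exists>ts K. tower ts K \<and> length ts = r" if "r \<le> CARD('n)" for r
    using that
  proof (induction r)
    case 0
    then show ?case using tower.base by auto
  next
    case (Suc r)
    then obtain ts K where t: "tower ts K" "length ts = r" by auto
    then have "K \<noteq> UNIV" using no Suc.prems by auto
    then obtain p where "p \<notin> K" by blast
    moreover have "0 \<in> K" using tower_stable[OF t(1)] stable_traceD(7) by blast
    ultimately obtain v where "v \<notin> K" "\<And>g. g \<in> carrier G \<Longrightarrow> dif g v \<in> K"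
      using fixed_vector[of K p UNIV] by auto
    then have "tower (v # ts) (adjoin K v)" by (intro tower.step t(1))
    then show ?case using t(2) by (intro exI[of _ "v # ts"] exI[of _ "adjoin K v"]) simp
  qed
  then obtain ts K where "tower ts K" "length ts = CARD('n)" by blast
  then show False using tower_length c by blast
qed

lemma tower_field:
  assumes "tower ts K" and inv: "invariant_polys G \<phi> = generated_algebra c" and F: "is_subfield F"
    "range (\<lambda>a. mfract (mconst a)) \<subseteq> F" "mfract c \<in> F" and "mfract ` set ts \<subseteq> F" "b \<in> K"
  shows "mfract b \<in> F"
  using assms(1,6,7)
proof (induction arbitrary: b)
  case base
  then obtain q :: "'k poly" where q: "b = poly (map_poly mconst q) c" using inv by (auto simp: generated_algebra_def)
  show ?case unfolding q
    by (rule mfract_poly_mem[OF F(1,3)]) (use F(2) in \<open>auto simp: coeff_map_poly\<close>)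
next
  case (step ts K v)
  then show ?case using adjoin_mfract_mem[OF F(1), of v K b] by auto
qed

lemma rational_coordinateI:
  assumes c: "irreducible c" and inv: "invariant_polys G \<phi> = generated_algebra c"
  shows "rational_coordinate c"
proof -
  have "c \<in> generated_algebra c" unfolding generated_algebra_def
    by (rule image_eqI[of _ _ "[:0, 1:]"]) (simp_all add: map_poly_pCons)
  then obtain ts where ts: "tower ts UNIV" "length ts < CARD('n)" using complete_tower[OF c] inv by blast
  \<comment> \<open>List positions start at 0 and the generators at 1; a tower shorter than n - 1 is
    padded with 0.\<close>
  define f where "f i = (if i \<le> length ts then mfract (ts ! (i - 1)) else 0)" for i
  let ?S = "insert (mfract c) (f ` {1..CARD('n) - 1})"
  have "x \<in> F" if F: "is_subfield F" "range (\<lambda>a. mfract (mconst a)) \<subseteq> F" and S: "?S \<subseteq> F" for F x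
  proof -
    have "mfract t \<in> F" if t: "t \<in> set ts" for t
    proof -
      obtain i where i: "i < length ts" "t = ts ! i" using t by (auto simp: in_set_conv_nth)
      then have "mfract t = f (Suc i)" "Suc i \<in> {1..CARD('n) - 1}" using ts(2) by (simp_all add: f_def)
      then have "mfract t \<in> f ` {1..CARD('n) - 1}" by (rule image_eqI)
      then show ?thesis using S by blast
    qed
    then have mF: "mfract b \<in> F" for b
      using tower_field[OF ts(1) inv F, of b] S by auto
    \<comment> \<open>A field that contains all polynomials contains all their quotients.\<close>
    obtain a b where ab: "x = Fract a b" "b \<noteq> 0" by (cases x) auto
    then have "x = mfract a * inverse (mfract b)" by (simp add: mfract_def)
    then show "x \<in> F" using is_subfieldD(2,3)[OF F(1)] mF by simp
  qed
  then have "generated_field ?S = UNIV" unfolding generated_field_def hull_def by blast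
  then show ?thesis unfolding rational_coordinate_def using c by blast
qed

end

theorem theorem2:
  fixes U :: "('m::finite \<Rightarrow> 'k::{alg_closed_field, field_char_0}) monoid"
    and \<phi> :: "('m \<Rightarrow> 'k) \<Rightarrow> ('n::{finite, linorder} \<Rightarrow> 'k) \<Rightarrow> ('n \<Rightarrow> 'k)"
  assumes "unipotent_algebraic_group U"
    and "regular_action U \<phi>"
    and "\<exists>a. orbit_dim U \<phi> a = enat (CARD('n) - 1)"
    and "\<forall>a. orbit_dim U \<phi> a \<le> enat (CARD('n) - 1)"
  shows "\<exists>c :: ('n, 'k) mpoly. rational_coordinate c \<and> invariant_polys U \<phi> = generated_algebra c"
proof -
  interpret unipotent_action U \<phi> using assms(1,2) by unfold_locales
  obtain a where a: "orbit_dim U \<phi> a = enat (CARD('n) - 1)" using assms(3) by blast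
  obtain c where c: "irreducible c" "van (orbit U \<phi> a) = {f. c dvd f}" using orbit_ideal_principal[OF a] by blast
  have inv: "invariant_polys U \<phi> = generated_algebra c" by (rule invariants_generated[OF c])
  show ?thesis using rational_coordinateI[OF c(1) inv] inv by blast
qed

end
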